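(* Fix $\delta>0$ and let $\hat\theta_{\rm GE_0}$ be a consistent (as $n\to\infty$) root in $\theta\in\Theta$ of $\mathbf y^TA_{b_0,\theta}(I_n-A_{b_0,\theta})\mathbf y=\mathrm{tr}\,A_{b_0,\theta}$ (i.e. with $b$ fixed at the true $b_0$). If $\int a_0^2h_0\ne0$, then as $n\to\infty$ $$n^{1/2}(\hat\theta_{\rm GE_0}-\theta_0)\to_{\mathcal D}N\Big(0,\;4\pi\int a_0^2\,\big(\textstyle\int a_0^2h_0\big)^{-2}\Big).$$ Moreover, defining $I^0_{\delta,b_0,\theta_0}$ as the ratio of this asymptotic variance to $4\pi(\int a_0^2h_0^2)^{-1}$, one has $I^0_{\delta,b_0,\theta_0}=1+J_0(h_0)$ and $I^0_{\delta,b_0,\theta_0}\to1$ as $\delta\to0$.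
   Context: Fix $\nu\ge1/2$. For $\alpha>0$, $\omega\in\mathbb R$ let $g^*_{\nu,\alpha}(\omega)=C_\nu\alpha^{2\nu}(\alpha^2+\omega^2)^{-(\nu+1/2)}$ with $C_\nu=\Gamma(\nu+\frac12)/(\sqrt\pi\,\Gamma(\nu))$. For $\delta,\theta>0$ and $\lambda\in[-\pi,\pi]$ let $g^\delta_{\nu,\theta}(\lambda)=\sum_{k\in\mathbb Z}g^*_{\nu,\delta\theta}(\lambda+2k\pi)$, $h^\delta_{\nu,\theta}=\partial\log g^\delta_{\nu,\theta}/\partial\theta$, and for $b>0$, $a^\delta_{b,\theta}=\dfrac{b\,g^\delta_{\nu,\theta}}{b\,g^\delta_{\nu,\theta}+(2\pi)^{-1}}$. All integrals $\int$ without limits are over $[-\pi,\pi]$ in $\lambda$. Model: $Z$ is a zero-mean stationary Gaussian process on $\mathbb R$ with $\mathrm{Cov}(Z(s),Z(t))=b_0K_{\nu,\theta_0}(t-s)$, $K_{\nu,\theta}(t)=\int_{\mathbb R}g^*_{\nu,\theta}(\omega)\cos(\omega t)d\omega$, $b_0,\theta_0>0$. $\mathbf z=(Z(\delta),\dots,Z(n\delta))^T$, $\mathbf y=\mathbf z+\boldsymbol\varepsilon$, $\boldsymbol\varepsilon\sim N(0,I_n)$ independent of $Z$. $R_\theta$ is the $n\times n$ matrix $[K_{\nu,\theta}(\delta|j-k|)]_{j,k}$, $A_{b,\theta}=bR_\theta(I_n+bR_\theta)^{-1}$. $\Theta$ is a compact interval not containing $0$ with $\theta_0$ in its interior. Notation: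 $h_0=h^\delta_{\nu,\theta_0}$, $a_0=a^\delta_{b_0,\theta_0}$; with $w=a_0^2$, $J_0(f):=\dfrac{(\int w)(\int wf^2)}{(\int wf)^2}-1$. The quantity $4\pi(\int a_0^2h_0^2)^{-1}$ is the asymptotic variance of the ML estimator of $\theta_0$ when $b_0$ is known. *)

theory Defs
  imports "HOL-Probability.Probability" "Jordan_Normal_Form.Matrix" "Jordan_Normal_Form.Gauss_Jordan_Elimination"
begin

definition Cnu :: "real \<Rightarrow> real" where
  "Cnu \<nu> = Gamma (\<nu> + 1/2) / (sqrt pi * Gamma \<nu>)"

definition gstar :: "real \<Rightarrow> real \<Rightarrow> real \<Rightarrow> real" where
  "gstar \<nu> \<alpha> \<omega> = Cnu \<nu> * \<alpha> powr (2*\<nu>) * (\<alpha>\<^sup>2 + \<omega>\<^sup>2) powr (-(\<nu> + 1/2))"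

definition Kmat :: "real \<Rightarrow> real \<Rightarrow> real \<Rightarrow> real" where
  "Kmat \<nu> \<theta> t = (LINT \<omega>|lborel. gstar \<nu> \<theta> \<omega> * cos (\<omega> * t))"

definition gdelta :: "real \<Rightarrow> real \<Rightarrow> real \<Rightarrow> real \<Rightarrow> real" where
  "gdelta \<nu> \<delta> \<theta> x = (\<Sum>\<^sub>\<infinity>k::int. gstar \<nu> (\<delta> * \<theta>) (x + 2 * real_of_int k * pi))"

definition hdelta :: "real \<Rightarrow> real \<Rightarrow> real \<Rightarrow> real \<Rightarrow> real" where
  "hdelta \<nu> \<delta> \<theta> x = deriv (\<lambda>t. ln (gdelta \<nu> \<delta> t x)) \<theta>"

definition adelta :: "real \<Rightarrow> real \<Rightarrow> real \<Rightarrow> real \<Rightarrow> real \<Rightarrow> real" where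
  "adelta \<nu> \<delta> b \<theta> x = b * gdelta \<nu> \<delta> \<theta> x / (b * gdelta \<nu> \<delta> \<theta> x + 1 / (2 * pi))"

definition Jfun :: "(real \<Rightarrow> real) \<Rightarrow> (real \<Rightarrow> real) \<Rightarrow> real" where
  "Jfun a f = (integral {-pi..pi} (\<lambda>x. (a x)\<^sup>2)) * (integral {-pi..pi} (\<lambda>x. (a x)\<^sup>2 * (f x)\<^sup>2))
      / (integral {-pi..pi} (\<lambda>x. (a x)\<^sup>2 * f x))\<^sup>2 - 1"

definition avarGE0 :: "real \<Rightarrow> real \<Rightarrow> real \<Rightarrow> real \<Rightarrow> real" where
  "avarGE0 \<nu> \<delta> b0 \<theta>0 = 4 * pi * integral {-pi..pi} (\<lambda>x. (adelta \<nu> \<delta> b0 \<theta>0 x)\<^sup>2)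
      / (integral {-pi..pi} (\<lambda>x. (adelta \<nu> \<delta> b0 \<theta>0 x)\<^sup>2 * hdelta \<nu> \<delta> \<theta>0 x))\<^sup>2"

text \<open>Asymptotic variance 4 pi (int a_0^2 h_0^2)^-1 of the ML estimator (b_0 known)\<close>
definition avarML :: "real \<Rightarrow> real \<Rightarrow> real \<Rightarrow> real \<Rightarrow> real" where
  "avarML \<nu> \<delta> b0 \<theta>0 = 4 * pi / integral {-pi..pi}
      (\<lambda>x. (adelta \<nu> \<delta> b0 \<theta>0 x)\<^sup>2 * (hdelta \<nu> \<delta> \<theta>0 x)\<^sup>2)"

definition I0 :: "real \<Rightarrow> real \<Rightarrow> real \<Rightarrow> real \<Rightarrow> real" where
  "I0 \<nu> \<delta> b0 \<theta>0 = avarGE0 \<nu> \<delta> b0 \<theta>0 / avarML \<nu> \<delta> b0 \<theta>0"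

section \<open>Matrices (n varies, so Jordan_Normal_Form matrices are used)\<close>

definition Rmat :: "real \<Rightarrow> real \<Rightarrow> real \<Rightarrow> nat \<Rightarrow> real mat" where
  "Rmat \<nu> \<delta> \<theta> n = mat n n (\<lambda>(j,k). Kmat \<nu> \<theta> (\<delta> * \<bar>real j - real k\<bar>))"

definition Amat :: "real \<Rightarrow> real \<Rightarrow> real \<Rightarrow> real \<Rightarrow> nat \<Rightarrow> real mat" where
  "Amat \<nu> \<delta> b \<theta> n = (b \<cdot>\<^sub>m Rmat \<nu> \<delta> \<theta> n) *
      the (mat_inverse (1\<^sub>m n + b \<cdot>\<^sub>m Rmat \<nu> \<delta> \<theta> n))"

definition mtrace :: "real mat \<Rightarrow> real" where
  "mtrace M = (\<Sum>i<dim_row M. M $$ (i,i))"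

definition GE0_eq :: "real \<Rightarrow> real \<Rightarrow> real \<Rightarrow> real \<Rightarrow> nat \<Rightarrow> real vec \<Rightarrow> bool" where
  "GE0_eq \<nu> \<delta> b \<theta> n y \<longleftrightarrow>
     y \<bullet> ((Amat \<nu> \<delta> b \<theta> n * (1\<^sub>m n - Amat \<nu> \<delta> b \<theta> n)) *\<^sub>v y) = mtrace (Amat \<nu> \<delta> b \<theta> n)"

definition centered_normal :: "'a measure \<Rightarrow> ('a \<Rightarrow> real) \<Rightarrow> real \<Rightarrow> bool" where
  "centered_normal M X v \<longleftrightarrow> X \<in> borel_measurable M \<and>
     (if v = 0 then (AE \<omega> in M. X \<omega> = 0) else distributed M lborel X (normal_density 0 (sqrt v)))"

definition gaussian_process :: "'a measure \<Rightarrow> (real \<Rightarrow> 'a \<Rightarrow> real) \<Rightarrow> (real \<Rightarrow> real \<Rightarrow> real) \<Rightarrow> bool" where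
  "gaussian_process M Z C \<longleftrightarrow>
     (\<forall>(ts :: real list) (cs :: real list). length cs = length ts \<longrightarrow>
        centered_normal M (\<lambda>\<omega>. \<Sum>i<length ts. cs!i * Z (ts!i) \<omega>)
          (\<Sum>i<length ts. \<Sum>j<length ts. cs!i * cs!j * C (ts!i) (ts!j)))"

end

theory Submission
  imports Defs "HOL-Analysis.Weierstrass_Theorems" "HOL-Real_Asymp.Real_Asymp" "Jordan_Normal_Form.Determinant"
begin

text \<open>
  Write \<open>S(\<theta>)\<close> for the estimating function \<open>y \<bullet> A(I - A)y - tr A\<close>. The matrix \<open>b R\<^sub>\<theta>\<close> is the Toeplitz
  matrix of the symbol \<open>2\<pi> b g\<^sub>\<theta>\<close>, whose \<open>\<theta>\<close>-dependence has a uniform second order expansion; hence, in operator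
  norm, \<open>S(\<theta>) - S(\<theta>\<^sub>0) = -(\<theta> - \<theta>\<^sub>0) V + O((\<theta> - \<theta>\<^sub>0)\<^sup>2 (|y|\<^sup>2 + n))\<close> with \<open>V\<close> a quadratic form in \<open>y\<close> plus a constant.
  Diagonalising such a form together with the inverse covariance turns it, after centring, into
  \<open>\<Sum> \<gamma>\<^sub>j (w\<^sub>j\<^sup>2 - 1)\<close> with independent standard normal \<open>w\<^sub>j\<close> and uniformly bounded \<open>\<gamma>\<^sub>j\<close>. This gives a central limit
  theorem for \<open>S(\<theta>\<^sub>0)\<close>, whose variance is governed by \<open>tr A\<^sup>2\<close>, and a law of large numbers for \<open>V\<close>. The traces
  converge because \<open>T\<^sub>n(f) T\<^sub>n(g) - T\<^sub>n(f g)\<close> is small in normalised Frobenius norm: this is elementary for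
  \<open>g = cos\<close>, is inherited by polynomials in \<open>cos\<close>, and passes to even continuous \<open>g\<close> by Weierstrass approximation.

  As \<open>\<delta> \<rightarrow> 0\<close>, \<open>h\<close> differs from the constant \<open>2\<nu>/\<theta>\<close> essentially only on \<open>|\<lambda>| = O(\<delta>)\<close>, whereas the weight
  \<open>a\<^sup>2\<close> is of order one up to \<open>|\<lambda>|\<close> of order \<open>\<delta>\<^sup>p\<close>, \<open>p = 2\<nu>/(2\<nu> + 1) < 1\<close>; so \<open>J\<^sub>0(h) \<rightarrow> 0\<close>.
\<close>

unbundle no inner_syntax and no vec_syntax

section \<open>Operator and Frobenius bounds\<close>

text \<open>Everything rests on \<open>Sig = I + b R\<close> being at least the identity: its
  inverse \<open>I - A\<close> has operator norm at most one for every \<open>n\<close> and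
  \<open>\<theta>\<close>. The expansion thus needs bounds on the symbol only, and its remainder
  stays under control although the root is random. At the true parameter
  \<open>A (I - A) Sig = A\<close>. The estimating function is therefore centred, with variance
  \<open>2 tr A^2\<close>. Since \<open>tr A^2 / n\<close> and \<open>V / n\<close> tend to the
  integrals of \<open>a^2\<close> and \<open>a^2 h\<close> divided by \<open>2 pi\<close>, variance
  over squared slope produces the factor \<open>4 pi\<close>. The model supplies only the laws of
  linear combinations of the observations, so the independence of the \<open>w\<^sub>j\<close> has
  to be extracted from characteristic functions. The exponent \<open>p\<close> balances
  \<open>\<delta>^(2\<nu>)\<close> against \<open>|\<lambda>|^(2\<nu>+1)\<close>: there the spectra
  of signal and noise are of equal order. The condition \<open>\<nu> \<ge> 1/2\<close> makes the
  aliased terms decay at least like \<open>1 / k^2\<close>, uniformly in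
  \<open>\<theta>\<close>.\<close>

definition vnorm :: "real vec \<Rightarrow> real" where
  "vnorm x = L2_set (\<lambda>i. x $ i) {..<dim_vec x}"

definition frob :: "real mat \<Rightarrow> real" where
  "frob X = L2_set (\<lambda>(i,j). X $$ (i,j)) ({..<dim_row X} \<times> {..<dim_col X})"

text \<open>A bound rather than the norm itself: no supremum has to be formed, and uniformity in the
  dimension is expressed by one \<open>c\<close> for all \<open>n\<close>.\<close>

definition opb :: "nat \<Rightarrow> real \<Rightarrow> real mat \<Rightarrow> bool" where
  "opb n c X \<longleftrightarrow> X \<in> carrier_mat n n \<and> 0 \<le> c \<and> (\<forall>x\<in>carrier_vec n. vnorm (X *\<^sub>v x) \<le> c * vnorm x)"

lemma vnorm_nonneg [simp]: "0 \<le> vnorm x"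
  by (simp add: vnorm_def)

lemma vnorm_sq: "(vnorm x)\<^sup>2 = x \<bullet> x"
  by (simp add: vnorm_def L2_set_def scalar_prod_def sum_nonneg power2_eq_square atLeast0LessThan)

lemma vnorm_zero [simp]: "vnorm (0\<^sub>v n) = 0"
  by (simp add: vnorm_def L2_set_def)

lemma vnorm_add_le: "x \<in> carrier_vec n \<Longrightarrow> y \<in> carrier_vec n \<Longrightarrow> vnorm (x + y) \<le> vnorm x + vnorm y"
  using L2_set_triangle_ineq[of "\<lambda>i. x $ i" "\<lambda>i. y $ i" "{..<n}"]
  by (auto simp: vnorm_def cong: L2_set_cong_simp)

lemma vnorm_smult: "vnorm (c \<cdot>\<^sub>v x) = \<bar>c\<bar> * vnorm x"
proof -
  have "vnorm (c \<cdot>\<^sub>v x) = L2_set (\<lambda>i. \<bar>c\<bar> * x $ i) {..<dim_vec x}"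
    unfolding vnorm_def by (auto simp: L2_set_def power_mult_distrib)
  then show ?thesis by (simp add: L2_set_right_distrib vnorm_def)
qed

lemma scalar_prod_le: "x \<in> carrier_vec n \<Longrightarrow> y \<in> carrier_vec n \<Longrightarrow> \<bar>x \<bullet> y\<bar> \<le> vnorm x * vnorm y"
proof -
  assume x: "x \<in> carrier_vec n" and y: "y \<in> carrier_vec n"
  have "\<bar>x \<bullet> y\<bar> \<le> (\<Sum>i<n. \<bar>x $ i\<bar> * \<bar>y $ i\<bar>)"
    using y by (auto simp: scalar_prod_def atLeast0LessThan abs_mult[symmetric] intro: sum_abs)
  also have "\<dots> \<le> vnorm x * vnorm y"
    using L2_set_mult_ineq[of "\<lambda>i. x $ i" "\<lambda>i. y $ i" "{..<n}"] x y by (auto simp: vnorm_def)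
  finally show ?thesis .
qed

lemma vnorm_eq_0D: "x \<in> carrier_vec n \<Longrightarrow> vnorm x = 0 \<Longrightarrow> x = 0\<^sub>v n"
  by (auto simp: vnorm_def L2_set_eq_0_iff intro!: eq_vecI)

lemma opb_carrier: "opb n c X \<Longrightarrow> X \<in> carrier_mat n n"
  and opb_nonneg: "opb n c X \<Longrightarrow> 0 \<le> c"
  and opbD: "opb n c X \<Longrightarrow> x \<in> carrier_vec n \<Longrightarrow> vnorm (X *\<^sub>v x) \<le> c * vnorm x"
  by (auto simp: opb_def)

lemma opb_mono: "opb n c X \<Longrightarrow> c \<le> d \<Longrightarrow> opb n d X"
  unfolding opb_def by (meson mult_right_mono order_trans vnorm_nonneg)

lemma opb_one: "opb n 1 (1\<^sub>m n)"
  by (auto simp: opb_def)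

lemma opb_add: "opb n c X \<Longrightarrow> opb n d Y \<Longrightarrow> opb n (c + d) (X + Y)"
proof -
  assume X: "opb n c X" and Y: "opb n d Y"
  have XY: "X \<in> carrier_mat n n" "Y \<in> carrier_mat n n" using X Y by (auto simp: opb_def)
  { fix x :: "real vec" assume x: "x \<in> carrier_vec n"
    have "vnorm ((X + Y) *\<^sub>v x) = vnorm (X *\<^sub>v x + Y *\<^sub>v x)"
      using XY x by (simp add: add_mult_distrib_mat_vec[of _ n n])
    also have "\<dots> \<le> vnorm (X *\<^sub>v x) + vnorm (Y *\<^sub>v x)"
      using XY x by (intro vnorm_add_le[of _ n]) auto
    also have "\<dots> \<le> c * vnorm x + d * vnorm x"
      using opbD[OF X x] opbD[OF Y x] by simp
    finally have "vnorm ((X + Y) *\<^sub>v x) \<le> (c + d) * vnorm x" by (simp add: algebra_simps) }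
  then show ?thesis using X Y by (auto simp: opb_def)
qed

lemma smult_mat_mult_vec: "X \<in> carrier_mat n n \<Longrightarrow> x \<in> carrier_vec n \<Longrightarrow> (a \<cdot>\<^sub>m X) *\<^sub>v x = a \<cdot>\<^sub>v (X *\<^sub>v (x::real vec))"
  by (auto intro!: eq_vecI simp: scalar_prod_def sum_distrib_left mult.assoc)

lemma opb_smult: "opb n c X \<Longrightarrow> opb n (\<bar>a\<bar> * c) (a \<cdot>\<^sub>m X)"
  by (auto simp: opb_def smult_mat_mult_vec vnorm_smult mult.assoc mult_left_mono)

lemma uminus_smult: "- X = (-1) \<cdot>\<^sub>m (X :: real mat)"
  by (auto intro!: eq_matI)

lemma opb_uminus: "opb n c X \<Longrightarrow> opb n c (- X)"
  using opb_smult[of n c X "-1"] by (simp add: uminus_smult)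

lemma opb_diff: "opb n c X \<Longrightarrow> opb n d Y \<Longrightarrow> opb n (c + d) (X - Y)"
proof -
  assume X: "opb n c X" and Y: "opb n d Y"
  have "X - Y = X + - Y" using X Y by (auto simp: opb_def)
  then show ?thesis using opb_add[OF X opb_uminus[OF Y]] by simp
qed

lemma opb_mult: "opb n c X \<Longrightarrow> opb n d Y \<Longrightarrow> opb n (c * d) (X * Y)"
proof -
  assume X: "opb n c X" and Y: "opb n d Y"
  have XY: "X \<in> carrier_mat n n" "Y \<in> carrier_mat n n" "0 \<le> c" "0 \<le> d" using X Y by (auto simp: opb_def)
  { fix x :: "real vec" assume x: "x \<in> carrier_vec n"
    have "vnorm ((X * Y) *\<^sub>v x) = vnorm (X *\<^sub>v (Y *\<^sub>v x))"
      using XY x by simp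
    also have "\<dots> \<le> c * vnorm (Y *\<^sub>v x)" using XY x by (intro opbD[OF X]) auto
    also have "\<dots> \<le> c * (d * vnorm x)" using opbD[OF Y x] XY by (intro mult_left_mono) auto
    finally have "vnorm ((X * Y) *\<^sub>v x) \<le> (c * d) * vnorm x" by (simp add: algebra_simps) }
  then show ?thesis using XY by (auto simp: opb_def)
qed

lemma vnorm_quad_le: "opb n c X \<Longrightarrow> x \<in> carrier_vec n \<Longrightarrow> \<bar>x \<bullet> (X *\<^sub>v x)\<bar> \<le> c * (vnorm x)\<^sup>2"
proof -
  assume X: "opb n c X" and x: "x \<in> carrier_vec n"
  have "\<bar>x \<bullet> (X *\<^sub>v x)\<bar> \<le> vnorm x * vnorm (X *\<^sub>v x)"
    using X x by (intro scalar_prod_le[of _ n]) (auto simp: opb_def)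
  also have "\<dots> \<le> vnorm x * (c * vnorm x)" by (intro mult_left_mono opbD[OF X x]) auto
  finally show ?thesis by (simp add: power2_eq_square mult_ac)
qed

lemma transpose_scalar_prod:
  "X \<in> carrier_mat n n \<Longrightarrow> x \<in> carrier_vec n \<Longrightarrow> y \<in> carrier_vec n \<Longrightarrow> (X\<^sup>T *\<^sub>v x) \<bullet> y = x \<bullet> (X *\<^sub>v (y::real vec))"
  by (simp add: transpose_vec_mult_scalar)

text \<open>With \<open>z\<close> the image of \<open>x\<close> under the transpose,
  \<open>|z|^2 = x . X z \<le> c |x| |z|\<close>; then \<open>|z|\<close> is cancelled.\<close>

lemma opb_transpose: "opb n c X \<Longrightarrow> opb n c (X\<^sup>T)"
proof -
  assume X: "opb n c X"
  have XY: "X \<in> carrier_mat n n" "0 \<le> c" using X by (auto simp: opb_def)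
  { fix x :: "real vec" assume x: "x \<in> carrier_vec n"
    define z where "z = X\<^sup>T *\<^sub>v x"
    have z: "z \<in> carrier_vec n" using XY x by (simp add: z_def)
    have "(vnorm z)\<^sup>2 = x \<bullet> (X *\<^sub>v z)" unfolding vnorm_sq
      by (subst (1) z_def) (rule transpose_scalar_prod[OF XY(1) x z])
    also have "\<dots> \<le> vnorm x * vnorm (X *\<^sub>v z)"
      using scalar_prod_le[of x n "X *\<^sub>v z"] XY x z by simp
    also have "\<dots> \<le> vnorm x * (c * vnorm z)" by (intro mult_left_mono opbD[OF X z]) auto
    finally have "vnorm z * vnorm z \<le> (c * vnorm x) * vnorm z" by (simp add: power2_eq_square mult_ac)
    then have "vnorm z \<le> c * vnorm x"
      using XY vnorm_nonneg[of z] vnorm_nonneg[of x] by (cases "vnorm z = 0") auto }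
  then show ?thesis using XY by (auto simp: opb_def)
qed

lemma frob_nonneg [simp]: "0 \<le> frob X"
  by (simp add: frob_def)

lemma frob_sq_cols: "X \<in> carrier_mat n n \<Longrightarrow> (frob X)\<^sup>2 = (\<Sum>j<n. (vnorm (col X j))\<^sup>2)"
proof -
  assume X: "X \<in> carrier_mat n n"
  have "(frob X)\<^sup>2 = (\<Sum>i<n. \<Sum>j<n. (X $$ (i,j))\<^sup>2)"
    using X by (auto simp: frob_def L2_set_def sum_nonneg sum.cartesian_product case_prod_beta)
  also have "\<dots> = (\<Sum>j<n. \<Sum>i<n. (X $$ (i,j))\<^sup>2)" by (rule sum.swap)
  also have "\<dots> = (\<Sum>j<n. (vnorm (col X j))\<^sup>2)"
    using X by (auto simp: vnorm_def L2_set_def sum_nonneg intro!: sum.cong)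
  finally show ?thesis .
qed

lemma frob_transpose: "X \<in> carrier_mat n n \<Longrightarrow> frob (X\<^sup>T) = frob X"
proof -
  assume X: "X \<in> carrier_mat n n"
  have "(\<Sum>i<n. \<Sum>j<n. (X $$ (j,i))\<^sup>2) = (\<Sum>i<n. \<Sum>j<n. (X $$ (i,j))\<^sup>2)" by (rule sum.swap)
  then have "(\<Sum>x\<in>{..<n}\<times>{..<n}. (X\<^sup>T $$ x)\<^sup>2) = (\<Sum>x\<in>{..<n}\<times>{..<n}. (X $$ x)\<^sup>2)"
    using X by (auto simp: sum.cartesian_product case_prod_beta intro!: sum.cong elim!: trans[rotated])
  then show ?thesis
    using X by (auto simp: frob_def L2_set_def case_prod_beta)
qed

text \<open>Column \<open>j\<close> of \<open>X * Y\<close> is \<open>X\<close> applied to column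
  \<open>j\<close> of \<open>Y\<close>, and the squared Frobenius norm is the sum of the squared
  column norms. Mixing the two norms lets a small Frobenius error survive multiplication by bounded
  matrices.\<close>

lemma frob_mult_left: "opb n c X \<Longrightarrow> Y \<in> carrier_mat n n \<Longrightarrow> frob (X * Y) \<le> c * frob Y"
proof (rule power2_le_imp_le)
  assume X: "opb n c X" and Y: "Y \<in> carrier_mat n n"
  have X': "X \<in> carrier_mat n n" "0 \<le> c" using X by (auto simp: opb_def)
  have "(frob (X * Y))\<^sup>2 = (\<Sum>j<n. (vnorm (col (X * Y) j))\<^sup>2)"
    using X' Y by (intro frob_sq_cols) auto
  also have "\<dots> \<le> (\<Sum>j<n. c\<^sup>2 * (vnorm (col Y j))\<^sup>2)"
  proof (rule sum_mono)
    fix j assume "j \<in> {..<n}"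
    then have "col (X * Y) j = X *\<^sub>v col Y j" using X' Y by (auto intro!: eq_vecI)
    then have "vnorm (col (X * Y) j) \<le> c * vnorm (col Y j)"
      using opbD[OF X] Y by auto
    then show "(vnorm (col (X * Y) j))\<^sup>2 \<le> c\<^sup>2 * (vnorm (col Y j))\<^sup>2"
      by (metis power_mono power_mult_distrib vnorm_nonneg)
  qed
  also have "\<dots> = (c * frob Y)\<^sup>2"
    by (simp add: power_mult_distrib frob_sq_cols[OF Y] sum_distrib_left)
  finally show "(frob (X * Y))\<^sup>2 \<le> (c * frob Y)\<^sup>2" .
qed (auto simp: opb_def)

lemma frob_mult_right: "opb n c X \<Longrightarrow> Y \<in> carrier_mat n n \<Longrightarrow> frob (Y * X) \<le> c * frob Y"
proof -
  assume X: "opb n c X" and Y: "Y \<in> carrier_mat n n"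
  have X': "X \<in> carrier_mat n n" "0 \<le> c" using X by (auto simp: opb_def)
  have "frob (Y * X) = frob ((Y * X)\<^sup>T)" using X' Y by (subst frob_transpose[of _ n]) auto
  also have "(Y * X)\<^sup>T = X\<^sup>T * Y\<^sup>T" using X' Y by (rule_tac transpose_mult) auto
  also have "frob (X\<^sup>T * Y\<^sup>T) \<le> c * frob (Y\<^sup>T)"
    using X Y by (intro frob_mult_left opb_transpose) auto
  finally show ?thesis using Y frob_transpose[OF Y] by simp
qed

lemma frob_add_le: "X \<in> carrier_mat n n \<Longrightarrow> Y \<in> carrier_mat n n \<Longrightarrow> frob (X + Y) \<le> frob X + frob Y"
proof -
  assume X: "X \<in> carrier_mat n n" and Y: "Y \<in> carrier_mat n n"
  have "L2_set (($$) (X + Y)) ({..<n} \<times> {..<n}) = L2_set (\<lambda>x. X $$ x + Y $$ x) ({..<n} \<times> {..<n})"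
    using X Y by (intro L2_set_cong) auto
  then show ?thesis
    using L2_set_triangle_ineq[of "\<lambda>x. X $$ x" "\<lambda>x. Y $$ x" "{..<n} \<times> {..<n}"] X Y
    by (simp add: frob_def case_prod_beta)
qed

text \<open>\<open>X = X * 1\<^sub>m n\<close>, and the identity has Frobenius norm
  \<open>sqrt n\<close>; this explains the normalisation in \<open>negl\<close>.\<close>

lemma frob_opb_le: "opb n c X \<Longrightarrow> frob X \<le> c * sqrt (real n)"
proof -
  assume X: "opb n c X"
  have "frob (1\<^sub>m n :: real mat) = sqrt (real n)"
  proof -
    have "(\<Sum>(i,j)\<in>{..<n}\<times>{..<n}. ((1\<^sub>m n :: real mat) $$ (i,j))\<^sup>2) = (\<Sum>i<n. \<Sum>j<n. if i = j then 1 else 0)"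
      by (subst sum.cartesian_product) (auto intro!: sum.cong)
    also have "\<dots> = real n" by (simp add: sum.delta)
    finally show ?thesis by (auto simp: frob_def L2_set_def case_prod_beta)
  qed
  moreover have "frob (X * 1\<^sub>m n) \<le> c * frob (1\<^sub>m n :: real mat)"
    using X by (intro frob_mult_left) auto
  ultimately show ?thesis using X by (auto simp: opb_def)
qed

text \<open>Cauchy-Schwarz on the diagonal. Together with the normalisation of \<open>negl\<close>
  it gives traces of order o(n).\<close>

lemma trace_frob_le: "X \<in> carrier_mat n n \<Longrightarrow> \<bar>mtrace X\<bar> \<le> sqrt (real n) * frob X"
proof -
  assume X: "X \<in> carrier_mat n n"
  have "\<bar>mtrace X\<bar> \<le> (\<Sum>i<n. \<bar>1\<bar> * \<bar>X $$ (i,i)\<bar>)" using X by (auto simp: mtrace_def)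
  also have "\<dots> \<le> L2_set (\<lambda>_. 1) {..<n} * L2_set (\<lambda>i. X $$ (i,i)) {..<n}"
    by (rule L2_set_mult_ineq)
  also have "L2_set (\<lambda>i. X $$ (i,i)) {..<n} \<le> frob X"
  proof -
    have "(\<Sum>i<n. (X $$ (i,i))\<^sup>2) \<le> (\<Sum>i<n. \<Sum>j<n. (X $$ (i,j))\<^sup>2)"
      by (intro sum_mono member_le_sum) auto
    then show ?thesis using X by (auto simp: frob_def L2_set_def sum.cartesian_product case_prod_beta)
  qed
  finally show ?thesis by (simp add: L2_set_def mult_left_mono)
qed

text \<open>Only the arithmetic mean form of the bound is assumed, because \<open>|xy| \<le> (x\<^sup>2 + y\<^sup>2)/2\<close> can be applied pointwise under an integral.\<close>

lemma opb_of_bilinear: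
  assumes X: "X \<in> carrier_mat n n" and c: "0 < c"
    and b: "\<And>x y. x \<in> carrier_vec n \<Longrightarrow> y \<in> carrier_vec n \<Longrightarrow> y \<bullet> (X *\<^sub>v x) \<le> c * ((vnorm x)\<^sup>2 + (vnorm y)\<^sup>2) / 2"
  shows "opb n c X"
proof -
  { fix x :: "real vec" assume x: "x \<in> carrier_vec n"
    define z where "z = X *\<^sub>v x"
    have z: "z \<in> carrier_vec n" using X x by (simp add: z_def)
    \<comment> \<open>The test vector \<open>z / c\<close> balances the two squares: half of
      \<open>|z|^2 / c\<close> is then absorbed on the left.\<close>
    have "(1/c) * (vnorm z)\<^sup>2 = ((1/c) \<cdot>\<^sub>v z) \<bullet> (X *\<^sub>v x)"
      using z by (simp add: vnorm_sq z_def)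
    also have "\<dots> \<le> c * ((vnorm x)\<^sup>2 + (vnorm ((1/c) \<cdot>\<^sub>v z))\<^sup>2) / 2"
      using x z by (intro b) auto
    also have "\<dots> = c * (vnorm x)\<^sup>2 / 2 + (1/c) * (vnorm z)\<^sup>2 / 2"
    proof -
      have "(vnorm ((1/c) \<cdot>\<^sub>v z))\<^sup>2 = (1/c) * ((1/c) * (vnorm z)\<^sup>2)"
        using c by (simp add: vnorm_smult power2_eq_square)
      moreover have "c * ((1/c) * ((1/c) * (vnorm z)\<^sup>2)) = (1/c) * (vnorm z)\<^sup>2"
        using c by simp
      ultimately show ?thesis by (simp only: distrib_left add_divide_distrib)
    qed
    finally have "(1/c) * (vnorm z)\<^sup>2 \<le> c * (vnorm x)\<^sup>2" by simp
    then have "c * ((1/c) * (vnorm z)\<^sup>2) \<le> c * (c * (vnorm x)\<^sup>2)"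
      using c by (intro mult_left_mono) auto
    then have "(vnorm z)\<^sup>2 \<le> (c * vnorm x)\<^sup>2"
      using c by (simp add: power_mult_distrib power2_eq_square mult_ac)
    then have "vnorm z \<le> c * vnorm x" using c by (auto intro: power2_le_imp_le) }
  then show ?thesis using X c by (auto simp: opb_def)
qed

lemma mtrace_add: "X \<in> carrier_mat n n \<Longrightarrow> Y \<in> carrier_mat n n \<Longrightarrow> mtrace (X + Y) = mtrace X + mtrace Y"
  by (auto simp: mtrace_def sum.distrib)

lemma mtrace_diff: "X \<in> carrier_mat n n \<Longrightarrow> Y \<in> carrier_mat n n \<Longrightarrow> mtrace (X - Y) = mtrace X - mtrace Y"
  by (auto simp: mtrace_def sum_subtractf)

lemma mtrace_smult: "mtrace (a \<cdot>\<^sub>m X) = a * mtrace X" if "X \<in> carrier_mat n n"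
  using that by (auto simp: mtrace_def sum_distrib_left)

lemma mtrace_one: "mtrace (1\<^sub>m n) = real n"
  by (simp add: mtrace_def)

lemma mtrace_comm: "X \<in> carrier_mat n n \<Longrightarrow> Y \<in> carrier_mat n n \<Longrightarrow> mtrace (X * Y) = mtrace (Y * X)"
proof -
  assume X: "X \<in> carrier_mat n n" and Y: "Y \<in> carrier_mat n n"
  have "mtrace (X * Y) = (\<Sum>i<n. \<Sum>k<n. X $$ (i,k) * Y $$ (k,i))"
    using X Y by (auto simp: mtrace_def scalar_prod_def atLeast0LessThan)
  also have "\<dots> = (\<Sum>k<n. \<Sum>i<n. Y $$ (k,i) * X $$ (i,k))"
    by (subst sum.swap) (simp add: mult.commute)
  also have "\<dots> = mtrace (Y * X)"
    using X Y by (auto simp: mtrace_def scalar_prod_def atLeast0LessThan)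
  finally show ?thesis .
qed

lemma mtrace_opb_le: "opb n c X \<Longrightarrow> \<bar>mtrace X\<bar> \<le> c * real n"
proof -
  assume X: "opb n c X"
  have "\<bar>mtrace X\<bar> \<le> sqrt (real n) * (c * sqrt (real n))"
    using trace_frob_le[OF opb_carrier[OF X]] frob_opb_le[OF X]
    by (meson mult_left_mono order_trans real_sqrt_ge_zero of_nat_0_le_iff)
  then show ?thesis by (simp add: mult_ac)
qed

section \<open>Toeplitz matrices\<close>

text \<open>Only cosine coefficients are taken, so \<open>toep n f\<close> sees just the even part
  of \<open>f\<close> and is always symmetric. The frequency is real so that differences of indices
  can be inserted directly.\<close>

definition tcoef :: "(real \<Rightarrow> real) \<Rightarrow> real \<Rightarrow> real" where
  "tcoef f m = integral {-pi..pi} (\<lambda>x. f x * cos (m * x)) / (2 * pi)"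

definition toep :: "nat \<Rightarrow> (real \<Rightarrow> real) \<Rightarrow> real mat" where
  "toep n f = mat n n (\<lambda>(j,k). tcoef f (real j - real k))"

lemma toep_carrier [simp]: "toep n f \<in> carrier_mat n n"
  by (simp add: toep_def)

lemma toep_dim [simp]: "dim_row (toep n f) = n" "dim_col (toep n f) = n"
  by (simp_all add: toep_def)

lemma toep_index: "j < n \<Longrightarrow> k < n \<Longrightarrow> toep n f $$ (j,k) = tcoef f (real j - real k)"
  by (simp add: toep_def)

lemma tcoef_minus: "tcoef f (- m) = tcoef f m"
  by (simp add: tcoef_def)

lemma toep_transpose [simp]: "(toep n f)\<^sup>T = toep n f"
  using tcoef_minus[of f] by (auto intro!: eq_matI simp: toep_index) (metis minus_diff_eq)

lemma tcoef_integrable: "continuous_on {-pi..pi} f \<Longrightarrow> (\<lambda>x. f x * cos (m * x)) integrable_on {-pi..pi}"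
  by (intro integrable_continuous_interval continuous_intros) auto

lemma tcoef_add: "continuous_on {-pi..pi} f \<Longrightarrow> continuous_on {-pi..pi} g \<Longrightarrow>
    tcoef (\<lambda>x. f x + g x) m = tcoef f m + tcoef g m"
  by (simp add: tcoef_def distrib_right integral_add tcoef_integrable add_divide_distrib)

lemma tcoef_cmult: "tcoef (\<lambda>x. c * f x) m = c * tcoef f m"
  by (simp add: tcoef_def mult.assoc)

lemma toep_add: "continuous_on {-pi..pi} f \<Longrightarrow> continuous_on {-pi..pi} g \<Longrightarrow>
    toep n (\<lambda>x. f x + g x) = toep n f + toep n g"
  by (auto intro!: eq_matI simp: toep_index tcoef_add)

lemma toep_cmult: "toep n (\<lambda>x. c * f x) = c \<cdot>\<^sub>m toep n f"
  by (auto intro!: eq_matI simp: toep_index tcoef_cmult)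

lemma toep_diff: "continuous_on {-pi..pi} f \<Longrightarrow> continuous_on {-pi..pi} g \<Longrightarrow>
    toep n (\<lambda>x. f x - g x) = toep n f - toep n g"
proof -
  assume f: "continuous_on {-pi..pi} f" and g: "continuous_on {-pi..pi} g"
  then have "toep n (\<lambda>x. f x + (-1) * g x) = toep n f + (-1) \<cdot>\<^sub>m toep n g"
    unfolding toep_cmult[symmetric] by (intro toep_add continuous_intros)
  then show ?thesis by (auto intro!: eq_matI)
qed

lemma toep_cong: "(\<And>x. x \<in> {-pi..pi} \<Longrightarrow> f x = g x) \<Longrightarrow> toep n f = toep n g"
  by (auto intro!: eq_matI integral_cong simp: toep_index tcoef_def)

lemma integral_cos_int:
  assumes "m \<in> \<int>" "m \<noteq> 0"
  shows "integral {-pi..pi} (\<lambda>x. cos (m * x)) = 0"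
proof -
  have "((\<lambda>x. cos (m * x)) has_integral (sin (m * pi) / m - sin (m * (-pi)) / m)) {-pi..pi}"
    using assms by (intro fundamental_theorem_of_calculus)
      (auto intro!: derivative_eq_intros simp: has_real_derivative_iff_has_vector_derivative[symmetric])
  moreover have "sin (m * pi) = 0" using assms by (auto elim!: Ints_cases simp: sin_zero_iff_int2)
  ultimately show ?thesis by (simp add: integral_unique)
qed

lemma tcoef_one: "m \<in> \<int> \<Longrightarrow> tcoef (\<lambda>_. 1) m = (if m = 0 then 1 else 0)"
  using integral_cos_int[of m] by (auto simp: tcoef_def)

lemma toep_one: "toep n (\<lambda>_. 1) = 1\<^sub>m n"
  by (rule eq_matI) (auto simp: toep_index tcoef_one)

lemma toep_const: "toep n (\<lambda>_. c) = c \<cdot>\<^sub>m 1\<^sub>m n"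
  using toep_cmult[of n c "\<lambda>_. 1"] by (simp add: toep_one)

text \<open>\<open>csum\<close> and \<open>ssum\<close> are the real and imaginary parts of the
  trigonometric polynomial with coefficients \<open>x\<close>, kept apart to stay in real
  arithmetic.\<close>

definition csum :: "real vec \<Rightarrow> real \<Rightarrow> real" where
  "csum x t = (\<Sum>i<dim_vec x. x $ i * cos (real i * t))"

definition ssum :: "real vec \<Rightarrow> real \<Rightarrow> real" where
  "ssum x t = (\<Sum>i<dim_vec x. x $ i * sin (real i * t))"

lemma csum_cont [continuous_intros]: "continuous_on S (csum x)" "continuous_on S (ssum x)"
  unfolding csum_def ssum_def by (intro continuous_intros)+

text \<open>The addition formula for \<open>cos ((j - k) t)\<close> factorises the double sum, so
  bounds on the symbol become bounds on the form.\<close>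

lemma toep_bilinear:
  assumes f: "continuous_on {-pi..pi} f" and x: "x \<in> carrier_vec n" and y: "y \<in> carrier_vec n"
  shows "y \<bullet> (toep n f *\<^sub>v x) = integral {-pi..pi} (\<lambda>t. f t * (csum y t * csum x t + ssum y t * ssum x t)) / (2 * pi)"
proof -
  have "y \<bullet> (toep n f *\<^sub>v x) = (\<Sum>j<n. \<Sum>k<n. y $ j * x $ k * tcoef f (real j - real k))"
    using x y by (auto simp: scalar_prod_def toep_index atLeast0LessThan sum_distrib_left mult_ac intro!: sum.cong)
  also have "\<dots> = (\<Sum>j<n. \<Sum>k<n. integral {-pi..pi} (\<lambda>t. y $ j * x $ k * (f t * cos ((real j - real k) * t)))) / (2 * pi)"
    by (simp add: tcoef_def sum_divide_distrib)
  also have "(\<Sum>j<n. \<Sum>k<n. integral {-pi..pi} (\<lambda>t. y $ j * x $ k * (f t * cos ((real j - real k) * t))))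
    = integral {-pi..pi} (\<lambda>t. \<Sum>j<n. \<Sum>k<n. y $ j * x $ k * (f t * cos ((real j - real k) * t)))"
  proof -
    have i: "(\<lambda>t. y $ j * x $ k * (f t * cos ((real j - real k) * t))) integrable_on {-pi..pi}" for j k
      using f by (intro integrable_continuous_interval continuous_intros)
    show ?thesis by (subst integral_sum) (auto intro!: integrable_sum i sum.cong simp: integral_sum i)
  qed
  also have "(\<lambda>t. \<Sum>j<n. \<Sum>k<n. y $ j * x $ k * (f t * cos ((real j - real k) * t))) =
     (\<lambda>t. f t * (csum y t * csum x t + ssum y t * ssum x t))"
  proof
    fix t
    have *: "y $ j * x $ k * (f t * cos ((real j - real k) * t)) =
      f t * ((y $ j * cos (real j * t)) * (x $ k * cos (real k * t)) + (y $ j * sin (real j * t)) * (x $ k * sin (real k * t)))" for j k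
      by (simp add: left_diff_distrib cos_diff algebra_simps)
    show "(\<Sum>j<n. \<Sum>k<n. y $ j * x $ k * (f t * cos ((real j - real k) * t))) = f t * (csum y t * csum x t + ssum y t * ssum x t)"
      unfolding * csum_def ssum_def sum_product using x y by (simp add: sum.distrib sum_distrib_left distrib_left)
  qed
  finally show ?thesis .
qed

text \<open>The constant symbol one has the identity as its Toeplitz matrix, so this is a special
  case of the bilinear formula.\<close>

lemma parseval:
  assumes x: "x \<in> carrier_vec n"
  shows "integral {-pi..pi} (\<lambda>t. (csum x t)\<^sup>2 + (ssum x t)\<^sup>2) / (2 * pi) = (vnorm x)\<^sup>2"
  using toep_bilinear[of "\<lambda>_. 1" x n x] x by (simp add: toep_one vnorm_sq[symmetric] power2_eq_square)

text \<open>By the bilinear formula the form is at most \<open>c\<close> times the mean of the two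
  Parseval integrals. The hypothesis \<open>0 < c\<close> comes from \<open>opb_of_bilinear\<close>,
  which divides by \<open>c\<close>.\<close>

lemma opb_toep:
  assumes f: "continuous_on {-pi..pi} f" and c: "0 < c" and b: "\<And>t. t \<in> {-pi..pi} \<Longrightarrow> \<bar>f t\<bar> \<le> c"
  shows "opb n c (toep n f)"
proof (rule opb_of_bilinear[OF toep_carrier c])
  fix x y :: "real vec" assume x: "x \<in> carrier_vec n" and y: "y \<in> carrier_vec n"
  let ?q = "\<lambda>x t. (csum x t)\<^sup>2 + (ssum x t)\<^sup>2"
  have i: "?q x integrable_on {-pi..pi}" for x
    by (intro integrable_continuous_interval continuous_intros)
  have "integral {-pi..pi} (\<lambda>t. f t * (csum y t * csum x t + ssum y t * ssum x t)) \<le>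
     integral {-pi..pi} (\<lambda>t. c / 2 * (?q x t + ?q y t))"
  proof (rule integral_le)
    show "(\<lambda>t. f t * (csum y t * csum x t + ssum y t * ssum x t)) integrable_on {-pi..pi}"
      using f by (intro integrable_continuous_interval continuous_intros)
    show "(\<lambda>t. c / 2 * (?q x t + ?q y t)) integrable_on {-pi..pi}"
      by (intro integrable_continuous_interval continuous_intros)
    fix t assume t: "t \<in> {-pi..pi}"
    have "csum y t * csum x t + ssum y t * ssum x t \<le> (?q x t + ?q y t) / 2"
         "- (csum y t * csum x t + ssum y t * ssum x t) \<le> (?q x t + ?q y t) / 2"
      using sum_squares_ge_zero[of "csum y t - csum x t" "ssum y t - ssum x t"]
        sum_squares_ge_zero[of "csum y t + csum x t" "ssum y t + ssum x t"]
      by (simp_all add: power2_eq_square algebra_simps)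
    then have "\<bar>csum y t * csum x t + ssum y t * ssum x t\<bar> \<le> (?q x t + ?q y t) / 2" by linarith
    then have "\<bar>f t\<bar> * \<bar>csum y t * csum x t + ssum y t * ssum x t\<bar> \<le> c * ((?q x t + ?q y t) / 2)"
      using b[OF t] c by (intro mult_mono) auto
    then show "f t * (csum y t * csum x t + ssum y t * ssum x t) \<le> c / 2 * (?q x t + ?q y t)"
      by (simp add: abs_mult[symmetric])
  qed
  also have "\<dots> = c / 2 * (integral {-pi..pi} (?q x) + integral {-pi..pi} (?q y))"
    by (simp only: integral_mult_right integral_add[OF i i])
  finally have "integral {-pi..pi} (\<lambda>t. f t * (csum y t * csum x t + ssum y t * ssum x t)) / (2*pi) \<le>
     c / 2 * (integral {-pi..pi} (?q x) + integral {-pi..pi} (?q y)) / (2*pi)"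
    by (rule divide_right_mono) simp
  also have "\<dots> = c * (integral {-pi..pi} (?q x) / (2*pi) + integral {-pi..pi} (?q y) / (2*pi)) / 2"
    by (simp add: add_divide_distrib distrib_left)
  finally show "y \<bullet> (toep n f *\<^sub>v x) \<le> c * ((vnorm x)\<^sup>2 + (vnorm y)\<^sup>2) / 2"
    by (simp only: toep_bilinear[OF f x y] parseval[OF x] parseval[OF y])
qed

lemma toep_quad_nonneg:
  assumes f: "continuous_on {-pi..pi} f" and b: "\<And>t. t \<in> {-pi..pi} \<Longrightarrow> 0 \<le> f t" and x: "x \<in> carrier_vec n"
  shows "0 \<le> x \<bullet> (toep n f *\<^sub>v x)"
  unfolding toep_bilinear[OF f x x] using b
  by (auto intro!: divide_nonneg_nonneg integral_nonneg integrable_continuous_interval continuous_intros f)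

text \<open>The product-to-sum formula: multiplying a symbol by \<open>cos\<close> averages two
  neighbouring coefficients, just as right multiplication by the tridiagonal matrix
  \<open>toep n cos\<close> does away from the border.\<close>

lemma tcoef_mult_cos:
  assumes f: "continuous_on {-pi..pi} f"
  shows "tcoef (\<lambda>x. f x * cos x) m = (tcoef f (m - 1) + tcoef f (m + 1)) / 2"
proof -
  have "(\<lambda>x. f x * cos x * cos (m * x)) = (\<lambda>x. (1/2) * (f x * cos ((m - 1) * x) + f x * cos ((m + 1) * x)))"
    by (rule ext) (simp add: cos_diff cos_add algebra_simps)
  then have "tcoef (\<lambda>x. f x * cos x) m = (1/2) * (integral {-pi..pi} (\<lambda>x. f x * cos ((m - 1) * x) + f x * cos ((m + 1) * x))) / (2*pi)"
    unfolding tcoef_def by (simp only: integral_mult_right)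
  also have "\<dots> = (1/2) * (integral {-pi..pi} (\<lambda>x. f x * cos ((m - 1) * x)) + integral {-pi..pi} (\<lambda>x. f x * cos ((m + 1) * x))) / (2*pi)"
    using tcoef_integrable[OF f] by (simp only: integral_add)
  finally show ?thesis by (simp add: tcoef_def add_divide_distrib)
qed

lemma mtrace_toep: "mtrace (toep n f) = real n * (integral {-pi..pi} f / (2 * pi))"
  by (simp add: mtrace_def toep_index tcoef_def)

section \<open>Asymptotic multiplicativity\<close>

text \<open>Frobenius norm of order o(\<open>sqrt n\<close>). This tolerates border errors confined
  to a few columns, which need not be small in operator norm, and still controls traces divided by
  \<open>n\<close>.\<close>

definition negl :: "(nat \<Rightarrow> real mat) \<Rightarrow> bool" where
  "negl X \<longleftrightarrow> (\<forall>n. X n \<in> carrier_mat n n) \<and> (\<lambda>n. frob (X n) / sqrt (real n)) \<longlonglongrightarrow> 0"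

lemma negl_carrier: "negl X \<Longrightarrow> X n \<in> carrier_mat n n"
  by (simp add: negl_def)

lemma negl_bound:
  assumes Y: "\<And>n. Y n \<in> carrier_mat n n" and X: "negl X" and le: "\<And>n. frob (Y n) \<le> c * frob (X n)"
  shows "negl Y"
proof -
  have "(\<lambda>n. c * (frob (X n) / sqrt (real n))) \<longlonglongrightarrow> 0"
    using X unfolding negl_def by (intro tendsto_mult_right_zero) simp
  then have "(\<lambda>n. frob (Y n) / sqrt (real n)) \<longlonglongrightarrow> 0"
  proof (rule tendsto_0_le[where K=1], intro always_eventually allI)
    fix n
    have "frob (Y n) / sqrt (real n) \<le> c * frob (X n) / sqrt (real n)"
      using le[of n] by (intro divide_right_mono) auto
    also have "\<dots> \<le> \<bar>c * frob (X n)\<bar> / sqrt (real n)" by (intro divide_right_mono) auto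
    finally show "norm (frob (Y n) / sqrt (real n)) \<le> norm (c * (frob (X n) / sqrt (real n))) * 1"
      by simp
  qed
  then show ?thesis using Y by (simp add: negl_def)
qed

lemma negl_add: "negl X \<Longrightarrow> negl Y \<Longrightarrow> negl (\<lambda>n. X n + Y n)"
proof -
  assume X: "negl X" and Y: "negl Y"
  have "(\<lambda>n. frob (X n) / sqrt (real n) + frob (Y n) / sqrt (real n)) \<longlonglongrightarrow> 0"
    using X Y by (auto simp: negl_def intro: tendsto_add_zero)
  then have "(\<lambda>n. frob (X n + Y n) / sqrt (real n)) \<longlonglongrightarrow> 0"
  proof (rule tendsto_0_le[where K=1], intro always_eventually allI)
    fix n
    have "frob (X n + Y n) / sqrt (real n) \<le> (frob (X n) + frob (Y n)) / sqrt (real n)"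
      using frob_add_le[OF negl_carrier[OF X] negl_carrier[OF Y]] by (intro divide_right_mono) auto
    then show "norm (frob (X n + Y n) / sqrt (real n)) \<le> norm (frob (X n) / sqrt (real n) + frob (Y n) / sqrt (real n)) * 1"
      by (simp add: add_divide_distrib)
  qed
  then show ?thesis using X Y by (auto simp: negl_def)
qed

lemma negl_mult_left: "negl X \<Longrightarrow> (\<And>n. opb n c (Y n)) \<Longrightarrow> negl (\<lambda>n. Y n * X n)"
  by (rule negl_bound[where X=X and c=c]) (auto intro!: frob_mult_left mult_carrier_mat dest: negl_carrier opb_carrier)

lemma negl_mult_right: "negl X \<Longrightarrow> (\<And>n. opb n c (Y n)) \<Longrightarrow> negl (\<lambda>n. X n * Y n)"
  by (rule negl_bound[where X=X and c=c]) (auto intro!: frob_mult_right mult_carrier_mat dest: negl_carrier opb_carrier)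

lemma negl_uminus: "negl X \<Longrightarrow> negl (\<lambda>n. - X n)"
proof (rule negl_bound[where X=X and c=1])
  fix n assume X: "negl X"
  note c = negl_carrier[OF X, of n]
  then show "- X n \<in> carrier_mat n n" by simp
  have "L2_set (\<lambda>p. (- X n) $$ p) ({..<n}\<times>{..<n}) = L2_set (\<lambda>p. X n $$ p) ({..<n}\<times>{..<n})"
    using c by (auto simp: L2_set_def intro!: sum.cong)
  then show "frob (- X n) \<le> 1 * frob (X n)" using c by (auto simp: frob_def)
qed auto

lemma negl_diff: "negl X \<Longrightarrow> negl Y \<Longrightarrow> negl (\<lambda>n. X n - Y n)"
proof -
  assume X: "negl X" and Y: "negl Y"
  have "X n - Y n = X n + - Y n" for n
    using negl_carrier[OF X] negl_carrier[OF Y] by auto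
  then show ?thesis using negl_add[OF X negl_uminus[OF Y]] by simp
qed

lemma negl_trace: "negl X \<Longrightarrow> (\<lambda>n. mtrace (X n) / real n) \<longlonglongrightarrow> 0"
proof (rule tendsto_0_le[where K=1])
  assume X: "negl X"
  then show "(\<lambda>n. frob (X n) / sqrt (real n)) \<longlonglongrightarrow> 0" by (simp add: negl_def)
  show "\<forall>\<^sub>F n in sequentially. norm (mtrace (X n) / real n) \<le> norm (frob (X n) / sqrt (real n)) * 1"
  proof (rule eventually_sequentiallyI[of 1])
    fix n :: nat assume n: "1 \<le> n"
    have "\<bar>mtrace (X n)\<bar> / real n \<le> (sqrt (real n) * frob (X n)) / real n"
      using trace_frob_le[OF negl_carrier[OF X]] by (intro divide_right_mono) auto
    also have "\<dots> = frob (X n) / sqrt (real n)"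
      using n by (simp add: field_simps)
    finally show "norm (mtrace (X n) / real n) \<le> norm (frob (X n) / sqrt (real n)) * 1" by simp
  qed
qed

text \<open>Closure under approximation in operator norm, uniform in \<open>n\<close>: an operator
  bound \<open>e\<close> costs at most \<open>e * sqrt n\<close> in Frobenius norm.\<close>

lemma negl_approx:
  assumes X: "\<And>n. X n \<in> carrier_mat n n"
    and a: "\<And>e. 0 < e \<Longrightarrow> \<exists>Y. negl Y \<and> (\<forall>n. opb n e (X n - Y n))"
  shows "negl X"
proof -
  have "(\<lambda>n. frob (X n) / sqrt (real n)) \<longlonglongrightarrow> 0"
  proof (rule LIMSEQ_I)
    fix r :: real assume r: "0 < r"
    obtain Y where Y: "negl Y" and o: "\<And>n. opb n (r/2) (X n - Y n)" using a[of "r/2"] r by auto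
    have "eventually (\<lambda>n. norm (frob (Y n) / sqrt (real n) - 0) < r/2) sequentially"
      using Y r unfolding negl_def tendsto_iff dist_norm by (metis half_gt_zero)
    then have "eventually (\<lambda>n. norm (frob (X n) / sqrt (real n) - 0) < r) sequentially"
      using eventually_gt_at_top[of 0]
    proof eventually_elim
      case (elim n)
      have "X n = (X n - Y n) + Y n" using X[of n] negl_carrier[OF Y, of n] by auto
      then have "frob (X n) \<le> frob (X n - Y n) + frob (Y n)"
        using frob_add_le[of "X n - Y n" n "Y n"] negl_carrier[OF Y, of n] X[of n] by (metis minus_carrier_mat)
      also have "\<dots> \<le> r/2 * sqrt (real n) + frob (Y n)" using frob_opb_le[OF o] by simp
      finally have "frob (X n) / sqrt (real n) \<le> (r/2 * sqrt (real n) + frob (Y n)) / sqrt (real n)"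
        by (rule divide_right_mono) simp
      also have "\<dots> = r/2 + frob (Y n) / sqrt (real n)" using elim by (simp add: add_divide_distrib)
      also have "\<dots> < r" using elim(1) by (simp only: diff_0_right real_norm_def)
      finally show ?case by simp
    qed
    then show "\<exists>no. \<forall>n\<ge>no. norm (frob (X n) / sqrt (real n) - 0) < r"
      by (simp add: eventually_sequentially)
  qed
  then show ?thesis using X by (simp add: negl_def)
qed

lemma bounded_cont:
  assumes "continuous_on {-pi..pi} (f::real\<Rightarrow>real)"
  shows "\<exists>c>0. \<forall>t\<in>{-pi..pi}. \<bar>f t\<bar> \<le> c"
proof -
  have "bounded (f ` {-pi..pi})" by (intro compact_imp_bounded compact_continuous_image assms compact_Icc)
  then obtain c where "c > 0" "\<forall>y\<in>f ` {-pi..pi}. norm y \<le> c" by (auto simp: bounded_pos)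
  then show ?thesis by auto
qed

text \<open>The left factor \<open>f\<close> is arbitrary and quantified inside: for a product
  \<open>g * h\<close> the property of \<open>h\<close> is applied to the left factor
  \<open>f * g\<close>.\<close>

definition asymp_mult :: "(real \<Rightarrow> real) \<Rightarrow> bool" where
  "asymp_mult g \<longleftrightarrow> continuous_on {-pi..pi} g \<and> (\<forall>f. continuous_on {-pi..pi} f \<longrightarrow>
      negl (\<lambda>n. toep n f * toep n g - toep n (\<lambda>x. f x * g x)))"

lemma negl_zero: "negl (\<lambda>n. 0\<^sub>m n n)"
proof -
  have "frob (0\<^sub>m n n) = 0" for n by (auto simp: frob_def L2_set_def intro!: sum.neutral)
  then show ?thesis by (simp add: negl_def)
qed

lemma asymp_mult_const: "asymp_mult (\<lambda>_. c)"
proof -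
  have "toep n f * toep n (\<lambda>_. c) - toep n (\<lambda>x. f x * c) = 0\<^sub>m n n" for n f
  proof -
    have "toep n (\<lambda>x. f x * c) = c \<cdot>\<^sub>m toep n f" using toep_cmult[of n c f] by (simp add: mult.commute)
    moreover have "toep n f * toep n (\<lambda>_. c) = c \<cdot>\<^sub>m toep n f"
      unfolding toep_const by (subst mult_smult_distrib[of _ n n _ n]) auto
    ultimately show ?thesis by auto
  qed
  then show ?thesis by (auto simp: asymp_mult_def negl_zero)
qed

lemma asymp_mult_add: "asymp_mult g \<Longrightarrow> asymp_mult h \<Longrightarrow> asymp_mult (\<lambda>x. g x + h x)"
  unfolding asymp_mult_def
proof (intro conjI allI impI; elim conjE)
  assume g: "continuous_on {-pi..pi} g" and h: "continuous_on {-pi..pi} h"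
  then show "continuous_on {-pi..pi} (\<lambda>x. g x + h x)" by (intro continuous_intros)
  fix f assume f: "continuous_on {-pi..pi} (f :: real \<Rightarrow> real)"
  assume *: "\<forall>f. continuous_on {-pi..pi} f \<longrightarrow> negl (\<lambda>n. toep n f * toep n g - toep n (\<lambda>x. f x * g x))"
    "\<forall>f. continuous_on {-pi..pi} f \<longrightarrow> negl (\<lambda>n. toep n f * toep n h - toep n (\<lambda>x. f x * h x))"
  have "toep n f * toep n (\<lambda>x. g x + h x) - toep n (\<lambda>x. f x * (g x + h x)) =
    (toep n f * toep n g - toep n (\<lambda>x. f x * g x)) + (toep n f * toep n h - toep n (\<lambda>x. f x * h x))" for n
  proof -
    have 1: "toep n (\<lambda>x. f x * (g x + h x)) = toep n (\<lambda>x. f x * g x) + toep n (\<lambda>x. f x * h x)"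
      unfolding distrib_left by (intro toep_add continuous_intros f g h)
    have 2: "toep n f * toep n (\<lambda>x. g x + h x) = toep n f * toep n g + toep n f * toep n h"
      unfolding toep_add[OF g h] by (intro mult_add_distrib_mat[of _ n n]) auto
    show ?thesis unfolding 1 2 by (intro eq_matI) (auto simp: index_mult_mat(1) simp del: index_mult_mat(1))
  qed
  then show "negl (\<lambda>n. toep n f * toep n (\<lambda>x. g x + h x) - toep n (\<lambda>x. f x * (g x + h x)))"
    using negl_add[OF *(1)[rule_format, OF f] *(2)[rule_format, OF f]] by simp
qed

lemma mat_telescope2:
  fixes F G H P Q :: "real mat"
  assumes "F \<in> carrier_mat n n" "G \<in> carrier_mat n n" "H \<in> carrier_mat n n"
    "P \<in> carrier_mat n n" "Q \<in> carrier_mat n n" "K \<in> carrier_mat n n"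
  shows "F * K - Q = F * (K - G * H) + ((F * G - P) * H + (P * H - Q))"
proof -
  have "F * (K - G * H) = F * K - F * (G * H)" using assms by (intro mult_minus_distrib_mat[of _ n n]) auto
  moreover have "(F * G - P) * H = F * G * H - P * H" using assms by (intro minus_mult_distrib_mat[of _ n n]) auto
  moreover have "F * G * H = F * (G * H)" using assms by (intro assoc_mult_mat[of _ n n _ n _ n]) auto
  ultimately show ?thesis using assms by (intro eq_matI) (auto simp del: index_mult_mat(1))
qed

text \<open>Telescoping from \<open>T(f) T(gh)\<close> through \<open>T(f) T(g) T(h)\<close> and
  \<open>T(fg) T(h)\<close> to \<open>T(fgh)\<close>; each error is negligible, at most multiplied
  by a bounded matrix.\<close>

lemma asymp_mult_mult: "asymp_mult g \<Longrightarrow> asymp_mult h \<Longrightarrow> asymp_mult (\<lambda>x. g x * h x)"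
  unfolding asymp_mult_def
proof (intro conjI allI impI; elim conjE)
  assume g: "continuous_on {-pi..pi} g" and h: "continuous_on {-pi..pi} h"
  then show "continuous_on {-pi..pi} (\<lambda>x. g x * h x)" by (intro continuous_intros)
  fix f assume f: "continuous_on {-pi..pi} (f :: real \<Rightarrow> real)"
  assume *: "\<forall>f. continuous_on {-pi..pi} f \<longrightarrow> negl (\<lambda>n. toep n f * toep n g - toep n (\<lambda>x. f x * g x))"
    "\<forall>f. continuous_on {-pi..pi} f \<longrightarrow> negl (\<lambda>n. toep n f * toep n h - toep n (\<lambda>x. f x * h x))"
  obtain cf where cf: "0 < cf" "\<And>t. t \<in> {-pi..pi} \<Longrightarrow> \<bar>f t\<bar> \<le> cf" using bounded_cont[OF f] by blast
  obtain ch where ch: "0 < ch" "\<And>t. t \<in> {-pi..pi} \<Longrightarrow> \<bar>h t\<bar> \<le> ch" using bounded_cont[OF h] by blast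
  have of': "opb n cf (toep n f)" for n by (rule opb_toep[OF f cf])
  have oh: "opb n ch (toep n h)" for n by (rule opb_toep[OF h ch])
  have fg: "continuous_on {-pi..pi} (\<lambda>x. f x * g x)" by (intro continuous_intros f g)
  have 1: "negl (\<lambda>n. toep n g * toep n h - toep n (\<lambda>x. g x * h x))" using *(2) g by blast
  have 2: "negl (\<lambda>n. toep n f * toep n g - toep n (\<lambda>x. f x * g x))" using *(1) f by blast
  have 3: "negl (\<lambda>n. toep n (\<lambda>x. f x * g x) * toep n h - toep n (\<lambda>x. f x * g x * h x))"
    using *(2)[rule_format, OF fg] .
  have 4: "negl (\<lambda>n. toep n (\<lambda>x. g x * h x) - toep n g * toep n h)"
  proof -
    have "toep n (\<lambda>x. g x * h x) - toep n g * toep n h = - (toep n g * toep n h - toep n (\<lambda>x. g x * h x))" for n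
      by (intro eq_matI) (auto simp del: index_mult_mat(1))
    then show ?thesis using negl_uminus[OF 1] by simp
  qed
  have "toep n f * toep n (\<lambda>x. g x * h x) - toep n (\<lambda>x. f x * g x * h x) =
     toep n f * (toep n (\<lambda>x. g x * h x) - toep n g * toep n h) +
     ((toep n f * toep n g - toep n (\<lambda>x. f x * g x)) * toep n h +
     (toep n (\<lambda>x. f x * g x) * toep n h - toep n (\<lambda>x. f x * g x * h x)))" for n
    by (rule mat_telescope2) auto
  moreover note negl_add[OF negl_mult_left[OF 4 of'] negl_add[OF negl_mult_right[OF 2 oh] 3]]
  ultimately show "negl (\<lambda>n. toep n f * toep n (\<lambda>x. g x * h x) - toep n (\<lambda>x. f x * (g x * h x)))"
    by (simp add: mult.assoc)
qed

text \<open>\<open>toep n cos\<close> has entries 1/2 next to the diagonal and 0 elsewhere, so by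
  \<open>tcoef_mult_cos\<close> the product is exact in every column except the first and the last.
  Two columns of bounded norm have Frobenius norm O(1).\<close>

lemma asymp_mult_cos: "asymp_mult cos"
  unfolding asymp_mult_def
proof (intro conjI allI impI)
  show "continuous_on {-pi..pi} (cos :: real \<Rightarrow> real)" by (intro continuous_intros)
  fix f assume f: "continuous_on {-pi..pi} (f :: real \<Rightarrow> real)"
  obtain c where c: "0 < c" "\<And>t. t \<in> {-pi..pi} \<Longrightarrow> \<bar>f t\<bar> \<le> c" using bounded_cont[OF f] by blast
  define X where "X n = toep n f * toep n cos - toep n (\<lambda>x. f x * cos x)" for n
  have fc: "continuous_on {-pi..pi} (\<lambda>x. f x * cos x)" by (intro continuous_intros f)
  have fc': "\<bar>f t * cos t\<bar> \<le> c" if "t \<in> {-pi..pi}" for t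
    using mult_mono[OF c(2)[OF that] abs_cos_le_one[of t]] c by (simp add: abs_mult)
  have o: "opb n (2 * c) (X n)" for n
  proof -
    have "opb n (c * 1 + c) (X n)" unfolding X_def
      by (intro opb_diff opb_mult opb_toep f c fc fc' continuous_intros) auto
    then show ?thesis by simp
  qed
  have Xc: "X n \<in> carrier_mat n n" for n using o by (auto simp: opb_def)
  have tcos: "tcoef cos m = (if \<bar>m\<bar> = 1 then 1/2 else 0)" if "m \<in> \<int>" for m
  proof -
    have "tcoef cos m = (tcoef (\<lambda>_. 1) (m - 1) + tcoef (\<lambda>_. 1) (m + 1)) / 2"
      using tcoef_mult_cos[of "\<lambda>_. 1" m] by simp
    then show ?thesis using that by (auto simp: tcoef_one abs_if split: if_splits)
  qed
  have col0: "X n $$ (j, k) = 0" if "j < n" "k \<noteq> 0" "Suc k < n" for n j k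
  proof -
    have "(toep n f * toep n cos) $$ (j,k) = (\<Sum>l<n. tcoef f (real j - real l) * tcoef cos (real l - real k))"
      using that by (simp add: scalar_prod_def toep_index atLeast0LessThan)
    also have "\<dots> = (\<Sum>l<n. (if l = k - 1 then tcoef f (real j - real l) / 2 else 0) + (if l = k + 1 then tcoef f (real j - real l) / 2 else 0))"
    proof (rule sum.cong, simp)
      fix l
      have "\<bar>real l - real k\<bar> = 1 \<longleftrightarrow> l = k - 1 \<or> l = k + 1" using that by linarith
      moreover have "k - 1 \<noteq> k + 1" by simp
      ultimately show "tcoef f (real j - real l) * tcoef cos (real l - real k) =
         (if l = k - 1 then tcoef f (real j - real l) / 2 else 0) + (if l = k + 1 then tcoef f (real j - real l) / 2 else 0)"
        by (auto simp: tcos)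
    qed
    also have "\<dots> = tcoef f (real j - real (k - 1)) / 2 + tcoef f (real j - real (k + 1)) / 2"
      using that by (simp add: sum.distrib sum.delta)
    also have "\<dots> = tcoef (\<lambda>x. f x * cos x) (real j - real k)"
      using that unfolding tcoef_mult_cos[OF f] by (simp add: of_nat_diff add_divide_distrib algebra_simps)
    finally show ?thesis using that by (simp add: X_def toep_index del: index_mult_mat(1))
  qed
  have colb: "(vnorm (col (X n) k))\<^sup>2 \<le> (2 * c)\<^sup>2" if "k < n" for n k
  proof -
    have "col (X n) k = X n *\<^sub>v unit_vec n k" using Xc[of n] that by auto
    then have "vnorm (col (X n) k) \<le> 2 * c * vnorm (unit_vec n k)" using opbD[OF o] by simp
    also have "vnorm (unit_vec n k) = 1"
      using that vnorm_sq[of "unit_vec n k"] by (simp add: power2_eq_square[symmetric])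
        (metis abs_of_nonneg vnorm_nonneg power2_eq_1_iff abs_one abs_minus_cancel)
    finally show ?thesis by (intro power_mono) auto
  qed
  have fb: "frob (X n) \<le> 4 * c" for n
  proof (cases n)
    case 0 then show ?thesis using c by (simp add: frob_def L2_set_def Xc X_def)
  next
    case (Suc m)
    have "(frob (X n))\<^sup>2 = (\<Sum>k<n. (vnorm (col (X n) k))\<^sup>2)" by (rule frob_sq_cols[OF Xc])
    \<comment> \<open>Only the border columns remain; for \<open>n = 1\<close> they coincide, so the
      sum has at most two terms.\<close>
    also have "\<dots> = (\<Sum>k\<in>{0,m}. (vnorm (col (X n) k))\<^sup>2)"
    proof (rule sum.mono_neutral_right)
      show "\<forall>k\<in>{..<n} - {0, m}. (vnorm (col (X n) k))\<^sup>2 = 0"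
      proof
        fix k assume "k \<in> {..<n} - {0,m}"
        then have "k \<noteq> 0" "Suc k < n" using Suc by auto
        then have "col (X n) k = 0\<^sub>v n" using col0 Xc[of n] by (intro eq_vecI) auto
        then show "(vnorm (col (X n) k))\<^sup>2 = 0" by simp
      qed
    qed (use Suc in auto)
    also have "\<dots> \<le> (\<Sum>k\<in>{0,m}. (2 * c)\<^sup>2)" using Suc by (intro sum_mono colb) auto
    also have "\<dots> \<le> 2 * (2*c)\<^sup>2" using c by (auto simp: card_insert_if)
    also have "\<dots> \<le> (4 * c)\<^sup>2" by (simp add: power2_eq_square)
    finally show ?thesis using c by (auto intro: power2_le_imp_le)
  qed
  have "(\<lambda>n. 4 * c / sqrt (real n)) \<longlonglongrightarrow> 0" by real_asymp
  then have "(\<lambda>n. frob (X n) / sqrt (real n)) \<longlonglongrightarrow> 0"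
  proof (rule tendsto_0_le[where K=1], intro always_eventually allI)
    fix n show "norm (frob (X n) / sqrt (real n)) \<le> norm (4 * c / sqrt (real n)) * 1"
      using fb[of n] c by (simp add: divide_right_mono)
  qed
  then show "negl (\<lambda>n. toep n f * toep n cos - toep n (\<lambda>x. f x * cos x))"
    using Xc by (simp add: negl_def X_def)
qed

text \<open>If \<open>c\<close> bounds \<open>f\<close>, replacing \<open>g\<close> by an
  \<open>h\<close> within \<open>e / (2 c)\<close> changes \<open>T(f) T(g)\<close> and
  \<open>T(fg)\<close> by at most \<open>e / 2\<close> each in operator norm;
  \<open>negl_approx\<close> absorbs this.\<close>

lemma asymp_mult_approx:
  assumes g: "continuous_on {-pi..pi} g"
    and a: "\<And>e. 0 < e \<Longrightarrow> \<exists>h. asymp_mult h \<and> (\<forall>t\<in>{-pi..pi}. \<bar>g t - h t\<bar> \<le> e)"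
  shows "asymp_mult g"
  unfolding asymp_mult_def
proof (intro conjI allI impI g)
  fix f assume f: "continuous_on {-pi..pi} (f :: real \<Rightarrow> real)"
  obtain c where c: "0 < c" "\<And>t. t \<in> {-pi..pi} \<Longrightarrow> \<bar>f t\<bar> \<le> c" using bounded_cont[OF f] by blast
  show "negl (\<lambda>n. toep n f * toep n g - toep n (\<lambda>x. f x * g x))"
  proof (rule negl_approx)
    fix e :: real assume e: "0 < e"
    then obtain h where h: "asymp_mult h" and gh: "\<forall>t\<in>{-pi..pi}. \<bar>g t - h t\<bar> \<le> e / (2*c)"
      using a[of "e/(2*c)"] c by auto
    have hc: "continuous_on {-pi..pi} h" using h by (simp add: asymp_mult_def)
    have "opb n e ((toep n f * toep n g - toep n (\<lambda>x. f x * g x)) - (toep n f * toep n h - toep n (\<lambda>x. f x * h x)))" for n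
    proof -
      have "opb n (c * (e/(2*c)) + (c * (e/(2*c)))) (toep n f * toep n (\<lambda>x. g x - h x) - toep n (\<lambda>x. f x * (g x - h x)))"
      proof (intro opb_diff opb_mult opb_toep f c continuous_intros g hc)
        fix t assume t: "t \<in> {-pi..pi}"
        then show "\<bar>g t - h t\<bar> \<le> e / (2*c)" using gh by blast
        then show "\<bar>f t * (g t - h t)\<bar> \<le> c * (e/(2*c))" unfolding abs_mult using c t by (intro mult_mono) auto
      qed (use c e in auto)
      moreover have "toep n (\<lambda>x. f x * (g x - h x)) = toep n (\<lambda>x. f x * g x) - toep n (\<lambda>x. f x * h x)"
        unfolding right_diff_distrib by (intro toep_diff continuous_intros f g hc)
      moreover have "toep n f * toep n (\<lambda>x. g x - h x) = toep n f * toep n g - toep n f * toep n h"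
        unfolding toep_diff[OF g hc] by (intro mult_minus_distrib_mat[of _ n n]) auto
      moreover have "(toep n f * toep n g - toep n f * toep n h) - (toep n (\<lambda>x. f x * g x) - toep n (\<lambda>x. f x * h x)) =
        ((toep n f * toep n g - toep n (\<lambda>x. f x * g x)) - (toep n f * toep n h - toep n (\<lambda>x. f x * h x)))"
        by (intro eq_matI) (auto simp del: index_mult_mat(1))
      ultimately show ?thesis using c by simp
    qed
    moreover have "negl (\<lambda>n. toep n f * toep n h - toep n (\<lambda>x. f x * h x))"
      using h f by (simp add: asymp_mult_def)
    ultimately show "\<exists>Y. negl Y \<and> (\<forall>n. opb n e (toep n f * toep n g - toep n (\<lambda>x. f x * g x) - Y n))"
      by blast
  qed auto
qed

lemma asymp_mult_poly_cos: "real_polynomial_function p \<Longrightarrow> asymp_mult (\<lambda>x. p (cos x))"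
proof (induction p rule: real_polynomial_function.induct)
  case (linear f)
  then have "f (cos x) = f 1 * cos x" for x
    using linear_simps(5)[of f "cos x" 1] by (simp add: mult.commute)
  then show ?case using asymp_mult_mult[OF asymp_mult_const[of "f 1"] asymp_mult_cos] by simp
qed (auto intro: asymp_mult_const asymp_mult_add asymp_mult_mult)

text \<open>Since \<open>arccos (cos t) = |t|\<close>, evenness is what makes \<open>g t\<close> a
  continuous function of \<open>cos t\<close>, to be approximated by polynomials on the interval
  from -1 to 1.\<close>

lemma asymp_mult_even:
  assumes g: "continuous_on {-pi..pi} g" and ev: "\<And>x. x \<in> {-pi..pi} \<Longrightarrow> g (- x) = g x"
  shows "asymp_mult g"
proof (rule asymp_mult_approx[OF g])
  fix e :: real assume e: "0 < e"
  have "continuous_on {-1..1} (\<lambda>u. g (arccos u))"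
  proof (rule continuous_on_compose2[OF g continuous_on_arccos'])
    show "arccos ` {-1..1} \<subseteq> {-pi..pi}"
    proof clarify
      fix u :: real assume "u \<in> {-1..1}"
      then have "0 \<le> arccos u" "arccos u \<le> pi" by (auto intro: arccos_lbound arccos_ubound)
      then show "arccos u \<in> {-pi..pi}" using pi_gt_zero by (simp del: pi_gt_zero)
    qed
  qed
  then obtain p where p: "real_polynomial_function p" "\<And>u. u \<in> {-1..1} \<Longrightarrow> \<bar>g (arccos u) - p u\<bar> < e"
    using Stone_Weierstrass_real_polynomial_function[of "{-1..1}" "\<lambda>u. g (arccos u)" e] e by auto
  have "\<bar>g t - p (cos t)\<bar> \<le> e" if t: "t \<in> {-pi..pi}" for t
  proof -
    have "g (arccos (cos t)) = g \<bar>t\<bar>" using t arccos_cos[of "\<bar>t\<bar>"] by (auto simp: abs_if)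
    also have "\<dots> = g t" using ev[OF t] by (auto simp: abs_if)
    finally show ?thesis using p(2)[of "cos t"] by (simp add: less_imp_le)
  qed
  then show "\<exists>h. asymp_mult h \<and> (\<forall>t\<in>{-pi..pi}. \<bar>g t - h t\<bar> \<le> e)"
    using asymp_mult_poly_cos[OF p(1)] by blast
qed

lemma mat_expand:
  fixes A B C :: "real mat"
  assumes "A \<in> carrier_mat n n" "B \<in> carrier_mat n n" "C \<in> carrier_mat n n"
  shows "(A + B) * C = A * C + B * C" "(A - B) * C = A * C - B * C"
    "A * (B + C) = A * B + A * C" "A * (B - C) = A * B - A * C"
    "(x \<cdot>\<^sub>m A) * B = x \<cdot>\<^sub>m (A * B)" "A * (x \<cdot>\<^sub>m B) = x \<cdot>\<^sub>m (A * B)"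
    "A * B * C = A * (B * C)"
  using assms by (auto intro!: add_mult_distrib_mat[of _ n n] minus_mult_distrib_mat[of _ n n]
    mult_add_distrib_mat[of _ n n] mult_minus_distrib_mat[of _ n n] mult_smult_assoc_mat[of _ n n]
    mult_smult_distrib[of _ n n] assoc_mult_mat[of _ n n _ n _ n])

lemma mat_eq_diff: "A \<in> carrier_mat n n \<Longrightarrow> B \<in> carrier_mat n n \<Longrightarrow> A + B = C \<Longrightarrow> B = C - (A :: real mat)"
  by (auto intro!: eq_matI)

section \<open>Expansion of the score\<close>

definition score :: "nat \<Rightarrow> real mat \<Rightarrow> real vec \<Rightarrow> real" where
  "score n A y = y \<bullet> ((A * (1\<^sub>m n - A)) *\<^sub>v y) - mtrace A"

text \<open>\<open>M\<close> and \<open>M0\<close> are the inverses of \<open>1 + T\<close> and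
  \<open>1 + T0\<close>. The resolvent identity \<open>M0 - M = M (T - T0) M0\<close> gives the
  first order bound; inserted into itself it leaves terms of order \<open>\<tau>^2\<close>. Both
  inverses have norm at most one, so the constants involve \<open>L\<close> and \<open>K\<close>
  alone.\<close>

lemma resolvent_expansion:
  fixes T T0 M M0 P E :: "real mat"
  assumes c: "T \<in> carrier_mat n n" "T0 \<in> carrier_mat n n"
    and M: "M * (1\<^sub>m n + T) = 1\<^sub>m n" "opb n 1 M" and M0: "(1\<^sub>m n + T0) * M0 = 1\<^sub>m n" "opb n 1 M0"
    and T: "T = T0 + (\<tau> \<cdot>\<^sub>m P + E)" and P: "opb n L P" and E: "opb n (K * \<tau>\<^sup>2) E" and t: "\<bar>\<tau>\<bar> \<le> 1" and K: "0 \<le> K"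
  shows "opb n ((L + K) * \<bar>\<tau>\<bar>) (M0 - M)"
    "opb n (((L + K)\<^sup>2 + K) * \<tau>\<^sup>2) (M - (M0 - \<tau> \<cdot>\<^sub>m (M0 * P * M0)))"
proof -
  define D where "D = \<tau> \<cdot>\<^sub>m P + E"
  note C = c opb_carrier[OF M(2)] opb_carrier[OF M0(2)] opb_carrier[OF P] opb_carrier[OF E]
  have D: "opb n ((L + K) * \<bar>\<tau>\<bar>) D"
  proof (rule opb_mono)
    show "opb n (\<bar>\<tau>\<bar> * L + K * \<tau>\<^sup>2) D" unfolding D_def by (intro opb_add opb_smult P E)
    have "\<tau>\<^sup>2 \<le> \<bar>\<tau>\<bar>" using mult_left_mono[OF t abs_ge_zero[of \<tau>]] by (simp add: power2_eq_square abs_mult_self_eq)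
    then show "\<bar>\<tau>\<bar> * L + K * \<tau>\<^sup>2 \<le> (L + K) * \<bar>\<tau>\<bar>" using K mult_left_mono[of "\<tau>\<^sup>2" "\<bar>\<tau>\<bar>" K] by (simp add: algebra_simps)
  qed
  have DC: "D \<in> carrier_mat n n" using D by (rule opb_carrier)
  have T': "T = T0 + D" using T by (simp add: D_def)
  note X = mat_expand[where n=n]
  have diff: "M0 - M = M * D * M0"
  proof -
    have "M * (1\<^sub>m n + T) * M0 = M * M0 + M * (T0 * M0) + M * (D * M0)"
      unfolding T' using C DC by (simp add: X assoc_add_mat[of _ n n])
    moreover have "M * ((1\<^sub>m n + T0) * M0) = M * M0 + M * (T0 * M0)"
      using C DC by (simp add: X)
    ultimately have "M + M * (D * M0) = M0" using C DC unfolding M M0 by simp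
    from mat_eq_diff[OF _ _ this, of n] show ?thesis using C DC by (simp add: X)
  qed
  show o1: "opb n ((L + K) * \<bar>\<tau>\<bar>) (M0 - M)"
    using opb_mult[OF opb_mult[OF M(2) D] M0(2)] unfolding diff by simp
  \<comment> \<open>The resolvent identity with \<open>M\<close> replaced by \<open>M0\<close> on
    the right: the replacement costs \<open>(M0 - M) D M0\<close>, already of second order.\<close>
  have "M - (M0 - \<tau> \<cdot>\<^sub>m (M0 * P * M0)) = (M0 - M) * D * M0 - M0 * E * M0"
  proof -
    have "(M0 - M) * D * M0 = M0 * D * M0 - M * D * M0" using C DC by (simp add: X)
    also have "M0 * D * M0 = \<tau> \<cdot>\<^sub>m (M0 * P * M0) + M0 * E * M0" unfolding D_def using C by (simp add: X)
    finally have "(M0 - M) * D * M0 = \<tau> \<cdot>\<^sub>m (M0 * P * M0) + M0 * E * M0 - (M0 - M)" using diff by simp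
    then show ?thesis using C by (intro eq_matI) (auto simp del: index_mult_mat(1))
  qed
  moreover have "opb n ((L + K) * \<bar>\<tau>\<bar> * ((L + K) * \<bar>\<tau>\<bar>) * 1 + 1 * (K * \<tau>\<^sup>2) * 1) ((M0 - M) * D * M0 - M0 * E * M0)"
    by (intro opb_diff opb_mult o1 D M0 E)
  moreover have "(L + K) * \<bar>\<tau>\<bar> * ((L + K) * \<bar>\<tau>\<bar>) * 1 + 1 * (K * \<tau>\<^sup>2) * 1 = ((L + K)\<^sup>2 + K) * \<tau>\<^sup>2"
    by (simp add: power2_eq_square algebra_simps flip: abs_mult)
  ultimately show "opb n (((L + K)\<^sup>2 + K) * \<tau>\<^sup>2) (M - (M0 - \<tau> \<cdot>\<^sub>m (M0 * P * M0)))" by simp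
qed

text \<open>With \<open>A = T M = 1 - M\<close> one has \<open>A (1 - A) = M - M^2\<close> and
  \<open>tr A = n - tr M\<close>, so the score depends on \<open>T\<close> through its resolvent
  only. \<open>N\<close> is minus the derivative of \<open>M\<close> in \<open>\<tau>\<close>, and
  the bracket multiplying \<open>\<tau>\<close> is minus the derivative of the score.\<close>

lemma score_expansion:
  fixes T T0 M M0 P E :: "real mat"
  assumes c: "T \<in> carrier_mat n n" "T0 \<in> carrier_mat n n"
    and M: "M * (1\<^sub>m n + T) = 1\<^sub>m n" "(1\<^sub>m n + T) * M = 1\<^sub>m n" "opb n 1 M" and M0: "(1\<^sub>m n + T0) * M0 = 1\<^sub>m n" "opb n 1 M0"
    and T: "T = T0 + (\<tau> \<cdot>\<^sub>m P + E)" and P: "opb n L P" and E: "opb n (K * \<tau>\<^sup>2) E" and t: "\<bar>\<tau>\<bar> \<le> 1" and K: "0 \<le> K"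
    and y: "y \<in> carrier_vec n"
  defines "N \<equiv> M0 * P * M0"
  shows "\<bar>score n (T * M) y - score n (T0 * M0) y + \<tau> * (y \<bullet> ((N - M0 * N - N * M0) *\<^sub>v y) + mtrace N)\<bar>
     \<le> (4 * (L + K)\<^sup>2 + 3 * K) * \<tau>\<^sup>2 * ((vnorm y)\<^sup>2 + real n)"
proof -
  note C = c opb_carrier[OF M(3)] opb_carrier[OF M0(2)] opb_carrier[OF P] opb_carrier[OF E]
  have NC: "N \<in> carrier_mat n n" using C by (simp add: N_def)
  define E1 where "E1 = M - (M0 - \<tau> \<cdot>\<^sub>m N)"
  define D where "D = M0 - M"
  \<comment> \<open>The remainder of \<open>M * M\<close>, found by multiplying out
    \<open>M = M0 - D\<close> with \<open>D = \<tau> N - E1\<close>.\<close>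
  define E2 where "E2 = M0 * E1 + E1 * M0 + D * D"
  define k where "k = ((L + K)\<^sup>2 + K) * \<tau>\<^sup>2"
  note R = resolvent_expansion[OF c M(1,3) M0 T P E t K, folded N_def, folded E1_def D_def k_def]
  have L0: "0 \<le> L" using P by (rule opb_nonneg)
  have EC: "E1 \<in> carrier_mat n n" "D \<in> carrier_mat n n" using R by (auto dest: opb_carrier)
  then have EC2: "E2 \<in> carrier_mat n n" using C by (simp add: E2_def)
  have o2: "opb n (k + (1 * k + k * 1 + (L + K) * \<bar>\<tau>\<bar> * ((L + K) * \<bar>\<tau>\<bar>))) (E1 - E2)"
    unfolding E2_def by (intro opb_diff opb_add opb_mult R M0)
  \<comment> \<open>\<open>3 k\<close> comes from \<open>E1\<close> and its two products with
    \<open>M0\<close>, a further \<open>(L + K)^2 \<tau>^2\<close> from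
    \<open>D * D\<close>.\<close>
  have o3: "opb n ((4 * (L + K)\<^sup>2 + 3 * K) * \<tau>\<^sup>2) (E1 - E2)"
    by (rule opb_mono[OF o2]) (simp add: k_def power2_eq_square algebra_simps flip: abs_mult)
  have o4: "opb n ((4 * (L + K)\<^sup>2 + 3 * K) * \<tau>\<^sup>2) E1"
    using K by (intro opb_mono[OF R(2)]) (auto simp: k_def intro!: mult_right_mono)
  note X = mat_expand[where n=n]
  have res: "T * M = 1\<^sub>m n - M" if "(1\<^sub>m n + T) * M = 1\<^sub>m n" "T \<in> carrier_mat n n" "M \<in> carrier_mat n n" for T M :: "real mat"
  proof -
    have "M + T * M = 1\<^sub>m n" using that by (simp add: X)
    from mat_eq_diff[OF _ _ this, of n] show ?thesis using that by simp
  qed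
  have score_eq: "score n (T * M) y = y \<bullet> ((M - M * M) *\<^sub>v y) + mtrace M - real n"
    if "(1\<^sub>m n + T) * M = 1\<^sub>m n" "T \<in> carrier_mat n n" "M \<in> carrier_mat n n" for T M :: "real mat"
  proof -
    have "1\<^sub>m n - (1\<^sub>m n - M) = M" using that by auto
    then have "(1\<^sub>m n - M) * (1\<^sub>m n - (1\<^sub>m n - M)) = M - M * M" using that by (simp add: X)
    then show ?thesis unfolding score_def res[OF that] using that by (simp add: mtrace_diff[of _ n] mtrace_one)
  qed
  have "M * M = M0 * M0 - D * M0 - M0 * D + D * D"
  proof -
    have "M = M0 - D" using C by (auto simp: D_def)
    then show ?thesis using C EC by (auto simp: X simp del: index_mult_mat(1) intro!: eq_matI)
  qed
  moreover have "D = \<tau> \<cdot>\<^sub>m N - E1" using C NC by (auto simp: D_def E1_def)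
  then have "D * M0 = \<tau> \<cdot>\<^sub>m (N * M0) - E1 * M0" "M0 * D = \<tau> \<cdot>\<^sub>m (M0 * N) - M0 * E1"
    using C NC EC by (simp_all add: X)
  ultimately have MM: "(M - M * M) = (M0 - M0 * M0) - \<tau> \<cdot>\<^sub>m (N - M0 * N - N * M0) + (E1 - E2)"
    using C NC EC by (auto simp: E2_def E1_def algebra_simps simp del: index_mult_mat(1) intro!: eq_matI)
  have q: "y \<bullet> ((A + B) *\<^sub>v y) = y \<bullet> (A *\<^sub>v y) + y \<bullet> (B *\<^sub>v y)" "y \<bullet> ((A - B) *\<^sub>v y) = y \<bullet> (A *\<^sub>v y) - y \<bullet> (B *\<^sub>v y)"
    "y \<bullet> ((a \<cdot>\<^sub>m A) *\<^sub>v y) = a * (y \<bullet> (A *\<^sub>v y))"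
    if "A \<in> carrier_mat n n" "B \<in> carrier_mat n n" for A B a
    using that y by (simp_all add: add_mult_distrib_mat_vec[of _ n n] minus_mult_distrib_mat_vec[of _ n n]
       scalar_prod_add_distrib[of _ n] scalar_prod_minus_distrib[of _ n] smult_mat_mult_vec[of _ n])
  have "y \<bullet> ((M - M * M) *\<^sub>v y) = y \<bullet> ((M0 - M0 * M0) *\<^sub>v y) - \<tau> * (y \<bullet> ((N - M0 * N - N * M0) *\<^sub>v y)) + y \<bullet> ((E1 - E2) *\<^sub>v y)"
  proof -
    let ?A = "M0 - M0 * M0" and ?B = "N - M0 * N - N * M0" and ?G = "E1 - E2"
    have "?A \<in> carrier_mat n n" "?B \<in> carrier_mat n n" "?G \<in> carrier_mat n n" "?A - \<tau> \<cdot>\<^sub>m ?B \<in> carrier_mat n n"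
      using C NC EC EC2 by (auto intro!: minus_carrier_mat)
    then show ?thesis unfolding MM
      using q(1)[of "?A - \<tau> \<cdot>\<^sub>m ?B" ?G] q(2)[of ?A "\<tau> \<cdot>\<^sub>m ?B"] q(3)[of ?B ?B \<tau>] by simp
  qed
  moreover have "M = M0 - \<tau> \<cdot>\<^sub>m N + E1" using C NC by (auto simp: E1_def)
  then have "mtrace M = mtrace M0 - \<tau> * mtrace N + mtrace E1"
    using C NC EC by (metis mtrace_add mtrace_diff mtrace_smult minus_carrier_mat smult_carrier_mat)
  ultimately have "score n (T * M) y - score n (T0 * M0) y + \<tau> * (y \<bullet> ((N - M0 * N - N * M0) *\<^sub>v y) + mtrace N)
     = y \<bullet> ((E1 - E2) *\<^sub>v y) + mtrace E1"
    using C M M0 by (simp add: score_eq algebra_simps)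
  also have "\<bar>\<dots>\<bar> \<le> (4 * (L + K)\<^sup>2 + 3 * K) * \<tau>\<^sup>2 * (vnorm y)\<^sup>2 + (4 * (L + K)\<^sup>2 + 3 * K) * \<tau>\<^sup>2 * real n"
    using vnorm_quad_le[OF o3 y] mtrace_opb_le[OF o4] by linarith
  finally show ?thesis by (simp add: algebra_simps)
qed

section \<open>Inverses of the identity plus a Toeplitz matrix, and traces of their products\<close>

lemma psd_inverse:
  assumes T: "T \<in> carrier_mat n n" and psd: "\<And>x. x \<in> carrier_vec n \<Longrightarrow> 0 \<le> x \<bullet> (T *\<^sub>v x)"
  defines "M \<equiv> the (mat_inverse (1\<^sub>m n + T))"
  shows "M \<in> carrier_mat n n" "(1\<^sub>m n + T) * M = 1\<^sub>m n" "M * (1\<^sub>m n + T) = 1\<^sub>m n" "opb n 1 M"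
    "x \<in> carrier_vec n \<Longrightarrow> vnorm x \<le> vnorm ((1\<^sub>m n + T) *\<^sub>v x)"
proof -
  define S where "S = 1\<^sub>m n + T"
  have S: "S \<in> carrier_mat n n" using T by (simp add: S_def)
  have Sx: "S *\<^sub>v x = x + T *\<^sub>v x" if "x \<in> carrier_vec n" for x
    using that T by (simp add: S_def add_mult_distrib_mat_vec[of _ n n])
  \<comment> \<open>In \<open>|x + T x|^2\<close> the cross term is nonnegative, so
    \<open>1 + T\<close> shrinks no vector. This gives injectivity, hence invertibility, and the
    bound one for the inverse.\<close>
  have lower: "vnorm x \<le> vnorm (S *\<^sub>v x)" if x: "x \<in> carrier_vec n" for x
  proof (rule power2_le_imp_le)
    have Tx: "T *\<^sub>v x \<in> carrier_vec n" using T x by simp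
    have "(x + T *\<^sub>v x) \<bullet> (x + T *\<^sub>v x) = x \<bullet> x + x \<bullet> (T *\<^sub>v x) + ((T *\<^sub>v x) \<bullet> x + (T *\<^sub>v x) \<bullet> (T *\<^sub>v x))"
      using x Tx by (simp add: scalar_prod_add_distrib[of _ n] add_scalar_prod_distrib[of _ n])
    also have "(T *\<^sub>v x) \<bullet> x = x \<bullet> (T *\<^sub>v x)" using x Tx by (rule_tac comm_scalar_prod) auto
    also have "(T *\<^sub>v x) \<bullet> (T *\<^sub>v x) = (vnorm (T *\<^sub>v x))\<^sup>2" by (simp add: vnorm_sq)
    finally show "(vnorm x)\<^sup>2 \<le> (vnorm (S *\<^sub>v x))\<^sup>2"
      using psd[OF x] zero_le_power2[of "vnorm (T *\<^sub>v x)"] unfolding Sx[OF x] vnorm_sq by linarith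
  qed simp
  have "det S \<noteq> 0"
  proof
    assume "det S = 0"
    then obtain v where v: "v \<in> carrier_vec n" "v \<noteq> 0\<^sub>v n" "S *\<^sub>v v = 0\<^sub>v n"
      using det_0_iff_vec_prod_zero[OF S] by auto
    then have "vnorm v = 0" using lower[OF v(1)] vnorm_nonneg[of v] by simp
    then show False using vnorm_eq_0D v by blast
  qed
  then have "S \<in> Units (ring_mat TYPE(real) n undefined)" using S by (rule_tac det_non_zero_imp_unit)
  then obtain B where B: "mat_inverse S = Some B"
    using mat_inverse(1)[OF S, where b=undefined] by (cases "mat_inverse S") auto
  have inv: "S * M = 1\<^sub>m n" "M * S = 1\<^sub>m n" "M \<in> carrier_mat n n"
    using mat_inverse(2)[OF S B] B by (auto simp: M_def S_def)
  then show "M \<in> carrier_mat n n" "(1\<^sub>m n + T) * M = 1\<^sub>m n" "M * (1\<^sub>m n + T) = 1\<^sub>m n"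
    by (auto simp: S_def)
  { fix y :: "real vec" assume y: "y \<in> carrier_vec n"
    have "S *\<^sub>v (M *\<^sub>v y) = y" using assoc_mult_mat_vec[OF S inv(3) y] inv y by simp
    then have "vnorm (M *\<^sub>v y) \<le> 1 * vnorm y" using lower[of "M *\<^sub>v y"] inv y by simp }
  then show "opb n 1 M" using inv by (simp add: opb_def)
  show "x \<in> carrier_vec n \<Longrightarrow> vnorm x \<le> vnorm ((1\<^sub>m n + T) *\<^sub>v x)" using lower S_def by simp
qed

text \<open>The inverse occurring in \<open>Amat\<close>: by \<open>scaled_Rmat\<close>,
  \<open>Amat\<close> becomes \<open>toep n p * toepinv n p\<close> with \<open>p\<close> the symbol
  of \<open>b R\<close>.\<close>

definition toepinv :: "nat \<Rightarrow> (real \<Rightarrow> real) \<Rightarrow> real mat" where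
  "toepinv n p = the (mat_inverse (1\<^sub>m n + toep n p))"

lemma toepinv:
  assumes p: "continuous_on {-pi..pi} p" "\<And>t. t \<in> {-pi..pi} \<Longrightarrow> 0 \<le> p t"
  shows "toepinv n p \<in> carrier_mat n n" "(1\<^sub>m n + toep n p) * toepinv n p = 1\<^sub>m n"
    "toepinv n p * (1\<^sub>m n + toep n p) = 1\<^sub>m n" "opb n 1 (toepinv n p)"
    "x \<in> carrier_vec n \<Longrightarrow> vnorm x \<le> vnorm ((1\<^sub>m n + toep n p) *\<^sub>v x)"
  using psd_inverse[OF toep_carrier toep_quad_nonneg[OF p], of n] unfolding toepinv_def by auto

text \<open>A class closed under products and differences: the operator bound lets negligible errors
  survive products, and evenness of the symbol gives access to
  \<open>asymp_mult_even\<close>.\<close>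

definition asymp_toep :: "(nat \<Rightarrow> real mat) \<Rightarrow> (real \<Rightarrow> real) \<Rightarrow> bool" where
  "asymp_toep X f \<longleftrightarrow> continuous_on {-pi..pi} f \<and> (\<forall>x\<in>{-pi..pi}. f (- x) = f x) \<and>
     (\<exists>c. \<forall>n. opb n c (X n)) \<and> negl (\<lambda>n. X n - toep n f)"

lemma opb_toep_ex: "continuous_on {-pi..pi} f \<Longrightarrow> \<exists>c>0. \<forall>n. opb n c (toep n f)"
  using bounded_cont[of f] opb_toep[of f] by meson

lemma asymp_toep_toep: "continuous_on {-pi..pi} f \<Longrightarrow> (\<And>x. x \<in> {-pi..pi} \<Longrightarrow> f (- x) = f x) \<Longrightarrow>
   asymp_toep (\<lambda>n. toep n f) f"
proof -
  have "toep n f - toep n f = 0\<^sub>m n n" for n by auto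
  then have "negl (\<lambda>n. toep n f - toep n f)" using negl_zero by (simp only:)
  then show "continuous_on {-pi..pi} f \<Longrightarrow> (\<And>x. x \<in> {-pi..pi} \<Longrightarrow> f (- x) = f x) \<Longrightarrow> ?thesis"
    using opb_toep_ex[of f] by (auto simp: asymp_toep_def)
qed

lemma asymp_toep_mult:
  assumes X: "asymp_toep X f" and Y: "asymp_toep Y g"
  shows "asymp_toep (\<lambda>n. X n * Y n) (\<lambda>x. f x * g x)"
proof -
  obtain c where c: "\<And>n. opb n c (X n)" using X by (auto simp: asymp_toep_def)
  obtain d where d: "\<And>n. opb n d (Y n)" using Y by (auto simp: asymp_toep_def)
  have f: "continuous_on {-pi..pi} f" and g: "continuous_on {-pi..pi} g" using X Y by (auto simp: asymp_toep_def)
  obtain k where k: "\<And>n. opb n k (toep n g)" using opb_toep_ex[OF g] by blast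
  have 1: "negl (\<lambda>n. toep n f * toep n g - toep n (\<lambda>x. f x * g x))"
    using asymp_mult_even[OF g] Y f by (auto simp: asymp_toep_def asymp_mult_def)
  have "X n * Y n - toep n (\<lambda>x. f x * g x) = X n * (Y n - toep n g) +
     ((X n - toep n f) * toep n g + (toep n f * toep n g - toep n (\<lambda>x. f x * g x)))" for n
  proof -
    note C = opb_carrier[OF c, of n] opb_carrier[OF d, of n] toep_carrier
    have "X n * (Y n - toep n g) = X n * Y n - X n * toep n g" "(X n - toep n f) * toep n g = X n * toep n g - toep n f * toep n g"
      using C by (auto intro!: minus_mult_distrib_mat[of _ n n] mult_minus_distrib_mat[of _ n n])
    then show ?thesis using C by (intro eq_matI) (auto simp del: index_mult_mat(1))
  qed
  moreover have "negl (\<lambda>n. X n * (Y n - toep n g) +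
     ((X n - toep n f) * toep n g + (toep n f * toep n g - toep n (\<lambda>x. f x * g x))))"
    using X Y by (intro negl_add negl_mult_left[OF _ c] negl_mult_right[OF _ k] 1) (auto simp: asymp_toep_def)
  ultimately have "negl (\<lambda>n. X n * Y n - toep n (\<lambda>x. f x * g x))" by simp
  moreover have "\<forall>n. opb n (c * d) (X n * Y n)" using c d by (auto intro: opb_mult)
  ultimately show ?thesis using X Y f g by (auto simp: asymp_toep_def intro!: continuous_intros)
qed

lemma asymp_toep_diff:
  assumes X: "asymp_toep X f" and Y: "asymp_toep Y g"
  shows "asymp_toep (\<lambda>n. X n - Y n) (\<lambda>x. f x - g x)"
proof -
  obtain c where c: "\<And>n. opb n c (X n)" using X by (auto simp: asymp_toep_def)
  obtain d where d: "\<And>n. opb n d (Y n)" using Y by (auto simp: asymp_toep_def)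
  have f: "continuous_on {-pi..pi} f" and g: "continuous_on {-pi..pi} g" using X Y by (auto simp: asymp_toep_def)
  have "X n - Y n - toep n (\<lambda>x. f x - g x) = (X n - toep n f) - (Y n - toep n g)" for n
    using opb_carrier[OF c, of n] opb_carrier[OF d, of n] unfolding toep_diff[OF f g] by (intro eq_matI) auto
  moreover have "negl (\<lambda>n. (X n - toep n f) - (Y n - toep n g))"
    using X Y by (intro negl_diff[of "\<lambda>n. X n - toep n f" "\<lambda>n. Y n - toep n g"]) (auto simp: asymp_toep_def)
  moreover have "\<forall>n. opb n (c + d) (X n - Y n)" using c d by (auto intro: opb_diff)
  ultimately show ?thesis using X Y f g by (auto simp: asymp_toep_def intro!: continuous_intros)
qed

text \<open>\<open>tr T(f)\<close> is exactly \<open>n\<close> times the mean of \<open>f\<close>,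
  so only the negligible difference contributes an error.\<close>

lemma asymp_toep_trace:
  assumes X: "asymp_toep X f"
  shows "(\<lambda>n. mtrace (X n) / real n) \<longlonglongrightarrow> integral {-pi..pi} f / (2 * pi)"
proof -
  obtain c where c: "\<And>n. opb n c (X n)" using X by (auto simp: asymp_toep_def)
  have "(\<lambda>n. mtrace (X n - toep n f) / real n + integral {-pi..pi} f / (2 * pi)) \<longlonglongrightarrow> 0 + integral {-pi..pi} f / (2 * pi)"
    using X by (intro tendsto_add negl_trace tendsto_const) (auto simp: asymp_toep_def)
  moreover have "eventually (\<lambda>n. mtrace (X n - toep n f) / real n + integral {-pi..pi} f / (2 * pi) = mtrace (X n) / real n) sequentially"
    using eventually_gt_at_top[of 0]
  proof eventually_elim
    case (elim n)
    have "mtrace (X n - toep n f) = mtrace (X n) - mtrace (toep n f)"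
      by (rule mtrace_diff[OF opb_carrier[OF c] toep_carrier])
    then show ?case using elim by (simp add: mtrace_toep diff_divide_distrib)
  qed
  ultimately show ?thesis by (simp add: tendsto_cong)
qed

text \<open>\<open>1 + T(p)\<close> times \<open>T(1 / (1 + p))\<close> is the identity up to a
  negligible matrix; multiplication by the true inverse, of norm at most one, keeps the error
  negligible.\<close>

lemma asymp_toep_toepinv:
  assumes p: "continuous_on {-pi..pi} p" "\<And>t. t \<in> {-pi..pi} \<Longrightarrow> 0 \<le> p t" and ev: "\<And>x. x \<in> {-pi..pi} \<Longrightarrow> p (- x) = p x"
  shows "asymp_toep (\<lambda>n. toepinv n p) (\<lambda>x. 1 / (1 + p x))"
proof -
  let ?r = "\<lambda>x. 1 / (1 + p x)"
  have r: "continuous_on {-pi..pi} ?r" using p(2) by (intro continuous_intros p(1)) (metis add_nonneg_eq_0_iff zero_le_one zero_neq_one)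
  have S: "toep n (\<lambda>x. 1 + p x) = 1\<^sub>m n + toep n p" for n
    using toep_add[of "\<lambda>_. 1" p n] p by (simp add: toep_one)
  have A: "asymp_toep (\<lambda>n. toep n (\<lambda>x. 1 + p x) * toep n ?r) (\<lambda>x. (1 + p x) * ?r x)"
    by (intro asymp_toep_mult asymp_toep_toep r continuous_intros p) (use ev in auto)
  have *: "toep n (\<lambda>x. (1 + p x) * ?r x) = 1\<^sub>m n" for n
  proof -
    have "toep n (\<lambda>x. (1 + p x) * ?r x) = toep n (\<lambda>_. 1)"
      using p(2) by (intro toep_cong) (metis add_nonneg_eq_0_iff zero_le_one zero_neq_one nonzero_mult_div_cancel_left times_divide_eq_right mult.right_neutral)
    then show ?thesis by (simp add: toep_one)
  qed
  have "negl (\<lambda>n. (1\<^sub>m n + toep n p) * toep n ?r - 1\<^sub>m n)"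
    using A unfolding asymp_toep_def * S by blast
  then have "negl (\<lambda>n. - (toepinv n p * ((1\<^sub>m n + toep n p) * toep n ?r - 1\<^sub>m n)))"
    by (intro negl_uminus negl_mult_left[OF _ toepinv(4)[OF p]])
  moreover have "- (toepinv n p * ((1\<^sub>m n + toep n p) * toep n ?r - 1\<^sub>m n)) = toepinv n p - toep n ?r" for n
  proof -
    note c = toepinv(1)[OF p, of n]
    have "toepinv n p * ((1\<^sub>m n + toep n p) * toep n ?r - 1\<^sub>m n) = toepinv n p * ((1\<^sub>m n + toep n p) * toep n ?r) - toepinv n p * 1\<^sub>m n"
      using c by (intro mult_minus_distrib_mat[of _ n n]) (auto intro!: mult_carrier_mat)
    also have "toepinv n p * ((1\<^sub>m n + toep n p) * toep n ?r) = (toepinv n p * (1\<^sub>m n + toep n p)) * toep n ?r"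
      using c by (intro assoc_mult_mat[of _ n n _ n _ n, symmetric]) auto
    also have "toepinv n p * (1\<^sub>m n + toep n p) = 1\<^sub>m n" by (rule toepinv(3)[OF p])
    also have "1\<^sub>m n * toep n ?r = toep n ?r" by (rule left_mult_one_mat[of _ n n]) simp
    finally show ?thesis using c by auto
  qed
  ultimately have "negl (\<lambda>n. toepinv n p - toep n ?r)" by simp
  then show ?thesis using r ev toepinv(4)[OF p] by (auto simp: asymp_toep_def)
qed

text \<open>The first trace is \<open>tr A^2\<close> with \<open>A = 1 - M\<close>, half the
  variance of the score; the second is the mean slope in the form reached by
  \<open>slope_trace\<close>.\<close>

lemma score_traces:
  assumes p: "continuous_on {-pi..pi} p" "\<And>t. t \<in> {-pi..pi} \<Longrightarrow> 0 \<le> p t" and ev: "\<And>x. x \<in> {-pi..pi} \<Longrightarrow> p (- x) = p x"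
    and q: "continuous_on {-pi..pi} q" "\<And>x. x \<in> {-pi..pi} \<Longrightarrow> q (- x) = q x"
  shows "(\<lambda>n. mtrace ((1\<^sub>m n - toepinv n p) * (1\<^sub>m n - toepinv n p)) / real n) \<longlonglongrightarrow>
      integral {-pi..pi} (\<lambda>x. (p x / (1 + p x))\<^sup>2) / (2 * pi)"
    "(\<lambda>n. mtrace (toepinv n p * toep n q * toepinv n p * toep n p) / real n) \<longlonglongrightarrow>
      integral {-pi..pi} (\<lambda>x. q x * p x / (1 + p x)\<^sup>2) / (2 * pi)"
proof -
  have pp: "1 + p x \<noteq> 0" if "x \<in> {-pi..pi}" for x using p(2)[OF that] by simp
  have one: "asymp_toep (\<lambda>n. 1\<^sub>m n) (\<lambda>_. 1)" using asymp_toep_toep[of "\<lambda>_. 1"] by (simp add: toep_one)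
  note M = asymp_toep_toepinv[OF p ev]
  have "integral {-pi..pi} (\<lambda>x. (p x / (1 + p x))\<^sup>2) = integral {-pi..pi} (\<lambda>x. (1 - 1/(1 + p x)) * (1 - 1/(1 + p x)))"
    using pp by (intro integral_cong) (simp add: power2_eq_square diff_divide_eq_iff)
  then show "(\<lambda>n. mtrace ((1\<^sub>m n - toepinv n p) * (1\<^sub>m n - toepinv n p)) / real n) \<longlonglongrightarrow>
      integral {-pi..pi} (\<lambda>x. (p x / (1 + p x))\<^sup>2) / (2 * pi)"
    using asymp_toep_trace[OF asymp_toep_mult[OF asymp_toep_diff[OF one M] asymp_toep_diff[OF one M]]] by simp
  have "asymp_toep (\<lambda>n. toepinv n p * toep n q * toepinv n p * toep n p) (\<lambda>x. 1/(1 + p x) * q x * (1 / (1 + p x)) * p x)"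
    by (intro asymp_toep_mult M asymp_toep_toep p q ev)
  from asymp_toep_trace[OF this]
  show "(\<lambda>n. mtrace (toepinv n p * toep n q * toepinv n p * toep n p) / real n) \<longlonglongrightarrow>
      integral {-pi..pi} (\<lambda>x. q x * p x / (1 + p x)\<^sup>2) / (2 * pi)"
    by (simp add: power2_eq_square)
qed

section \<open>Simultaneous diagonalisation\<close>

definition bform :: "real mat \<Rightarrow> real vec \<Rightarrow> real vec \<Rightarrow> real" where
  "bform X x y = x \<bullet> (X *\<^sub>v y)"

lemma bform_add:
  assumes "X \<in> carrier_mat n n" "x \<in> carrier_vec n" "y \<in> carrier_vec n" "z \<in> carrier_vec n"
  shows "bform X (x + y) z = bform X x z + bform X y z" "bform X x (y + z) = bform X x y + bform X x z"
    "bform X (c \<cdot>\<^sub>v x) y = c * bform X x y" "bform X x (c \<cdot>\<^sub>v y) = c * bform X x y"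
  using assms by (simp_all add: bform_def mult_add_distrib_mat_vec[of _ n n] scalar_prod_add_distrib[of _ n]
      add_scalar_prod_distrib[of _ n] mult_mat_vec[of _ n n])

lemma bform_sym:
  assumes "X \<in> carrier_mat n n" "X\<^sup>T = X" "x \<in> carrier_vec n" "y \<in> carrier_vec n"
  shows "bform X x y = bform X y x"
proof -
  have "bform X x y = (X\<^sup>T *\<^sub>v x) \<bullet> y" using assms transpose_scalar_prod[of X n x y] by (simp add: bform_def)
  also have "\<dots> = y \<bullet> (X *\<^sub>v x)" unfolding assms(2) using assms by (intro comm_scalar_prod[of _ n]) auto
  finally show ?thesis by (simp add: bform_def)
qed

lemma bform_sum: "X \<in> carrier_mat n n \<Longrightarrow> x \<in> carrier_vec n \<Longrightarrow> y \<in> carrier_vec n \<Longrightarrow>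
    bform X x y = (\<Sum>i<n. \<Sum>j<n. x $ i * X $$ (i,j) * y $ j)"
  by (auto simp: bform_def scalar_prod_def atLeast0LessThan sum_distrib_left mult.assoc)

lemma vec_eq_smult_if_sum_zero:
  fixes a b :: "real vec"
  assumes "a \<in> carrier_vec n" "b \<in> carrier_vec n" "a + (- l) \<cdot>\<^sub>v b = 0\<^sub>v n"
  shows "a = l \<cdot>\<^sub>v b"
proof (rule eq_vecI)
  fix i assume i: "i < dim_vec (l \<cdot>\<^sub>v b)"
  have "(a + (- l) \<cdot>\<^sub>v b) $ i = 0" unfolding assms(3) using i assms by simp
  then show "a $ i = (l \<cdot>\<^sub>v b) $ i" using i assms(1,2) by simp
qed (use assms in auto)

text \<open>Zero rows are appended to make the system square; a vanishing row makes the matrix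
  singular.\<close>

lemma underdetermined_solution:
  fixes w :: "nat \<Rightarrow> real vec"
  assumes "k < n" "\<And>i. i < k \<Longrightarrow> w i \<in> carrier_vec n"
  shows "\<exists>x \<in> carrier_vec n. x \<noteq> 0\<^sub>v n \<and> (\<forall>i<k. w i \<bullet> x = 0)"
proof -
  define B where "B = mat n n (\<lambda>(i,j). if i < k then w i $ j else 0)"
  have B: "B \<in> carrier_mat n n" by (simp add: B_def)
  have "det B = 0"
  proof (rule ccontr)
    assume "det B \<noteq> 0"
    then have "B \<in> Units (ring_mat TYPE(real) n undefined)" by (rule det_non_zero_imp_unit[OF B])
    then obtain B' where B': "B' \<in> carrier_mat n n" "B * B' = 1\<^sub>m n" by (auto simp: Units_def ring_mat_simps)
    have "(B * B') $$ (k,k) = 0" using assms B B'(1) by (auto simp: scalar_prod_def B_def)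
    then show False unfolding B' using assms by simp
  qed
  then obtain x where x: "x \<in> carrier_vec n" "x \<noteq> 0\<^sub>v n" "B *\<^sub>v x = 0\<^sub>v n"
    using det_0_iff_vec_prod_zero[OF B] by auto
  have "w i \<bullet> x = 0" if "i < k" for i
  proof -
    have "(B *\<^sub>v x) $ i = w i \<bullet> x" using that assms x(1) by (auto simp: B_def scalar_prod_def)
    then show ?thesis using x that assms by simp
  qed
  then show ?thesis using x by blast
qed

text \<open>\<open>Sig\<close> plays the role of the covariance and \<open>G\<close> of its inverse; the assumption \<open>lower\<close> says \<open>Sig \<ge> I\<close>.\<close>

locale pencil =
  fixes n :: nat and G Sig T :: "real mat" and s :: real
  assumes G: "G \<in> carrier_mat n n" "G\<^sup>T = G" and Sig: "Sig \<in> carrier_mat n n"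
    and inv: "Sig * G = 1\<^sub>m n" "G * Sig = 1\<^sub>m n"
    and T: "T \<in> carrier_mat n n" "T\<^sup>T = T" and s: "opb n s Sig"
    and lower: "\<And>q. q \<in> carrier_vec n \<Longrightarrow> (vnorm q)\<^sup>2 \<le> bform Sig q q"
begin

text \<open>With \<open>q = G x\<close>, that is \<open>x = Sig q\<close>, \<open>lower\<close>
  gives \<open>|q|^2 \<le> q . Sig q = x . G x\<close>, and the bound on \<open>Sig\<close> gives
  \<open>|x| \<le> s |q|\<close>.\<close>

lemma G_lower: assumes x: "x \<in> carrier_vec n" shows "(vnorm x)\<^sup>2 \<le> s\<^sup>2 * bform G x x"
proof -
  define q where "q = G *\<^sub>v x"
  have q: "q \<in> carrier_vec n" using G x by (simp add: q_def)
  have xq: "x = Sig *\<^sub>v q" unfolding q_def using assoc_mult_mat_vec[OF Sig G(1) x] inv x by simp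
  have "bform Sig q q = q \<bullet> x" by (simp add: bform_def xq[symmetric])
  also have "\<dots> = x \<bullet> q" using x q by (rule_tac comm_scalar_prod)
  finally have "bform Sig q q = bform G x x" by (simp add: bform_def q_def)
  then have "(vnorm q)\<^sup>2 \<le> bform G x x" using lower[OF q] by simp
  moreover have "(vnorm x)\<^sup>2 \<le> s\<^sup>2 * (vnorm q)\<^sup>2"
    using power_mono[OF opbD[OF s q], of 2] by (simp add: xq[symmetric] power_mult_distrib)
  moreover have "s\<^sup>2 * (vnorm q)\<^sup>2 \<le> s\<^sup>2 * bform G x x"
    using calculation(1) by (intro mult_left_mono) auto
  ultimately show ?thesis by linarith
qed

lemma G_pos: assumes "x \<in> carrier_vec n" "x \<noteq> 0\<^sub>v n" shows "0 < bform G x x"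
proof (rule ccontr)
  assume "\<not> 0 < bform G x x"
  then have "s\<^sup>2 * bform G x x \<le> 0" by (simp add: mult_nonneg_nonpos)
  then have "(vnorm x)\<^sup>2 \<le> 0" using G_lower[OF assms(1)] by linarith
  then show False using assms vnorm_eq_0D by simp
qed

text \<open>The generalised eigenvalue problem \<open>T u = \<gamma> G u\<close>, with eigenvectors
  orthonormal for the inner product of \<open>G\<close>.\<close>

definition eigen_family :: "nat \<Rightarrow> (nat \<Rightarrow> real vec) \<Rightarrow> (nat \<Rightarrow> real) \<Rightarrow> bool" where
  "eigen_family k u \<gamma> \<longleftrightarrow> (\<forall>i<k. u i \<in> carrier_vec n \<and> T *\<^sub>v u i = \<gamma> i \<cdot>\<^sub>v (G *\<^sub>v u i)) \<and>
     (\<forall>i<k. \<forall>j<k. bform G (u i) (u j) = (if i = j then 1 else 0))"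

text \<open>The Rayleigh quotient of \<open>T\<close> against \<open>G\<close> attains its maximum
  because \<open>G_lower\<close> confines the vectors of \<open>G\<close>-norm one to a box of
  half-width \<open>s\<close>. Vectors are replaced by functions on \<open>nat\<close>, where the
  product topology supplies compactness and continuity.\<close>

lemma maximiser:
  assumes k: "k < n" and u: "\<And>i. i < k \<Longrightarrow> u i \<in> carrier_vec n"
  shows "\<exists>v \<in> carrier_vec n. bform G v v = 1 \<and> (\<forall>i<k. bform G (u i) v = 0) \<and>
     (\<forall>x \<in> carrier_vec n. (\<forall>i<k. bform G (u i) x = 0) \<longrightarrow> bform T x x \<le> bform T v v * bform G x x)"
proof -
  define q where "q X f = (\<Sum>i<n. \<Sum>j<n. f i * X $$ (i,j) * f j)" for X :: "real mat" and f :: "nat \<Rightarrow> real"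
  define l where "l i f = (\<Sum>a<n. \<Sum>b<n. u i $ a * G $$ (a,b) * f b)" for i and f :: "nat \<Rightarrow> real"
  have co: "continuous_on S (\<lambda>f :: nat \<Rightarrow> real. f i)" for S i by (rule continuous_on_subset[OF continuous_on_product_coordinates subset_UNIV])
  have qc: "continuous_on S (q X)" for S X unfolding q_def by (intro continuous_intros co)
  have lc: "continuous_on S (l i)" for S i unfolding l_def by (intro continuous_intros co)
  define F where "F = PiE {..<n} (\<lambda>_. {-s..s}) \<inter> ({f. q G f = 1} \<inter> (\<Inter>i\<in>{..<k}. {f. l i f = 0}))"
  \<comment> \<open>Coordinates from \<open>n\<close> on are frozen to \<open>undefined\<close>, so
    that the box is a product of compact sets over all of \<open>nat\<close>.\<close>
  have "compactin (product_topology (\<lambda>_. euclidean) UNIV) (PiE UNIV (\<lambda>i::nat. if i < n then {-s..s} else {undefined}))"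
    by (subst compactin_PiE) auto
  then have "compact (PiE UNIV (\<lambda>i::nat. if i < n then {-s..s} else {undefined}))"
    by (simp add: euclidean_product_topology)
  moreover have "PiE UNIV (\<lambda>i::nat. if i < n then {-s..s} else {undefined}) = PiE {..<n} (\<lambda>_. {-s..s})"
    by (auto simp: PiE_def Pi_def extensional_def)
  ultimately have "compact (PiE {..<n} (\<lambda>_::nat. {-s..s}))" by simp
  moreover have "closed ({f. q G f = 1} \<inter> (\<Inter>i\<in>{..<k}. {f. l i f = 0}))"
    by (intro closed_Int closed_INT ballI closed_Collect_eq qc lc continuous_on_const)
  ultimately have F: "compact F" unfolding F_def by (rule compact_Int_closed)
  have qv: "q X f = bform X (vec n f) (vec n f)" if "X \<in> carrier_mat n n" for X f
    using that by (simp add: q_def bform_sum[of _ n])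
  have lv: "l i f = bform G (u i) (vec n f)" if "i < k" for i f
    using that G u by (simp add: l_def bform_sum[of _ n])
  have norm: "\<exists>f\<in>F. vec n f = (1 / sqrt (bform G x x)) \<cdot>\<^sub>v x" if x: "x \<in> carrier_vec n" "x \<noteq> 0\<^sub>v n" "\<forall>i<k. bform G (u i) x = 0" for x
  proof -
    define g where "g = bform G x x"
    have g: "0 < g" unfolding g_def by (rule G_pos[OF x(1,2)])
    define y where "y = (1 / sqrt g) \<cdot>\<^sub>v x"
    define f where "f = restrict (\<lambda>i. y $ i) {..<n}"
    have y: "y \<in> carrier_vec n" using x by (simp add: y_def)
    have fy: "vec n f = y" using y by (auto simp: f_def)
    have 1: "bform G y y = 1" using g x G unfolding y_def by (simp add: bform_add[of _ n] g_def[symmetric])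
    have "(vnorm y)\<^sup>2 \<le> s\<^sup>2" using G_lower[OF y] 1 by simp
    then have ns: "vnorm y \<le> s" using opb_nonneg[OF s] by (auto intro: power2_le_imp_le)
    have "\<bar>y $ i\<bar> \<le> s" if "i < n" for i
    proof -
      have "(y $ i)\<^sup>2 \<le> (\<Sum>i<n. (y $ i)\<^sup>2)" using that by (intro member_le_sum) auto
      also have "\<dots> = (vnorm y)\<^sup>2" using y by (simp add: vnorm_def L2_set_def sum_nonneg)
      finally have "\<bar>y $ i\<bar> \<le> vnorm y" by (metis abs_of_nonneg abs_le_square_iff vnorm_nonneg)
      then show ?thesis using ns by simp
    qed
    then have "f \<in> PiE {..<n} (\<lambda>_. {-s..s})" by (auto simp: f_def abs_le_iff minus_le_iff)
    moreover have "bform G (u i) y = 0" if "i < k" for i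
      using x that u G unfolding y_def by (simp add: bform_add[of _ n])
    ultimately have "f \<in> F" unfolding F_def using 1 by (auto simp: qv[OF G(1)] lv fy)
    then show ?thesis using fy unfolding y_def g_def by blast
  qed
  \<comment> \<open>Fewer constraints than dimensions leave a nonzero admissible vector, so the
    maximum is taken over a nonempty set.\<close>
  obtain x0 where x0: "x0 \<in> carrier_vec n" "x0 \<noteq> 0\<^sub>v n" "\<forall>i<k. (G *\<^sub>v u i) \<bullet> x0 = 0"
    using underdetermined_solution[OF k, of "\<lambda>i. G *\<^sub>v u i"] G u by auto
  have "bform G (u i) x0 = 0" if "i < k" for i
    using x0 that transpose_scalar_prod[OF G(1) u[OF that] x0(1)] by (simp add: bform_def G)
  then have "F \<noteq> {}" using norm[OF x0(1,2)] by auto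
  then obtain f where f: "f \<in> F" "\<And>g. g \<in> F \<Longrightarrow> q T g \<le> q T f"
    using continuous_attains_sup[OF F _ qc] by blast
  define v where "v = vec n f"
  have v: "v \<in> carrier_vec n" by (simp add: v_def)
  have "bform T x x \<le> bform T v v * bform G x x" if x: "x \<in> carrier_vec n" "\<forall>i<k. bform G (u i) x = 0" for x
  proof (cases "x = 0\<^sub>v n")
    case True
    then have "bform X x x = 0" if "X \<in> carrier_mat n n" for X using that by (simp add: bform_def)
    then show ?thesis using T G by simp
  next
    case False
    from norm[OF x(1) False x(2)] obtain g where g: "g \<in> F" "vec n g = (1 / sqrt (bform G x x)) \<cdot>\<^sub>v x" by blast
    have p: "0 < bform G x x" by (rule G_pos[OF x(1) False])
    have "bform T x x / bform G x x \<le> bform T v v"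
      using f(2)[OF g(1)] x T p unfolding qv[OF T(1)] g(2) v_def[symmetric] by (simp add: bform_add[of _ n])
    then show ?thesis using p by (simp add: field_simps)
  qed
  moreover have "bform G v v = 1" "\<forall>i<k. bform G (u i) v = 0"
    using f(1) by (auto simp: F_def qv[OF G(1)] lv v_def)
  ultimately show ?thesis using v by blast
qed

text \<open>The next vector maximises the Rayleigh quotient on the \<open>G\<close>-orthogonal complement; perturbing it along the residual \<open>z\<close> of the eigenvalue equation shows that \<open>z\<close> vanishes.\<close>

lemma eigen_family_exists: "k \<le> n \<Longrightarrow> \<exists>u \<gamma>. eigen_family k u \<gamma>"
proof (induction k)
  case 0
  then show ?case by (simp add: eigen_family_def)
next
  case (Suc k)
  then obtain u \<gamma> where ug: "eigen_family k u \<gamma>" by auto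
  then have u: "i < k \<Longrightarrow> u i \<in> carrier_vec n" "i < k \<Longrightarrow> T *\<^sub>v u i = \<gamma> i \<cdot>\<^sub>v (G *\<^sub>v u i)" for i by (auto simp: eigen_family_def)
  obtain v where v: "v \<in> carrier_vec n" "bform G v v = 1" "\<And>i. i < k \<Longrightarrow> bform G (u i) v = 0"
     "\<And>x. x \<in> carrier_vec n \<Longrightarrow> (\<And>i. i < k \<Longrightarrow> bform G (u i) x = 0) \<Longrightarrow> bform T x x \<le> bform T v v * bform G x x"
    using maximiser[of k u] Suc.prems u by (auto simp: Suc_le_eq)
  define lam where "lam = bform T v v"
  define z where "z = Sig *\<^sub>v (T *\<^sub>v v) + (- lam) \<cdot>\<^sub>v v"
  have Tv: "T *\<^sub>v v \<in> carrier_vec n" using T v by simp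
  have z: "z \<in> carrier_vec n" using Sig Tv v by (simp add: z_def)
  have Gz: "G *\<^sub>v z = T *\<^sub>v v + (- lam) \<cdot>\<^sub>v (G *\<^sub>v v)"
  proof -
    have "G *\<^sub>v z = G *\<^sub>v (Sig *\<^sub>v (T *\<^sub>v v)) + (- lam) \<cdot>\<^sub>v (G *\<^sub>v v)"
      unfolding z_def using G Sig Tv v by (simp add: mult_add_distrib_mat_vec[of _ n n] mult_mat_vec[of _ n n])
    also have "G *\<^sub>v (Sig *\<^sub>v (T *\<^sub>v v)) = T *\<^sub>v v"
      using assoc_mult_mat_vec[OF G(1) Sig Tv] inv Tv by simp
    finally show ?thesis .
  qed
  have bz: "bform G x z = bform T x v - lam * bform G x v" if "x \<in> carrier_vec n" for x
    using that Tv v G unfolding bform_def Gz by (simp add: scalar_prod_add_distrib[of _ n])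
  have zv: "bform G v z = 0" unfolding bz[OF v(1)] using v by (simp add: lam_def)
  have uz: "bform G (u i) z = 0" if "i < k" for i
  proof -
    have "bform T (u i) v = bform T v (u i)" using T u(1)[OF that] v by (intro bform_sym[of _ n]) auto
    also have "\<dots> = \<gamma> i * bform G v (u i)" using u[OF that] v G by (simp add: bform_def)
    also have "bform G v (u i) = bform G (u i) v" using G u(1)[OF that] v by (intro bform_sym[of _ n]) auto
    finally show ?thesis using bz[OF u(1)[OF that]] v(3)[OF that] by simp
  qed
  define c where "c = bform G z z"
  have zTv: "bform T z v = c" using bz[OF z] zv bform_sym[OF G z v(1)] by (simp add: c_def)
  have "2 * c \<le> e * (lam * c - bform T z z)" if e: "0 < e" for e
  proof -
    have ez: "e \<cdot>\<^sub>v z \<in> carrier_vec n" using z by simp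
    note B = bform_add[OF G(1) v(1) ez ez] bform_add[OF G(1) v(1) ez v(1)] bform_add[OF G(1) z v(1) ez] bform_add[OF G(1) z z ez] bform_add[OF G(1) v(1) z ez]
       bform_add[OF T(1) v(1) ez ez] bform_add[OF T(1) v(1) ez v(1)] bform_add[OF T(1) z v(1) ez] bform_add[OF T(1) z z ez] bform_add[OF T(1) v(1) z ez]
    have 1: "bform G (v + e \<cdot>\<^sub>v z) (v + e \<cdot>\<^sub>v z) = 1 + e\<^sup>2 * c"
      using v z G zv bform_sym[OF G z v(1)] by (simp add: bform_add[of _ n] c_def power2_eq_square)
    have 2: "bform T (v + e \<cdot>\<^sub>v z) (v + e \<cdot>\<^sub>v z) = lam + 2 * e * c + e\<^sup>2 * bform T z z"
      using v z T zTv bform_sym[OF T z v(1)] by (simp add: bform_add[of _ n] lam_def power2_eq_square algebra_simps)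
    have "bform G (u i) (v + e \<cdot>\<^sub>v z) = 0" if "i < k" for i
      using uz[OF that] v(3)[OF that] v(1) z G u(1)[OF that] by (simp add: bform_add[of _ n])
    from v(4)[OF _ this] have "lam + 2 * e * c + e\<^sup>2 * bform T z z \<le> lam * (1 + e\<^sup>2 * c)"
      using v(1) z unfolding 1 2 lam_def[symmetric] by simp
    then have "e * (2 * c) \<le> e * (e * (lam * c - bform T z z))" by (simp add: algebra_simps power2_eq_square)
    then show ?thesis using e by simp
  qed
  note small = this
  have "c \<le> 0"
  proof (rule ccontr)
    assume "\<not> c \<le> 0"
    then have c0: "0 < c" by simp
    \<comment> \<open>For \<open>e = c / d\<close> the inequality \<open>small\<close> would give
      \<open>2 c \<le> c\<close>.\<close>
    define d where "d = \<bar>lam * c - bform T z z\<bar> + 1"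
    have d: "0 < d" by (simp add: d_def)
    have "2 * c \<le> (c / d) * (lam * c - bform T z z)" using small[of "c/d"] c0 d by simp
    also have "\<dots> \<le> (c / d) * d" using c0 d by (intro mult_left_mono) (auto simp: d_def)
    also have "\<dots> = c" using d by simp
    finally show False using c0 by simp
  qed
  then have "z = 0\<^sub>v n" using G_pos[OF z] unfolding c_def by force
  moreover have "G *\<^sub>v 0\<^sub>v n = 0\<^sub>v n" using G by auto
  ultimately have "T *\<^sub>v v + (- lam) \<cdot>\<^sub>v (G *\<^sub>v v) = 0\<^sub>v n" using Gz by simp
  then have Tvl: "T *\<^sub>v v = lam \<cdot>\<^sub>v (G *\<^sub>v v)"
  proof -
    assume *: "T *\<^sub>v v + (- lam) \<cdot>\<^sub>v (G *\<^sub>v v) = 0\<^sub>v n"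
    have GV: "G *\<^sub>v v \<in> carrier_vec n" using G v by simp
    show ?thesis by (rule vec_eq_smult_if_sum_zero[OF Tv GV *])
  qed
  have "bform G v (u i) = 0" if "i < k" for i
    using v(3)[OF that] bform_sym[OF G v(1) u(1)[OF that]] by simp
  then have "eigen_family (Suc k) (u(k := v)) (\<gamma>(k := lam))"
    using ug v Tvl unfolding eigen_family_def by (auto simp: less_Suc_eq)
  then show ?case by blast
qed

text \<open>\<open>U\<close> has the eigenvectors as columns. \<open>U\<^sup>T G\<close> is a left
  inverse of \<open>U\<close>, hence a right inverse, and \<open>U U\<^sup>T G = 1\<close> says
  \<open>U U\<^sup>T = Sig\<close>. Each \<open>\<gamma>\<close> is a value of the form of
  \<open>T\<close> at a vector of norm at most \<open>s\<close>, by \<open>G_lower\<close>.\<close>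

lemma simultaneous_diagonalisation:
  "\<exists>U \<gamma>. U \<in> carrier_mat n n \<and> U\<^sup>T * G * U = 1\<^sub>m n \<and> U * U\<^sup>T = Sig \<and>
     U\<^sup>T * T * U = mat n n (\<lambda>(i,j). if i = j then \<gamma> i else 0) \<and>
     (\<forall>c. opb n c T \<longrightarrow> (\<forall>i<n. \<bar>\<gamma> i\<bar> \<le> c * s\<^sup>2))"
proof -
  obtain u \<gamma> where ug: "eigen_family n u \<gamma>" using eigen_family_exists by blast
  define U where "U = mat n n (\<lambda>(i,j). u j $ i)"
  have U: "U \<in> carrier_mat n n" by (simp add: U_def)
  have uc: "u i \<in> carrier_vec n" if "i < n" for i using ug that by (simp add: eigen_family_def)
  have colU: "col U j = u j" if "j < n" for j using uc[OF that] that by (auto simp: U_def)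
  have ent: "(U\<^sup>T * X * U) $$ (i,j) = bform X (u i) (u j)" if "X \<in> carrier_mat n n" "i < n" "j < n" for X i j
  proof -
    have "U\<^sup>T * X * U = U\<^sup>T * (X * U)" using U that by (intro assoc_mult_mat[of _ n n _ n _ n]) auto
    also have "\<dots> $$ (i,j) = col U i \<bullet> col (X * U) j" using U that by simp
    also have "col (X * U) j = X *\<^sub>v col U j" using U that by (auto intro!: eq_vecI)
    finally show ?thesis using that by (simp add: colU bform_def)
  qed
  have 1: "U\<^sup>T * G * U = 1\<^sub>m n"
  proof (rule eq_matI)
    fix i j assume "i < dim_row (1\<^sub>m n :: real mat)" "j < dim_col (1\<^sub>m n :: real mat)"
    then show "(U\<^sup>T * G * U) $$ (i,j) = 1\<^sub>m n $$ (i,j)"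
      using ent[OF G(1), of i j] ug by (simp only: index_one_mat) (simp add: eigen_family_def)
  qed (use U in auto)
  have bT: "bform T (u i) (u j) = (if i = j then \<gamma> i else 0)" if "i < n" "j < n" for i j
  proof -
    have "bform T (u i) (u j) = \<gamma> j * bform G (u i) (u j)" using ug that uc G by (simp add: bform_def eigen_family_def)
    then show ?thesis using ug that by (simp add: eigen_family_def)
  qed
  have 2: "U\<^sup>T * T * U = mat n n (\<lambda>(i,j). if i = j then \<gamma> i else 0)"
  proof (rule eq_matI)
    fix i j assume "i < dim_row (mat n n (\<lambda>(i,j). if i = j then \<gamma> i else 0))" "j < dim_col (mat n n (\<lambda>(i,j). if i = j then \<gamma> i else 0))"
    then have ij: "i < n" "j < n" by auto
    show "(U\<^sup>T * T * U) $$ (i,j) = mat n n (\<lambda>(i,j). if i = j then \<gamma> i else 0) $$ (i,j)"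
      unfolding ent[OF T(1) ij] bT[OF ij] using ij by simp
  qed (use U in auto)
  have UGU: "(U\<^sup>T * G) * U = 1\<^sub>m n" using 1 .
  have "U * (U\<^sup>T * G) = 1\<^sub>m n" by (rule mat_mult_left_right_inverse[OF _ U UGU]) (use U G in auto)
  then have "U * (U\<^sup>T * G) * Sig = Sig" using Sig by simp
  moreover have "U * (U\<^sup>T * G) * Sig = U * U\<^sup>T"
  proof -
    have "U * (U\<^sup>T * G) * Sig = U * (U\<^sup>T * (G * Sig))"
      using U G Sig by (simp add: assoc_mult_mat[of _ n n _ n _ n])
    then show ?thesis unfolding inv using U by simp
  qed
  ultimately have 3: "U * U\<^sup>T = Sig" by simp
  have "\<bar>\<gamma> i\<bar> \<le> c * s\<^sup>2" if c: "opb n c T" and i: "i < n" for c i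
  proof -
    have "\<gamma> i = bform T (u i) (u i)" using bT[OF i i] by simp
    then have "\<bar>\<gamma> i\<bar> \<le> c * (vnorm (u i))\<^sup>2" using vnorm_quad_le[OF c uc[OF i]] by (simp add: bform_def)
    also have "\<dots> \<le> c * (s\<^sup>2 * bform G (u i) (u i))" using opb_nonneg[OF c] by (intro mult_left_mono G_lower uc i)
    also have "bform G (u i) (u i) = 1" using ug i by (simp add: eigen_family_def)
    finally show ?thesis by simp
  qed
  then show ?thesis using U 1 2 3 by blast
qed
end

section \<open>Gaussian quadratic forms\<close>

text \<open>Divided by its mean \<open>m\<close>, the weight \<open>u\<close> is the density of a
  new probability measure, under which \<open>w\<close> has the standard normal characteristic
  function; uniqueness identifies the law.\<close>

lemma (in prob_space) weighted_normal_law: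
  fixes u w :: "'a \<Rightarrow> real"
  assumes [measurable]: "u \<in> borel_measurable M" "w \<in> borel_measurable M" and u: "\<And>x. 0 \<le> u x" "\<And>x. u x \<le> C"
    and m: "0 < m" and ch: "\<And>t. (CLINT x|M. complex_of_real (u x) * iexp (t * w x)) = complex_of_real (m * exp (- t\<^sup>2 / 2))"
    and B[measurable]: "B \<in> sets borel"
  shows "(LINT x|M. u x * indicator B (w x)) = m * measure std_normal_distribution B"
proof -
  have iu: "integrable M u" using u by (intro integrable_const_bound[where B=C]) auto
  have "complex_of_real (LINT x|M. u x) = complex_of_real m" using ch[of 0] by simp
  then have Eu: "(LINT x|M. u x) = m" using of_real_eq_iff by blast
  define M1 where "M1 = density M (\<lambda>x. ennreal (u x / m))"
  have "prob_space M1"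
  proof
    have "emeasure M1 (space M1) = (\<integral>\<^sup>+x. ennreal (u x / m) \<partial>M)"
      by (simp add: M1_def emeasure_density cong: nn_integral_cong_simp)
    also have "\<dots> = ennreal (LINT x|M. u x / m)" using iu u m by (intro nn_integral_eq_integral) (auto intro!: AE_I2)
    also have "(LINT x|M. u x / m) = 1" using Eu m by simp
    finally show "emeasure M1 (space M1) = 1" by simp
  qed
  then interpret M1: prob_space M1 .
  have wM1[measurable]: "w \<in> borel_measurable M1" by (simp add: M1_def)
  have um: "0 \<le> u x / m" for x using u m by simp
  have "char (distr M1 borel w) t = char std_normal_distribution t" for t
  proof -
    have "char (distr M1 borel w) t = (CLINT x|M1. iexp (t * w x))" by (simp add: char_def integral_distr)
    also have "\<dots> = (CLINT x|M. (u x / m) *\<^sub>R iexp (t * w x))"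
      unfolding M1_def by (rule integral_density) (auto simp: um)
    also have "\<dots> = (CLINT x|M. (1/m) *\<^sub>R (complex_of_real (u x) * iexp (t * w x)))"
      by (intro Bochner_Integration.integral_cong) (auto simp: scaleR_conv_of_real)
    also have "\<dots> = complex_of_real (exp (- t\<^sup>2 / 2))" using ch[of t] m by (simp only: integral_scaleR_right) (simp add: scaleR_conv_of_real)
    finally show ?thesis by (simp add: char_std_normal_distribution)
  qed
  then have D: "distr M1 borel w = std_normal_distribution"
    by (intro Levy_uniqueness real_dist_normal_dist M1.real_distribution_distr wM1 ext)
  have "(LINT x|M. u x * indicator B (w x)) = m * (LINT x|M. (u x / m) *\<^sub>R indicator B (w x))"
    using m by (subst integral_mult_right_zero[symmetric]) (auto intro!: Bochner_Integration.integral_cong)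
  also have "(LINT x|M. (u x / m) *\<^sub>R indicator B (w x)) = (LINT x|M1. (indicator B (w x) :: real))"
    unfolding M1_def by (rule integral_density[symmetric]) (auto simp: um)
  also have "\<dots> = (LINT x|std_normal_distribution. indicator B x)"
    unfolding D[symmetric] by (rule integral_distr[symmetric]) auto
  also have "\<dots> = measure std_normal_distribution B" by simp
  finally show ?thesis .
qed

text \<open>Condition on the event that the last coordinate lies in \<open>A n\<close>. The remaining coordinates keep their characteristic function: apply \<open>weighted_normal_law\<close> with the weights \<open>1 + cos\<close> and \<open>1 + sin\<close> of their linear combinations, which are nonnegative.\<close>

lemma normal_coordinates_product:
  fixes w :: "nat \<Rightarrow> 'a \<Rightarrow> real"
  assumes "prob_space M" and "\<And>j. j < n \<Longrightarrow> w j \<in> borel_measurable M"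
    and "\<And>s. (CLINT x|M. iexp (\<Sum>j<n. s j * w j x)) = complex_of_real (exp (- (\<Sum>j<n. (s j)\<^sup>2) / 2))"
    and "\<And>j. j < n \<Longrightarrow> A j \<in> sets borel"
  shows "measure M {x \<in> space M. \<forall>j<n. w j x \<in> A j} = (\<Prod>j<n. measure std_normal_distribution (A j))"
  using assms
proof (induction n arbitrary: M)
  case 0
  then show ?case by (simp add: prob_space.prob_space)
next
  case (Suc n)
  interpret prob_space M by fact
  have wm[measurable]: "w n \<in> borel_measurable M" and Am[measurable]: "A n \<in> sets borel" using Suc.prems by auto
  have wj[measurable]: "w j \<in> borel_measurable M" "A j \<in> sets borel" if "j < n" for j using Suc.prems that by auto
  define E where "E = {x \<in> space M. w n x \<in> A n}"
  have Em[measurable]: "E \<in> sets M" unfolding E_def by measurable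
  define g where "g s x = (\<Sum>j<n. s j * w j x)" for s x
  have gm[measurable]: "g s \<in> borel_measurable M" for s unfolding g_def by (intro borel_measurable_sum borel_measurable_times) auto
  define c where "c s = exp (- (\<Sum>j<n. (s j)\<^sup>2) / 2)" for s :: "nat \<Rightarrow> real"
  have I: "(CLINT x|M. iexp (g s x + t * w n x)) = complex_of_real (c s * exp (- t\<^sup>2 / 2))" for s t
  proof -
    have "(\<Sum>j<Suc n. (if j < n then s j else t) * w j x) = g s x + t * w n x" for x by (simp add: g_def)
    moreover have "(\<Sum>j<Suc n. (if j < n then s j else t)\<^sup>2) = (\<Sum>j<n. (s j)\<^sup>2) + t\<^sup>2" by simp
    ultimately show ?thesis using Suc.prems(3)[of "\<lambda>j. if j < n then s j else t"]
      by (simp add: c_def exp_add[symmetric] diff_divide_distrib)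
  qed
  have gneg: "g (\<lambda>j. - s j) x = - g s x" for s x by (simp add: g_def sum_negf)
  have cneg: "c (\<lambda>j. - s j) = c s" for s by (simp add: c_def)
  have I0: "(CLINT x|M. iexp (t * w n x)) = complex_of_real (exp (- t\<^sup>2 / 2))" for t
    using I[of "\<lambda>_. 0" t] by (simp add: g_def c_def)
  have Im: "(CLINT x|M. iexp (- g s x + t * w n x)) = complex_of_real (c s * exp (- t\<^sup>2 / 2))" for s t
    using I[of "\<lambda>j. - s j" t] by (simp add: gneg cneg)
  have ii: "integrable M (\<lambda>x. iexp (f x))" if "f \<in> borel_measurable M" for f using that by (intro integrable_const_bound[where B=1]) auto
  have shift: "iexp (g s x + t * w n x) = iexp (g s x) * iexp (t * w n x)"
    "iexp (- g s x + t * w n x) = exp (- (\<i> * g s x)) * iexp (t * w n x)" for s t x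
    by (simp_all add: exp_add[symmetric] algebra_simps)
  have cs: "0 \<le> 1 + cos z" "0 \<le> 1 + sin z" "1 + cos z \<le> 2" "1 + sin z \<le> 2" for z :: real
    using cos_ge_minus_one[of z] sin_ge_minus_one[of z] cos_le_one[of z] sin_le_one[of z] by linarith+
  have PE: "measure M E = measure std_normal_distribution (A n)"
  proof -
    have "measure M E = (LINT x|M. indicator E x)" by simp
    also have "\<dots> = (LINT x|M. indicator (A n) (w n x))"
      by (intro Bochner_Integration.integral_cong) (auto simp: E_def indicator_def)
    finally show ?thesis using weighted_normal_law[of "\<lambda>_. 1" "w n" 1 1 "A n"] I0 by simp
  qed
  have cosE: "(LINT x|M. (1 + cos (g s x)) * indicator (A n) (w n x)) = (1 + c s) * measure std_normal_distribution (A n)" for s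
  proof (rule weighted_normal_law[where C=2])
    fix t
    have "complex_of_real (1 + cos (g s x)) * iexp (t * w n x) =
       iexp (t * w n x) + ((1/2) * iexp (g s x + t * w n x) + (1/2) * iexp (- g s x + t * w n x))" for x
      unfolding shift by (simp add: cos_of_real[symmetric] cos_exp_eq algebra_simps)
    then have "(CLINT x|M. complex_of_real (1 + cos (g s x)) * iexp (t * w n x)) =
      (CLINT x|M. iexp (t * w n x)) + ((1/2) * (CLINT x|M. iexp (g s x + t * w n x)) + (1/2) * (CLINT x|M. iexp (- g s x + t * w n x)))"
      by (simp only:) (simp only: integral_mult_right_zero Bochner_Integration.integral_add ii integrable_mult_right Bochner_Integration.integrable_add
          borel_measurable_add borel_measurable_uminus borel_measurable_times borel_measurable_const gm wm)
    then show "(CLINT x|M. complex_of_real (1 + cos (g s x)) * iexp (t * w n x)) = complex_of_real ((1 + c s) * exp (- t\<^sup>2 / 2))"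
      unfolding I I0 Im by (simp add: algebra_simps)
  qed (auto simp: c_def add_pos_pos cs)
  have sinE: "(LINT x|M. (1 + sin (g s x)) * indicator (A n) (w n x)) = 1 * measure std_normal_distribution (A n)" for s
  proof (rule weighted_normal_law[where C=2])
    fix t
    have "complex_of_real (1 + sin (g s x)) * iexp (t * w n x) =
       iexp (t * w n x) + ((- \<i>/2) * iexp (g s x + t * w n x) + (\<i>/2) * iexp (- g s x + t * w n x))" for x
    proof -
      have "(p - q) / (2 * \<i>) = (- \<i> / 2) * (p - q)" for p q :: complex by (simp add: field_simps)
      then have h1: "complex_of_real (sin (g s x)) = (- \<i> / 2) * (iexp (g s x) - exp (- (\<i> * g s x)))"
        by (simp add: sin_of_real[symmetric] sin_exp_eq)
      have h2: "(1 + S) * W = W + ((- \<i> / 2) * (P * W) + (\<i> / 2) * (Q * W))" if "S = (- \<i> / 2) * (P - Q)" for S P Q W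
        unfolding that by (simp add: field_simps)
      show ?thesis unfolding shift unfolding of_real_add of_real_1 by (rule h2[OF h1])
    qed
    then have "(CLINT x|M. complex_of_real (1 + sin (g s x)) * iexp (t * w n x)) =
      (CLINT x|M. iexp (t * w n x)) + ((-\<i>/2) * (CLINT x|M. iexp (g s x + t * w n x)) + (\<i>/2) * (CLINT x|M. iexp (- g s x + t * w n x)))"
      by (simp only:) (simp only: integral_mult_right_zero Bochner_Integration.integral_add ii integrable_mult_right Bochner_Integration.integrable_add
          borel_measurable_add borel_measurable_uminus borel_measurable_times borel_measurable_const gm wm)
    then show "(CLINT x|M. complex_of_real (1 + sin (g s x)) * iexp (t * w n x)) = complex_of_real (1 * exp (- t\<^sup>2 / 2))"
      unfolding I I0 Im by (simp add: algebra_simps)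
  qed (auto simp: c_def add_pos_pos cs)
  have indE: "indicator (A n) (w n x) = (indicator E x :: real)" if "x \<in> space M" for x
    using that by (auto simp: E_def indicator_def)
  have iE: "integrable M (\<lambda>x. indicator E x :: real)"
    by (intro integrable_const_bound[where B=1]) (auto split: split_indicator)
  have iB: "integrable M (\<lambda>x. f x * indicator E x)" if "f \<in> borel_measurable M" "\<And>x. \<bar>f x\<bar> \<le> 1" for f :: "'a \<Rightarrow> real"
    using that by (intro integrable_const_bound[where B=1]) (auto intro!: AE_I2 split: split_indicator)
  have cosE': "(LINT x|M. cos (g s x) * indicator E x) = c s * measure M E" for s
  proof -
    have "(LINT x|M. (1 + cos (g s x)) * indicator (A n) (w n x)) = (LINT x|M. indicator E x + cos (g s x) * indicator E x)"
      by (intro Bochner_Integration.integral_cong) (auto simp: indE distrib_right)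
    also have "\<dots> = measure M E + (LINT x|M. cos (g s x) * indicator E x)"
      using iB[of "\<lambda>x. cos (g s x)"] iE by (subst Bochner_Integration.integral_add) auto
    finally show ?thesis using cosE[of s] PE by (simp add: algebra_simps)
  qed
  have sinE': "(LINT x|M. sin (g s x) * indicator E x) = 0" for s
  proof -
    have "(LINT x|M. (1 + sin (g s x)) * indicator (A n) (w n x)) = (LINT x|M. indicator E x + sin (g s x) * indicator E x)"
      by (intro Bochner_Integration.integral_cong) (auto simp: indE distrib_right)
    also have "\<dots> = measure M E + (LINT x|M. sin (g s x) * indicator E x)"
      using iB[of "\<lambda>x. sin (g s x)"] iE by (subst Bochner_Integration.integral_add) auto
    finally show ?thesis using sinE[of s] PE by (simp add: algebra_simps)
  qed
  have split: "{x \<in> space M. \<forall>j<Suc n. w j x \<in> A j} = E \<inter> {x \<in> space M. \<forall>j<n. w j x \<in> A j}"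
    by (auto simp: E_def less_Suc_eq)
  have Fm: "{x \<in> space M. \<forall>j<n. w j x \<in> A j} \<in> sets M"
  proof -
    have "{x \<in> space M. \<forall>j\<in>{..<n}. w j x \<in> A j} \<in> sets M"
    proof (rule sets.sets_Collect_finite_All)
      fix j assume "j \<in> {..<n}"
      then have "w j -` A j \<inter> space M \<in> sets M" by (intro measurable_sets[OF wj(1) wj(2)]) auto
      moreover have "w j -` A j \<inter> space M = {x \<in> space M. w j x \<in> A j}" by auto
      ultimately show "{x \<in> space M. w j x \<in> A j} \<in> sets M" by simp
    qed simp
    then show ?thesis by (simp only: Ball_def lessThan_iff)
  qed
  show ?case
  proof (cases "measure M E = 0")
    \<comment> \<open>Conditioning on a null event is impossible; here the left side and the factor
      for \<open>A n\<close> both vanish.\<close>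
    case True
    have "measure M (E \<inter> {x \<in> space M. \<forall>j<n. w j x \<in> A j}) \<le> measure M E"
      using Em by (intro finite_measure_mono) auto
    then show ?thesis unfolding split using True PE by (simp add: measure_le_0_iff)
  next
    case False
    then have p: "0 < measure M E" by (simp add: zero_less_measure_iff)
    \<comment> \<open>The conditional measure is written as a density, so that
      \<open>integral_density\<close> computes characteristic functions under it.\<close>
    define M' where "M' = density M (\<lambda>x. ennreal (indicator E x / measure M E))"
    have M': "M' = uniform_measure M E"
      unfolding M'_def uniform_measure_def using p
      by (intro density_cong) (auto simp: emeasure_eq_measure divide_ennreal[symmetric] ennreal_indicator intro!: AE_I2)
    have ps: "prob_space M'" unfolding M' using p by (intro prob_space_uniform_measure) (auto simp: emeasure_eq_measure)
    have "measure M' {x \<in> space M'. \<forall>j<n. w j x \<in> A j} = (\<Prod>j<n. measure std_normal_distribution (A j))"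
    proof (rule Suc.IH[OF ps])
      fix s
      have "(CLINT x|M'. iexp (\<Sum>j<n. s j * w j x)) = (CLINT x|M. (indicator E x / measure M E) *\<^sub>R iexp (g s x))"
        unfolding M'_def g_def[symmetric] using p by (intro integral_density) auto
      also have "\<dots> = (CLINT x|M. complex_of_real (1 / measure M E) * (complex_of_real (cos (g s x) * indicator E x) + \<i> * complex_of_real (sin (g s x) * indicator E x)))"
        by (intro Bochner_Integration.integral_cong) (auto simp: scaleR_conv_of_real exp_Euler cos_of_real sin_of_real algebra_simps)
      also have "\<dots> = complex_of_real (1 / measure M E) * (complex_of_real (c s * measure M E) + \<i> * complex_of_real 0)"
        unfolding cosE'[symmetric] sinE'[of s, symmetric] using iB[of "\<lambda>x. cos (g s x)"] iB[of "\<lambda>x. sin (g s x)"]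
        by (simp only: integral_mult_right_zero)
           (subst Bochner_Integration.integral_add, auto simp del: of_real_mult intro!: integrable_mult_right)
      also have "\<dots> = complex_of_real (c s)" using p by simp
      finally show "(CLINT x|M'. iexp (\<Sum>j<n. s j * w j x)) = complex_of_real (exp (- (\<Sum>j<n. (s j)\<^sup>2) / 2))"
        by (simp add: c_def)
    qed (auto simp: M'_def intro: wj)
    moreover have "measure M' {x \<in> space M'. \<forall>j<n. w j x \<in> A j} = measure M (E \<inter> {x \<in> space M. \<forall>j<n. w j x \<in> A j}) / measure M E"
      unfolding M' using Fm by (subst measure_uniform_measure) (use p in \<open>auto simp: emeasure_eq_measure\<close>)
    ultimately show ?thesis unfolding split using p PE by (simp add: field_simps)
  qed
qed

context prob_space begin

text \<open>Taking \<open>UNIV\<close> for all sets but one yields the marginals; taking it outside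
  a finite index set yields the product rule of independence.\<close>

lemma normal_coordinates:
  fixes w :: "nat \<Rightarrow> 'a \<Rightarrow> real"
  assumes w: "\<And>j. j < n \<Longrightarrow> w j \<in> borel_measurable M"
    and ch: "\<And>s. (CLINT x|M. iexp (\<Sum>j<n. s j * w j x)) = complex_of_real (exp (- (\<Sum>j<n. (s j)\<^sup>2) / 2))"
  shows "\<And>j. j < n \<Longrightarrow> distr M borel (w j) = std_normal_distribution" and "indep_vars (\<lambda>_. borel) w {..<n}"
proof -
  note aux = normal_coordinates_product[OF prob_space_axioms w ch]
  have one: "measure std_normal_distribution UNIV = 1"
    using prob_space.prob_space[of std_normal_distribution] by (simp add: prob_space_normal_density)
  have single: "prob (w j -` B \<inter> space M) = measure std_normal_distribution B" if "j < n" "B \<in> sets borel" for j B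
  proof -
    have "{x \<in> space M. \<forall>i<n. w i x \<in> (if i = j then B else UNIV)} = w j -` B \<inter> space M" using that by auto
    moreover have "(\<Prod>i<n. measure std_normal_distribution (if i = j then B else UNIV)) = (\<Prod>i<n. if i = j then measure std_normal_distribution B else 1)"
      by (intro prod.cong) (auto simp: one)
    moreover have "\<dots> = measure std_normal_distribution B" using that by (simp add: prod.delta)
    ultimately show ?thesis using aux[of "\<lambda>i. if i = j then B else UNIV"] that by simp
  qed
  show "distr M borel (w j) = std_normal_distribution" if j: "j < n" for j
  proof (rule measure_eqI)
    fix B assume "B \<in> sets (distr M borel (w j))"
    then have B: "B \<in> sets borel" by simp
    interpret N: prob_space std_normal_distribution by (simp add: prob_space_normal_density)
    have "emeasure (distr M borel (w j)) B = ennreal (prob (w j -` B \<inter> space M))"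
      using w[OF j] B by (simp add: emeasure_distr emeasure_eq_measure)
    also have "\<dots> = emeasure std_normal_distribution B" using single[OF j B] by (simp add: N.emeasure_eq_measure)
    finally show "emeasure (distr M borel (w j)) B = emeasure std_normal_distribution B" .
  qed simp
  show "indep_vars (\<lambda>_. borel) w {..<n}"
    unfolding indep_vars_def2
  proof (intro conjI ballI)
    show "random_variable borel (w i)" if "i \<in> {..<n}" for i using w that by simp
    show "indep_sets (\<lambda>i. {w i -` A \<inter> space M |A. A \<in> sets borel}) {..<n}"
    proof (rule indep_setsI)
      show "{w i -` A \<inter> space M |A. A \<in> sets borel} \<subseteq> events" if "i \<in> {..<n}" for i
        using w that by (auto intro: measurable_sets)
      fix A J assume J: "J \<noteq> {}" "J \<subseteq> {..<n}" "finite J" "\<forall>j\<in>J. A j \<in> {w j -` A \<inter> space M |A. A \<in> sets borel}"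
      then obtain B where B: "\<And>j. j \<in> J \<Longrightarrow> B j \<in> sets borel" "\<And>j. j \<in> J \<Longrightarrow> A j = w j -` B j \<inter> space M"
        by (auto simp: Ball_def) metis
      have "(\<Inter>j\<in>J. A j) = {x \<in> space M. \<forall>i<n. w i x \<in> (if i \<in> J then B i else UNIV)}"
        using B J by auto
      also have "prob \<dots> = (\<Prod>i<n. measure std_normal_distribution (if i \<in> J then B i else UNIV))"
        using B by (intro aux) auto
      also have "\<dots> = (\<Prod>i<n. if i \<in> J then measure std_normal_distribution (B i) else 1)"
        by (intro prod.cong) (auto simp: one)
      also have "\<dots> = (\<Prod>i\<in>J. measure std_normal_distribution (B i))"
        using J by (subst prod.inter_restrict[symmetric]) (auto simp: Int_absorb1)
      also have "\<dots> = (\<Prod>i\<in>J. prob (A i))" using B J by (intro prod.cong) (auto simp: single)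
      finally show "prob (\<Inter>j\<in>J. A j) = (\<Prod>j\<in>J. prob (A j))" .
    qed
  qed
qed

section \<open>Moments and a central limit theorem for weighted sums of centred squares\<close>

lemma std_normal_moments:
  assumes [measurable]: "w \<in> borel_measurable M" and d: "distr M borel w = std_normal_distribution"
  shows "integrable M (\<lambda>x. (w x)^k)" "expectation (\<lambda>x. (w x)\<^sup>2) = 1" "expectation (\<lambda>x. (w x)^4) = 3"
proof -
  show i: "integrable M (\<lambda>x. (w x)^k)" for k
    using integrable_std_normal_distribution_moment[of k] unfolding d[symmetric] by (subst (asm) integrable_distr_eq) auto
  have e: "expectation (\<lambda>x. (w x)^k) = (LINT x|std_normal_distribution. x^k)" for k
    unfolding d[symmetric] by (subst integral_distr) auto
  show "expectation (\<lambda>x. (w x)\<^sup>2) = 1"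
    using std_normal_distribution_even_moments(1)[of 1] by (simp add: e fact_2)
  have "fact 4 = (24::real)" by (simp add: fact_numeral)
  then show "expectation (\<lambda>x. (w x)^4) = 3"
    using std_normal_distribution_even_moments(1)[of 2] by (simp add: e fact_2)
qed

lemma centred_square_moments:
  assumes [measurable]: "w \<in> borel_measurable M" and d: "distr M borel w = std_normal_distribution"
  defines "X \<equiv> \<lambda>x. (w x)\<^sup>2 - 1"
  shows "X \<in> borel_measurable M" "integrable M X" "integrable M (\<lambda>x. (X x)\<^sup>2)" "expectation X = 0" "expectation (\<lambda>x. (X x)\<^sup>2) = 2"
    "integrable M (\<lambda>x. \<bar>X x\<bar>^3)"
proof -
  note i = std_normal_moments(1)[OF assms(1,2)]
  show "X \<in> borel_measurable M" by (simp add: X_def)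
  show "integrable M X" unfolding X_def using i[of 2] by simp
  have sq: "(X x)\<^sup>2 = (w x)^4 - 2 * (w x)\<^sup>2 + 1" for x by (simp add: X_def power2_eq_square power4_eq_xxxx algebra_simps)
  show "integrable M (\<lambda>x. (X x)\<^sup>2)" unfolding sq using i[of 2] i[of 4] by simp
  show "expectation X = 0" unfolding X_def using i[of 2] std_normal_moments(2)[OF assms(1,2)] by (simp add: prob_space)
  show "expectation (\<lambda>x. (X x)\<^sup>2) = 2" unfolding sq using i[of 2] i[of 4] std_normal_moments(2,3)[OF assms(1,2)] by (simp add: prob_space)
  show "integrable M (\<lambda>x. \<bar>X x\<bar>^3)"
  proof (rule Bochner_Integration.integrable_bound[where f="\<lambda>x. (w x)^6 + 3 * (w x)^4 + 3 * (w x)^2 + 1"])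
    show "integrable M (\<lambda>x. (w x)^6 + 3 * (w x)^4 + 3 * (w x)^2 + 1)" using i[of 2] i[of 4] i[of 6] by simp
    show "(\<lambda>x. \<bar>X x\<bar>^3) \<in> borel_measurable M" by (simp add: X_def)
    have "norm (\<bar>X x\<bar>^3) \<le> norm ((w x)^6 + 3 * (w x)^4 + 3 * (w x)^2 + 1)" for x
    proof -
      have "\<bar>X x\<bar> \<le> (w x)\<^sup>2 + 1" unfolding X_def using abs_triangle_ineq4[of "(w x)\<^sup>2" 1] by simp
      then have "\<bar>X x\<bar>^3 \<le> ((w x)\<^sup>2 + 1)^3" by (intro power_mono) auto
      also have "\<dots> = (w x)^6 + 3 * (w x)^4 + 3 * (w x)^2 + 1" by (simp add: eval_nat_numeral algebra_simps)
      finally show ?thesis by simp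
    qed
    then show "AE x in M. norm (\<bar>X x\<bar>^3) \<le> norm ((w x)^6 + 3 * (w x)^4 + 3 * (w x)^2 + 1)" by simp
  qed
qed

end

lemma exp_minus_taylor: "0 \<le> u \<Longrightarrow> \<bar>exp (- u) - (1 - u)\<bar> \<le> u\<^sup>2" for u :: real
proof -
  assume u: "0 \<le> u"
  have "exp (-u) * (1 + u) \<le> exp (-u) * exp u" using exp_ge_add_one_self[of u] by (intro mult_left_mono) auto
  also have "\<dots> = 1" by (simp add: exp_minus)
  \<comment> \<open>The product equals \<open>1 + u^3\<close>.\<close>
  also have "1 \<le> (1 - u + u\<^sup>2) * (1 + u)" using u by (simp add: algebra_simps power2_eq_square)
  finally have "exp (-u) \<le> 1 - u + u\<^sup>2" using u by (simp add: mult_le_cancel_right)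
  then show ?thesis using exp_ge_add_one_self[of "-u"] by simp
qed

text \<open>The characteristic function of a centred chi-square variable with one degree of
  freedom.\<close>

definition chi_char :: "real \<Rightarrow> complex" where
  "chi_char t = char (distr std_normal_distribution borel (\<lambda>x. x\<^sup>2 - 1)) t"

text \<open>Both functions are close to \<open>1 - t^2\<close>: a centred square has mean 0 and
  variance 2, and its third absolute moment supplies \<open>K\<close>; the term \<open>t^4\<close>
  is the Taylor error of the exponential.\<close>

lemma chi_char_approx: "\<exists>K. \<forall>t. cmod (chi_char t - exp (- t\<^sup>2)) \<le> K * \<bar>t\<bar>^3 + t^4"
proof -
  interpret N: prob_space std_normal_distribution by (simp add: prob_space_normal_density)
  have d: "distr std_normal_distribution borel (\<lambda>x. x) = std_normal_distribution" by (intro distr_id2) auto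
  note m = N.centred_square_moments[of "\<lambda>x. x", OF _ d, simplified]
  define K where "K = (LINT x|std_normal_distribution. \<bar>x\<^sup>2 - 1\<bar>^3) / 6"
  have "cmod (chi_char t - exp (- t\<^sup>2)) \<le> K * \<bar>t\<bar>^3 + t^4" for t
  proof -
    have "cmod (chi_char t - (1 - t\<^sup>2 * 2 / 2)) \<le> (t\<^sup>2 / 6) * (LINT x|std_normal_distribution. min (6 * (x\<^sup>2 - 1)\<^sup>2) (\<bar>t\<bar> * \<bar>x\<^sup>2 - 1\<bar>^3))"
      unfolding chi_char_def of_real_power[symmetric]
      using N.char_approx3'[of "\<lambda>x. x\<^sup>2 - 1" 2 "distr std_normal_distribution borel (\<lambda>x. x\<^sup>2 - 1)" t] m by simp
    also have "\<dots> \<le> (t\<^sup>2 / 6) * (LINT x|std_normal_distribution. \<bar>t\<bar> * \<bar>x\<^sup>2 - 1\<bar>^3)"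
      using m by (intro mult_left_mono integral_mono) (auto intro!: Bochner_Integration.integrable_bound[where f="\<lambda>x. 6 * (x\<^sup>2 - 1)\<^sup>2"])
    also have "\<dots> = K * \<bar>t\<bar>^3" by (simp add: K_def power3_eq_cube power2_eq_square abs_mult_self_eq mult_ac)
    finally have 1: "cmod (chi_char t - (1 - t\<^sup>2)) \<le> K * \<bar>t\<bar>^3" by simp
    have "cmod (complex_of_real (exp (- t\<^sup>2)) - (1 - t\<^sup>2)) = \<bar>exp (- t\<^sup>2) - (1 - t\<^sup>2)\<bar>"
      by (simp only: norm_of_real[where 'a=complex, symmetric] of_real_diff of_real_1 of_real_power)
    also have "\<dots> \<le> t^4" using exp_minus_taylor[of "t\<^sup>2"] by (simp add: power_mult[symmetric])
    finally have 2: "cmod (complex_of_real (exp (- t\<^sup>2)) - (1 - t\<^sup>2)) \<le> t^4" .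
    have "chi_char t - exp (- t\<^sup>2) = (chi_char t - (1 - t\<^sup>2)) - (complex_of_real (exp (- t\<^sup>2)) - (1 - t\<^sup>2))"
      by (simp add: exp_of_real[symmetric])
    also have "cmod \<dots> \<le> K * \<bar>t\<bar>^3 + t^4" using 1 2 norm_triangle_ineq4 by (meson add_mono order_trans)
    finally show ?thesis .
  qed
  then show ?thesis by blast
qed

text \<open>Factors are exchanged one at a time; all the others have modulus at most one.\<close>

lemma norm_prod_diff_le:
  fixes z w :: "'i \<Rightarrow> complex"
  assumes "finite I" "\<And>i. i \<in> I \<Longrightarrow> norm (z i) \<le> 1" "\<And>i. i \<in> I \<Longrightarrow> norm (w i) \<le> 1"
  shows "norm ((\<Prod>i\<in>I. z i) - (\<Prod>i\<in>I. w i)) \<le> (\<Sum>i\<in>I. norm (z i - w i))"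
  using assms
proof (induction I)
  case (insert a I)
  have "norm (\<Prod>i\<in>I. w i) \<le> 1" unfolding prod_norm[symmetric] using insert by (intro prod_le_1) auto
  moreover have "z a * (\<Prod>i\<in>I. z i) - w a * (\<Prod>i\<in>I. w i) = z a * ((\<Prod>i\<in>I. z i) - (\<Prod>i\<in>I. w i)) + (z a - w a) * (\<Prod>i\<in>I. w i)"
    by (simp add: algebra_simps)
  ultimately have "norm (z a * (\<Prod>i\<in>I. z i) - w a * (\<Prod>i\<in>I. w i)) \<le> 1 * norm ((\<Prod>i\<in>I. z i) - (\<Prod>i\<in>I. w i)) + norm (z a - w a) * 1"
    using insert.prems by (simp only:) (intro norm_triangle_le add_mono order_trans[OF norm_mult_ineq] mult_mono, auto)
  then show ?case using insert by simp
qed simp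

context prob_space begin

lemma char_quadratic:
  assumes w: "\<And>j. j < n \<Longrightarrow> w j \<in> borel_measurable M"
    and d: "\<And>j. j < n \<Longrightarrow> distr M borel (w j) = std_normal_distribution" and i: "indep_vars (\<lambda>_. borel) w {..<n}"
  shows "char (distr M borel (\<lambda>x. \<Sum>j<n. c j * ((w j x)\<^sup>2 - 1))) t = (\<Prod>j<n. chi_char (t * c j))"
proof -
  have "indep_vars (\<lambda>_. borel) (\<lambda>j x. c j * ((w j x)\<^sup>2 - 1)) {..<n}"
    by (rule indep_vars_compose2[OF i, where Y="\<lambda>j y. c j * (y\<^sup>2 - 1)"]) measurable
  then have "char (distr M borel (\<lambda>x. \<Sum>j<n. c j * ((w j x)\<^sup>2 - 1))) t = (\<Prod>j<n. char (distr M borel (\<lambda>x. c j * ((w j x)\<^sup>2 - 1))) t)"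
    by (rule char_distr_sum)
  also have "\<dots> = (\<Prod>j<n. chi_char (t * c j))"
  proof (rule prod.cong[OF refl])
    fix j assume "j \<in> {..<n}"
    then have [measurable]: "w j \<in> borel_measurable M" and dj: "distr M borel (w j) = std_normal_distribution" using w d by auto
    have "char (distr M borel (\<lambda>x. c j * ((w j x)\<^sup>2 - 1))) t = (CLINT x|M. iexp (t * c j * ((w j x)\<^sup>2 - 1)))"
      by (simp add: char_def integral_distr mult.assoc)
    also have "\<dots> = (CLINT x|distr M borel (w j). iexp (t * c j * (x\<^sup>2 - 1)))" by (subst integral_distr) auto
    also have "\<dots> = chi_char (t * c j)" unfolding dj chi_char_def char_def by (subst integral_distr) auto
    finally show "char (distr M borel (\<lambda>x. c j * ((w j x)\<^sup>2 - 1))) t = chi_char (t * c j)" .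
  qed
  finally show ?thesis .
qed

text \<open>By independence the cross terms vanish, and each centred square has variance 2; the rest
  is Chebyshev's inequality.\<close>

lemma second_moment_quadratic:
  fixes c :: "nat \<Rightarrow> real"
  assumes w: "\<And>j. j < n \<Longrightarrow> w j \<in> borel_measurable M"
    and d: "\<And>j. j < n \<Longrightarrow> distr M borel (w j) = std_normal_distribution" and i: "indep_vars (\<lambda>_. borel) w {..<n}"
  defines "S \<equiv> \<lambda>x. \<Sum>j<n. c j * ((w j x)\<^sup>2 - 1)"
  assumes a: "0 < a"
  shows "prob {x \<in> space M. a \<le> \<bar>S x\<bar>} \<le> 2 * (\<Sum>j<n. (c j)\<^sup>2) / a\<^sup>2"
proof -
  define X where "X j x = (w j x)\<^sup>2 - 1" for j x
  note m = centred_square_moments[OF w d, folded X_def]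
  have ind: "indep_vars (\<lambda>_. borel) X {..<n}" unfolding X_def
    by (rule indep_vars_compose2[OF i, where Y="\<lambda>j y. y\<^sup>2 - 1"]) measurable
  have cross: "integrable M (\<lambda>x. X j x * X k x)" "expectation (\<lambda>x. X j x * X k x) = (if j = k then 2 else 0)" if "j < n" "k < n" for j k
  proof -
    have "integrable M (\<lambda>x. X j x * X k x) \<and> expectation (\<lambda>x. X j x * X k x) = (if j = k then 2 else 0)"
    proof (cases "j = k")
      case True
      then show ?thesis using m(3,5)[of k] that by (simp add: power2_eq_square)
    next
      case False
      have ind2: "indep_vars (\<lambda>_. borel) X {j,k}" using indep_vars_subset[OF ind] that by auto
      have "integrable M (\<lambda>x. \<Prod>i\<in>{j,k}. X i x)" "expectation (\<lambda>x. \<Prod>i\<in>{j,k}. X i x) = (\<Prod>i\<in>{j,k}. expectation (X i))"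
        using that m(2) by (auto intro!: indep_vars_integrable indep_vars_lebesgue_integral ind2)
      then show ?thesis using False that m(4) by auto
    qed
    then show "integrable M (\<lambda>x. X j x * X k x)" "expectation (\<lambda>x. X j x * X k x) = (if j = k then 2 else 0)" by auto
  qed
  have [measurable]: "S \<in> borel_measurable M" unfolding S_def X_def[symmetric] using m(1) by (intro borel_measurable_sum borel_measurable_times) auto
  have sq: "(S x)\<^sup>2 = (\<Sum>j<n. \<Sum>k<n. c j * c k * (X j x * X k x))" for x
    unfolding S_def X_def[symmetric] power2_eq_square[of "\<Sum>j<n. _ j"] sum_product by (simp add: mult_ac)
  have iS: "integrable M (\<lambda>x. (S x)\<^sup>2)" unfolding sq using cross(1) by (intro Bochner_Integration.integrable_sum integrable_mult_right) auto
  have ES: "expectation S = 0" unfolding S_def X_def[symmetric] using m(2,4) by (subst Bochner_Integration.integral_sum) auto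
  have "expectation (\<lambda>x. (S x)\<^sup>2) = (\<Sum>j<n. \<Sum>k<n. c j * c k * (if j = k then 2 else 0))"
    unfolding sq using cross by (subst Bochner_Integration.integral_sum) (auto simp: Bochner_Integration.integral_sum intro!: sum.cong)
  also have "\<dots> = 2 * (\<Sum>j<n. (c j)\<^sup>2)" by (simp add: if_distrib sum.delta power2_eq_square sum_distrib_left mult_ac cong: if_cong)
  finally have "variance S = 2 * (\<Sum>j<n. (c j)\<^sup>2)" by (simp add: ES)
  then show ?thesis using Chebyshev_inequality[OF _ iS a] by (simp add: ES)
qed

text \<open>Each factor of the characteristic function is replaced by a Gaussian one of the same
  variance. As the \<open>\<gamma>\<close> are uniformly bounded, the \<open>n\<close> errors are of
  order \<open>n^(-3/2)\<close> each and sum to a null sequence, which takes the place of a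
  Lindeberg condition. The Gaussian product depends only on the sum of the squared
  \<open>\<gamma>\<close>. Each \<open>n\<close> may have its own family \<open>w n\<close>.\<close>

lemma quadratic_clt:
  assumes w: "\<And>n j. j < n \<Longrightarrow> w n j \<in> borel_measurable M"
    and d: "\<And>n j. j < n \<Longrightarrow> distr M borel (w n j) = std_normal_distribution" and i: "\<And>n. indep_vars (\<lambda>_. borel) (w n) {..<n}"
    and g: "\<And>n j. j < n \<Longrightarrow> \<bar>\<gamma> n j\<bar> \<le> G" and lim: "(\<lambda>n. (\<Sum>j<n. (\<gamma> n j)\<^sup>2) / real n) \<longlonglongrightarrow> v"
  shows "(\<lambda>n. char (distr M borel (\<lambda>x. (\<Sum>j<n. \<gamma> n j * ((w n j x)\<^sup>2 - 1)) / sqrt (real n))) t) \<longlonglongrightarrow> exp (- v * t\<^sup>2)"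
proof -
  obtain K0 where K0: "\<And>t. cmod (chi_char t - exp (- t\<^sup>2)) \<le> K0 * \<bar>t\<bar>^3 + t^4" using chi_char_approx by blast
  define K where "K = \<bar>K0\<bar>"
  have K: "cmod (chi_char t - exp (- t\<^sup>2)) \<le> K * \<bar>t\<bar>^3 + t^4" for t
    using order_trans[OF K0[of t] add_right_mono[OF mult_right_mono[of K0 K "\<bar>t\<bar>^3"]]] by (simp add: K_def)
  have G: "0 \<le> G" using g[of 0 1] by simp
  have chi1: "cmod (chi_char t) \<le> 1" for t unfolding chi_char_def
    by (intro real_distribution.cmod_char_le_1 prob_space.real_distribution_distr prob_space_normal_density) auto
  define b where "b n j = t * (\<gamma> n j / sqrt (real n))" for n j
  have ch: "char (distr M borel (\<lambda>x. (\<Sum>j<n. \<gamma> n j * ((w n j x)\<^sup>2 - 1)) / sqrt (real n))) t = (\<Prod>j<n. chi_char (b n j))" for n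
    using char_quadratic[OF w d i, of n "\<lambda>j. \<gamma> n j / sqrt (real n)" t] by (simp add: b_def sum_divide_distrib)
  have "(\<lambda>n. (\<Prod>j<n. complex_of_real (exp (- (b n j)\<^sup>2)))) \<longlonglongrightarrow> exp (- v * t\<^sup>2)"
  proof -
    have "(\<Prod>j<n. complex_of_real (exp (- (b n j)\<^sup>2))) = complex_of_real (exp (- ((\<Sum>j<n. (\<gamma> n j)\<^sup>2) / real n * t\<^sup>2)))" for n
      by (simp add: of_real_prod[symmetric] exp_sum[symmetric] b_def power_mult_distrib power_divide sum_divide_distrib sum_distrib_right sum_distrib_left sum_negf mult_ac del: of_real_exp of_real_prod)
    moreover have "(\<lambda>n. complex_of_real (exp (- ((\<Sum>j<n. (\<gamma> n j)\<^sup>2) / real n * t\<^sup>2)))) \<longlonglongrightarrow> complex_of_real (exp (- (v * t\<^sup>2)))"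
      by (intro tendsto_intros lim)
    ultimately show ?thesis by (simp add: exp_of_real)
  qed
  moreover have "(\<lambda>n. (\<Prod>j<n. chi_char (b n j)) - (\<Prod>j<n. complex_of_real (exp (- (b n j)\<^sup>2)))) \<longlonglongrightarrow> 0"
  proof (rule tendsto_0_le[where K=1])
    define B where "B = \<bar>t\<bar> * G"
    have "(\<lambda>n. c1 / sqrt (real n) + c2 / real n) \<longlonglongrightarrow> 0" for c1 c2 :: real by real_asymp
    moreover have "real n * (K * (B / sqrt (real n))^3 + (B / sqrt (real n))^4) = (K * B^3) / sqrt (real n) + B^4 / real n" for n
    proof (cases "n = 0")
      case False
      have "sqrt (real n) ^ 3 = real n * sqrt (real n)" "sqrt (real n) ^ 4 = real n * real n" by (simp_all add: eval_nat_numeral)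
      then show ?thesis using False by (simp add: power_divide distrib_left)
    qed simp
    ultimately show "(\<lambda>n. real n * (K * (B / sqrt (real n))^3 + (B / sqrt (real n))^4)) \<longlonglongrightarrow> 0" by (simp only:)
    have "cmod ((\<Prod>j<n. chi_char (b n j)) - (\<Prod>j<n. complex_of_real (exp (- (b n j)\<^sup>2)))) \<le> real n * (K * (B / sqrt (real n))^3 + (B / sqrt (real n))^4)" for n
    proof -
      have bB: "\<bar>b n j\<bar> \<le> B / sqrt (real n)" if "j < n" for j
        using g[OF that] by (simp add: b_def B_def abs_mult divide_right_mono mult_left_mono)
      have "cmod ((\<Prod>j<n. chi_char (b n j)) - (\<Prod>j<n. complex_of_real (exp (- (b n j)\<^sup>2)))) \<le> (\<Sum>j<n. cmod (chi_char (b n j) - complex_of_real (exp (- (b n j)\<^sup>2))))"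
        by (intro norm_prod_diff_le chi1) auto
      also have "\<dots> \<le> (\<Sum>j<n. K * (B / sqrt (real n))^3 + (B / sqrt (real n))^4)"
      proof (rule sum_mono)
        fix j assume "j \<in> {..<n}"
        then have l: "\<bar>b n j\<bar> \<le> B / sqrt (real n)" using bB by simp
        have "cmod (chi_char (b n j) - complex_of_real (exp (- (b n j)\<^sup>2))) \<le> K * \<bar>b n j\<bar>^3 + (b n j)^4" using K[of "b n j"] by (simp add: exp_of_real)
        also have "(b n j)^4 = \<bar>b n j\<bar>^4" by simp
        also have "K * \<bar>b n j\<bar>^3 + \<bar>b n j\<bar>^4 \<le> K * (B / sqrt (real n))^3 + (B / sqrt (real n))^4"
          using l by (intro add_mono mult_left_mono power_mono) (auto simp: K_def)
        finally show "cmod (chi_char (b n j) - complex_of_real (exp (- (b n j)\<^sup>2))) \<le> K * (B / sqrt (real n))^3 + (B / sqrt (real n))^4" .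
      qed
      finally show ?thesis by simp
    qed
    then show "\<forall>\<^sub>F n in sequentially. norm ((\<Prod>j<n. chi_char (b n j)) - (\<Prod>j<n. complex_of_real (exp (- (b n j)\<^sup>2)))) \<le> norm (real n * (K * (B / sqrt (real n))^3 + (B / sqrt (real n))^4)) * 1"
      by (intro always_eventually allI) (simp only: mult_1_right real_norm_def, rule order_trans[OF _ abs_ge_self])
  qed
  ultimately have "(\<lambda>n. ((\<Prod>j<n. chi_char (b n j)) - (\<Prod>j<n. complex_of_real (exp (- (b n j)\<^sup>2)))) + (\<Prod>j<n. complex_of_real (exp (- (b n j)\<^sup>2)))) \<longlonglongrightarrow> 0 + complex_of_real (exp (- v * t\<^sup>2))"
    by (intro tendsto_add)
  then show ?thesis unfolding ch by simp
qed
end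

section \<open>Convergence in probability, Slutsky's lemma and the linearised root\<close>

context prob_space begin

text \<open>Convergence in probability to zero. Measurability is included because a set outside the
  sigma-algebra has \<open>prob\<close> zero, which would make the limit vacuous.\<close>

definition to_zero :: "(nat \<Rightarrow> 'a \<Rightarrow> real) \<Rightarrow> bool" where
  "to_zero X \<longleftrightarrow> (\<forall>n. X n \<in> borel_measurable M) \<and> (\<forall>e>0. (\<lambda>n. prob {x \<in> space M. e < \<bar>X n x\<bar>}) \<longlonglongrightarrow> 0)"

lemma to_zeroI_bound:
  assumes X: "\<And>n. X n \<in> borel_measurable M"
    and b: "\<And>e. 0 < e \<Longrightarrow> \<exists>f. f \<longlonglongrightarrow> 0 \<and> eventually (\<lambda>n. prob {x \<in> space M. e < \<bar>X n x\<bar>} \<le> f n) sequentially"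
  shows "to_zero X"
  unfolding to_zero_def
proof (intro conjI allI impI X)
  fix e :: real assume "0 < e"
  from b[OF this] obtain f where f: "f \<longlonglongrightarrow> 0" "eventually (\<lambda>n. prob {x \<in> space M. e < \<bar>X n x\<bar>} \<le> f n) sequentially" by blast
  show "(\<lambda>n. prob {x \<in> space M. e < \<bar>X n x\<bar>}) \<longlonglongrightarrow> 0"
    by (rule tendsto_sandwich[OF _ f(2) tendsto_const f(1)]) simp
qed

text \<open>The two exponentials differ by at most \<open>|t| e\<close> where \<open>W\<close> and
  \<open>Y\<close> are within \<open>e\<close>, and by at most 2 elsewhere.\<close>

lemma char_close:
  assumes W[measurable]: "W \<in> borel_measurable M" and Y[measurable]: "Y \<in> borel_measurable M" and e: "0 < e"
  shows "cmod (char (distr M borel W) t - char (distr M borel Y) t) \<le> \<bar>t\<bar> * e + 2 * prob {x \<in> space M. e < \<bar>W x - Y x\<bar>}"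
proof -
  let ?B = "{x \<in> space M. e < \<bar>W x - Y x\<bar>}"
  have Bm[measurable]: "?B \<in> sets M" by measurable
  have ii: "integrable M (\<lambda>x. iexp (f x))" if "f \<in> borel_measurable M" for f using that by (intro integrable_const_bound[where B=1]) auto
  have iB: "integrable M (indicator ?B :: 'a \<Rightarrow> real)" by (intro integrable_const_bound[where B=1]) (auto split: split_indicator)
  have ch: "char (distr M borel f) t = (CLINT x|M. iexp (t * f x))" if [measurable]: "f \<in> borel_measurable M" for f
    by (simp add: char_def integral_distr)
  have "char (distr M borel W) t - char (distr M borel Y) t = (CLINT x|M. iexp (t * W x) - iexp (t * Y x))"
    unfolding ch[OF W] ch[OF Y] by (rule Bochner_Integration.integral_diff[symmetric]) (intro ii; measurable)+
  also have "cmod \<dots> \<le> (LINT x|M. cmod (iexp (t * W x) - iexp (t * Y x)))" by (rule integral_norm_bound)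
  also have "\<dots> \<le> (LINT x|M. \<bar>t\<bar> * e + 2 * indicator ?B x)"
  proof (rule integral_mono)
    show "integrable M (\<lambda>x. cmod (iexp (t * W x) - iexp (t * Y x)))"
      by (intro integrable_norm Bochner_Integration.integrable_diff ii) measurable
    show "integrable M (\<lambda>x. \<bar>t\<bar> * e + 2 * indicator ?B x)" using iB by (intro Bochner_Integration.integrable_add integrable_mult_right) auto
    fix x assume x: "x \<in> space M"
    show "cmod (iexp (t * W x) - iexp (t * Y x)) \<le> \<bar>t\<bar> * e + 2 * indicator ?B x"
    proof (cases "x \<in> ?B")
      case True
      have "cmod (iexp (t * W x) - iexp (t * Y x)) \<le> cmod (iexp (t * W x)) + cmod (iexp (t * Y x))" by (rule norm_triangle_ineq4)
      also have "\<dots> = 2" by (simp only: norm_exp_i_times)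
      finally show ?thesis using True e by (simp add: add_increasing)
    next
      case False
      have eqn: "iexp (t * W x) - iexp (t * Y x) = iexp (t * Y x) * (iexp (t * W x - t * Y x) - 1)"
        by (simp add: right_diff_distrib exp_add[symmetric])
      have "cmod (iexp (t * W x) - iexp (t * Y x)) = cmod (iexp (t * W x - t * Y x) - 1)"
        unfolding eqn norm_mult norm_exp_i_times by simp
      also have "\<dots> \<le> \<bar>t * W x - t * Y x\<bar>" using iexp_approx1[of "t * W x - t * Y x" 0] by simp
      also have "\<dots> = \<bar>t\<bar> * \<bar>W x - Y x\<bar>" by (simp add: abs_mult[symmetric] right_diff_distrib)
      also have "\<dots> \<le> \<bar>t\<bar> * e" using False x by (intro mult_left_mono) auto
      finally show ?thesis using False by simp
    qed
  qed
  also have "\<dots> = \<bar>t\<bar> * e + 2 * prob ?B" using iB by (simp add: prob_space)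
  finally show ?thesis .
qed

text \<open>Slutsky's lemma at the level of characteristic functions.\<close>

lemma char_tendsto_of_to_zero:
  assumes W: "\<And>n. W n \<in> borel_measurable M" and Y: "\<And>n. Y n \<in> borel_measurable M"
    and z: "to_zero (\<lambda>n x. W n x - Y n x)" and l: "(\<lambda>n. char (distr M borel (Y n)) t) \<longlonglongrightarrow> L"
  shows "(\<lambda>n. char (distr M borel (W n)) t) \<longlonglongrightarrow> L"
proof -
  have "(\<lambda>n. char (distr M borel (W n)) t - char (distr M borel (Y n)) t) \<longlonglongrightarrow> 0"
  proof (rule LIMSEQ_I)
    fix r :: real assume r: "0 < r"
    define e where "e = r / (2 * (\<bar>t\<bar> + 1))"
    have e: "0 < e" using r by (auto simp: e_def intro: divide_pos_pos)
    have te: "\<bar>t\<bar> * e \<le> r / 2"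
    proof -
      have "\<bar>t\<bar> * e \<le> (\<bar>t\<bar> + 1) * e" using e by (intro mult_right_mono) auto
      also have "\<dots> = r / 2"
      proof -
        have u: "u * (r / (2 * u)) = r / 2" if "0 < u" for u :: real using that by simp
        show ?thesis unfolding e_def by (rule u) simp
      qed
      finally show ?thesis .
    qed
    have "(\<lambda>n. prob {x \<in> space M. e < \<bar>W n x - Y n x\<bar>}) \<longlonglongrightarrow> 0" using z e by (simp add: to_zero_def)
    then have "eventually (\<lambda>n. prob {x \<in> space M. e < \<bar>W n x - Y n x\<bar>} < r / 4) sequentially"
      using r by (intro order_tendstoD(2)) auto
    then have "eventually (\<lambda>n. norm (char (distr M borel (W n)) t - char (distr M borel (Y n)) t - 0) < r) sequentially"
    proof eventually_elim
      case (elim n)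
      show ?case using char_close[OF W[of n] Y[of n] e, of t] elim te by simp
    qed
    then show "\<exists>no. \<forall>n\<ge>no. norm (char (distr M borel (W n)) t - char (distr M borel (Y n)) t - 0) < r"
      by (simp add: eventually_sequentially)
  qed
  from tendsto_add[OF this l] show ?thesis by simp
qed

text \<open>In the application \<open>W\<close> is the scaled estimation error, \<open>X\<close> the
  scaled score at the true parameter, \<open>D\<close> the normalised slope and \<open>R\<close> a
  relative remainder. From \<open>X = W D + O(|W| |R|)\<close> with \<open>D\<close> near
  \<open>v\<close>, \<open>W\<close> is bounded by a multiple of \<open>X\<close>, which the
  Chebyshev hypothesis bounds in probability; then \<open>X - v W\<close> is \<open>|W|\<close>
  times a small quantity. The estimate \<open>good\<close> is asked for only when
  \<open>|R| \<le> 1\<close> because the score expansion is local.\<close>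

lemma root_linearisation:
  assumes m: "\<And>n. W n \<in> borel_measurable M" "\<And>n. X n \<in> borel_measurable M"
    and D: "to_zero (\<lambda>n x. D n x - v)" and R: "to_zero R" and v: "v \<noteq> 0"
    and E: "(\<lambda>n. prob (E n)) \<longlonglongrightarrow> 1" and good: "\<And>n x. x \<in> E n \<Longrightarrow> x \<in> space M \<Longrightarrow> \<bar>R n x\<bar> \<le> 1 \<Longrightarrow> \<bar>X n x - W n x * D n x\<bar> \<le> \<bar>W n x\<bar> * \<bar>R n x\<bar>"
    and X: "\<And>n L. 0 < n \<Longrightarrow> 0 < L \<Longrightarrow> prob {x \<in> space M. L \<le> \<bar>X n x\<bar>} \<le> C / L\<^sup>2"
  shows "to_zero (\<lambda>n x. W n x - X n x / v)"
  unfolding to_zero_def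
proof (intro conjI allI impI)
  note [measurable] = m
  have Dm[measurable]: "(\<lambda>x. D n x - v) \<in> borel_measurable M" and Rm[measurable]: "R n \<in> borel_measurable M" for n using D R by (auto simp: to_zero_def)
  show "(\<lambda>x. W n x - X n x / v) \<in> borel_measurable M" for n by measurable
  fix e :: real assume e: "0 < e"
  show "(\<lambda>n. prob {x \<in> space M. e < \<bar>W n x - X n x / v\<bar>}) \<longlonglongrightarrow> 0"
  proof (rule LIMSEQ_I)
    fix r :: real assume r: "0 < r"
    \<comment> \<open>Makes \<open>C / L^2\<close> at most \<open>r / 4\<close>; the absolute value
      and the summand one cover \<open>C \<le> 0\<close>.\<close>
    define L where "L = sqrt (4 * (\<bar>C\<bar> + 1) / r)"
    have L: "0 < L" using r by (simp add: L_def)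
    have L2: "L\<^sup>2 = 4 * (\<bar>C\<bar> + 1) / r" using r by (simp add: L_def)
    have CL: "C / L\<^sup>2 < r / 3"
    proof -
      have "C / L\<^sup>2 = C * r / (4 * (\<bar>C\<bar> + 1))" unfolding L2 using r by simp
      also have "\<dots> \<le> (\<bar>C\<bar> + 1) * r / (4 * (\<bar>C\<bar> + 1))" using r by (intro divide_right_mono mult_right_mono) auto
      also have "\<dots> = r / 4"
      proof -
        have u: "u * r / (4 * u) = r / 4" if "0 < u" for u :: real using that by simp
        show ?thesis by (rule u) simp
      qed
      also have "\<dots> < r / 3" using r by simp
      finally show ?thesis .
    qed
    \<comment> \<open>The three bounds serve to absorb the error into half of
      \<open>|v| |W|\<close>, to activate \<open>good\<close>, and to make the final error at most
      \<open>e\<close>.\<close>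
    define h where "h = min (min (\<bar>v\<bar> / 4) 1) (e * v\<^sup>2 / (4 * L))"
    have h: "0 < h" using v e L by (simp add: h_def)
    have hv: "2 * h \<le> \<bar>v\<bar> / 2" "h \<le> 1" "2 * L * (2 * h) / v\<^sup>2 \<le> e"
    proof -
      show "2 * h \<le> \<bar>v\<bar> / 2" "h \<le> 1" by (auto simp: h_def)
      have "h \<le> e * v\<^sup>2 / (4 * L)" by (simp add: h_def)
      then have "h * (4 * L) \<le> e * v\<^sup>2" using L by (simp add: pos_le_divide_eq)
      then have "2 * L * (2 * h) \<le> e * v\<^sup>2" by (simp add: mult_ac)
      then show "2 * L * (2 * h) / v\<^sup>2 \<le> e" using v by (simp add: pos_divide_le_eq)
    qed
    have "(\<lambda>n. prob {x \<in> space M. h < \<bar>D n x - v\<bar>}) \<longlonglongrightarrow> 0" "(\<lambda>n. prob {x \<in> space M. h < \<bar>R n x\<bar>}) \<longlonglongrightarrow> 0"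
      using D R h by (auto simp: to_zero_def)
    then have "eventually (\<lambda>n. prob {x \<in> space M. h < \<bar>D n x - v\<bar>} < r / 12) sequentially"
      "eventually (\<lambda>n. prob {x \<in> space M. h < \<bar>R n x\<bar>} < r / 12) sequentially"
      using r by (auto intro!: order_tendstoD(2))
    moreover have "eventually (\<lambda>n. max 0 (1 - r / 12) < prob (E n) \<or> 1 - r/12 < prob (E n) \<and> 0 < prob (E n)) sequentially"
      using order_tendstoD(1)[OF E, of "max 0 (1 - r / 12)"] r by (auto elim: eventually_mono)
    ultimately have "eventually (\<lambda>n. norm (prob {x \<in> space M. e < \<bar>W n x - X n x / v\<bar>} - 0) < r) sequentially"
      using eventually_gt_at_top[of 0]
    proof eventually_elim
      case (elim n)
      then have En: "0 < prob (E n)" "1 - r / 12 < prob (E n)" by auto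
      \<comment> \<open>Measurability of \<open>E n\<close> is read off from its positive
        probability: a set outside the sigma-algebra has measure zero.\<close>
      then have Em[measurable]: "E n \<in> sets M" using measure_notin_sets by fastforce
      have "{x \<in> space M. e < \<bar>W n x - X n x / v\<bar>} \<subseteq> (space M - E n) \<union> ({x \<in> space M. h < \<bar>D n x - v\<bar>} \<union> ({x \<in> space M. h < \<bar>R n x\<bar>} \<union> {x \<in> space M. L \<le> \<bar>X n x\<bar>}))"
      proof (rule subsetI, rule ccontr)
        fix x assume x: "x \<in> {x \<in> space M. e < \<bar>W n x - X n x / v\<bar>}"
          and nx: "x \<notin> (space M - E n) \<union> ({x \<in> space M. h < \<bar>D n x - v\<bar>} \<union> ({x \<in> space M. h < \<bar>R n x\<bar>} \<union> {x \<in> space M. L \<le> \<bar>X n x\<bar>}))"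
        then have g: "x \<in> E n" "x \<in> space M" "\<bar>D n x - v\<bar> \<le> h" "\<bar>R n x\<bar> \<le> h" "\<bar>X n x\<bar> < L" by auto
        have "\<bar>X n x - W n x * D n x\<bar> \<le> \<bar>W n x\<bar> * h"
          using good[OF g(1,2)] g(4) hv(2) mult_left_mono[OF g(4), of "\<bar>W n x\<bar>"] by linarith
        moreover have "\<bar>W n x * (D n x - v)\<bar> \<le> \<bar>W n x\<bar> * h" unfolding abs_mult using g(3) by (intro mult_left_mono) auto
        moreover have "X n x - W n x * v = (X n x - W n x * D n x) + W n x * (D n x - v)" by (simp add: algebra_simps)
        ultimately have 1: "\<bar>X n x - W n x * v\<bar> \<le> \<bar>W n x\<bar> * (2 * h)" by (simp only: mult_2 distrib_left)
        have "\<bar>W n x\<bar> * \<bar>v\<bar> \<le> \<bar>X n x\<bar> + \<bar>X n x - W n x * v\<bar>" unfolding abs_mult[symmetric] by linarith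
        also have "\<dots> \<le> L + \<bar>W n x\<bar> * (\<bar>v\<bar> / 2)" using 1 g(5) mult_left_mono[OF hv(1), of "\<bar>W n x\<bar>"] by linarith
        finally have "\<bar>W n x\<bar> * \<bar>v\<bar> \<le> 2 * L" by simp
        then have W: "\<bar>W n x\<bar> \<le> 2 * L / \<bar>v\<bar>" using v by (simp add: pos_le_divide_eq)
        have "W n x - X n x / v = - (X n x - W n x * v) / v" using v by (simp add: diff_divide_distrib)
        then have "\<bar>W n x - X n x / v\<bar> = \<bar>X n x - W n x * v\<bar> / \<bar>v\<bar>" by (simp only: abs_divide abs_minus_cancel)
        also have "\<dots> \<le> \<bar>W n x\<bar> * (2 * h) / \<bar>v\<bar>" using 1 by (intro divide_right_mono) auto
        also have "\<dots> \<le> 2 * L / \<bar>v\<bar> * (2 * h) / \<bar>v\<bar>" using W h by (intro divide_right_mono mult_right_mono) auto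
        also have "\<dots> = 2 * L * (2 * h) / v\<^sup>2" by (simp add: power2_eq_square)
        also have "\<dots> \<le> e" by (rule hv)
        finally show False using x by simp
      qed
      then have "prob {x \<in> space M. e < \<bar>W n x - X n x / v\<bar>} \<le> prob ((space M - E n) \<union> ({x \<in> space M. h < \<bar>D n x - v\<bar>} \<union> ({x \<in> space M. h < \<bar>R n x\<bar>} \<union> {x \<in> space M. L \<le> \<bar>X n x\<bar>})))"
        by (rule finite_measure_mono) measurable
      also have "\<dots> \<le> prob (space M - E n) + (prob {x \<in> space M. h < \<bar>D n x - v\<bar>} + (prob {x \<in> space M. h < \<bar>R n x\<bar>} + prob {x \<in> space M. L \<le> \<bar>X n x\<bar>}))"
      proof -
        have 1: "prob (space M - E n \<union> S) \<le> prob (space M - E n) + prob S" if "S \<in> sets M" for S using that by (intro measure_Un_le) auto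
        have 2: "prob ({x \<in> space M. h < \<bar>D n x - v\<bar>} \<union> S) \<le> prob {x \<in> space M. h < \<bar>D n x - v\<bar>} + prob S" if "S \<in> sets M" for S
          using that by (intro measure_Un_le) auto
        have 3: "prob ({x \<in> space M. h < \<bar>R n x\<bar>} \<union> S) \<le> prob {x \<in> space M. h < \<bar>R n x\<bar>} + prob S" if "S \<in> sets M" for S
          using that by (intro measure_Un_le) auto
        show ?thesis
          by (rule order_trans[OF 1], measurable, intro add_left_mono, rule order_trans[OF 2], measurable, intro add_left_mono, rule 3, measurable)
      qed
      also have "prob (space M - E n) < r / 12" using En by (simp add: prob_compl)
      finally show ?case using elim X[of n L] L CL r by simp
    qed
    then show "\<exists>no. \<forall>n\<ge>no. norm (prob {x \<in> space M. e < \<bar>W n x - X n x / v\<bar>} - 0) < r"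
      by (simp add: eventually_sequentially)
  qed
qed

lemma char_normal:
  assumes X: "distributed M lborel X (normal_density 0 s)" and s: "0 < s"
  shows "char (distr M borel X) t = complex_of_real (exp (- (s * t)\<^sup>2 / 2))"
proof -
  have [measurable]: "X \<in> borel_measurable M" using distributed_measurable[OF X] by simp
  have "distributed M lborel (\<lambda>x. (X x - 0) / s) std_normal_density"
    using X normal_standard_normal_convert[OF s, of X 0] by simp
  then have d: "distr M borel (\<lambda>x. X x / s) = std_normal_distribution"
    using distributed_distr_eq_density by (metis (no_types, lifting) diff_zero distr_cong sets_lborel)
  have eq: "(s * t) * (X x / s) = t * X x" for x using s by simp
  have "char (distr M borel X) t = (CLINT x|M. iexp (t * X x))" by (simp add: char_def integral_distr)
  also have "\<dots> = (CLINT x|M. iexp ((s * t) * (X x / s)))" by (simp only: eq)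
  also have "\<dots> = char (distr M borel (\<lambda>x. X x / s)) (s * t)" unfolding char_def by (rule integral_distr[symmetric]) measurable
  finally show ?thesis unfolding d char_std_normal_distribution .
qed

end

lemma char_normal_density:
  assumes s: "0 < s"
  shows "real_distribution (density lborel (normal_density 0 s))" "char (density lborel (normal_density 0 s)) t = complex_of_real (exp (- (s * t)\<^sup>2 / 2))"
proof -
  let ?N = "density lborel (normal_density 0 s)"
  interpret N: prob_space ?N using s by (rule prob_space_normal_density)
  show "real_distribution ?N" by unfold_locales simp
  have d: "distr ?N borel (\<lambda>x. x) = ?N" by (intro distr_id2) auto
  have "distributed ?N lborel (\<lambda>x. x) (normal_density 0 s)"
    unfolding distributed_def by (auto intro!: distr_id2)
  from N.char_normal[OF this s, of t] show "char ?N t = complex_of_real (exp (- (s * t)\<^sup>2 / 2))" unfolding d .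
qed

lemma summable_on_int_inverse_sq:
  assumes c: "0 < (c::real)"
  shows "(\<lambda>k::int. 1 / (c\<^sup>2 + (real_of_int k)\<^sup>2)) summable_on UNIV"
proof -
  let ?f = "\<lambda>k::int. 1 / (c\<^sup>2 + (real_of_int k)\<^sup>2)"
  have s: "(\<lambda>n::nat. 1 / (c\<^sup>2 + (real n)\<^sup>2)) summable_on UNIV"
  proof (subst summable_on_UNIV_nonneg_real_iff)
    show "summable (\<lambda>n::nat. 1 / (c\<^sup>2 + (real n)\<^sup>2))"
    proof (rule summable_comparison_test_ev)
      show "summable (\<lambda>n. inverse (real n ^ 2))" by (rule inverse_power_summable) simp
      show "\<forall>\<^sub>F n in sequentially. norm (1 / (c\<^sup>2 + (real n)\<^sup>2)) \<le> inverse (real n ^ 2)"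
        using eventually_gt_at_top[of 0]
        by eventually_elim (auto simp: inverse_eq_divide intro!: divide_left_mono mult_pos_pos add_nonneg_pos)
    qed
  qed auto
  have "?f summable_on range int"
    by (subst summable_on_reindex) (use s in \<open>auto simp: o_def\<close>)
  moreover have "?f summable_on range (\<lambda>n. - int (Suc n))"
  proof (subst summable_on_reindex)
    have "(\<lambda>n::nat. 1 / (c\<^sup>2 + (real n)\<^sup>2)) summable_on range Suc" by (rule summable_on_subset_banach[OF s]) simp
    then show "(?f \<circ> (\<lambda>n. - int (Suc n))) summable_on UNIV"
      by (subst (asm) summable_on_reindex) (auto simp: o_def algebra_simps power2_eq_square)
  qed (auto simp: inj_def)
  moreover have "range int \<inter> range (\<lambda>n. - int (Suc n)) = {}" by auto
  ultimately have "?f summable_on (range int \<union> range (\<lambda>n. - int (Suc n)))" by (rule summable_on_Un_disjoint)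
  moreover have "range int \<union> range (\<lambda>n. - int (Suc n)) = UNIV"
  proof -
    have "k \<in> range int \<union> range (\<lambda>n. - int (Suc n))" for k :: int
      by (cases k) auto
    then show ?thesis by auto
  qed
  ultimately show ?thesis by simp
qed

section \<open>The aliased Matern spectral density\<close>

locale matern =
  fixes \<nu> \<delta> lo hi :: real
  assumes nu: "1/2 \<le> \<nu>" and delta: "0 < \<delta>" and lo: "0 < lo" and lohi: "lo < hi"
begin

definition G :: "real \<Rightarrow> real \<Rightarrow> real" where "G \<theta> x = gstar \<nu> (\<delta> * \<theta>) x"
text \<open>The \<open>\<theta>\<close>-derivative of \<open>ln (G \<theta> x)\<close>;
  \<open>ddlogG\<close> is the next derivative. Both are bounded in \<open>x\<close>, so the
  derivatives of \<open>G\<close> are bounded multiples of \<open>G\<close> and one majorant serves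
  all series.\<close>

definition dlogG :: "real \<Rightarrow> real \<Rightarrow> real" where
  "dlogG \<theta> x = 2 * \<nu> / \<theta> - (2 * \<nu> + 1) * (\<delta>\<^sup>2 * \<theta> / (\<delta>\<^sup>2 * \<theta>\<^sup>2 + x\<^sup>2))"
definition ddlogG :: "real \<Rightarrow> real \<Rightarrow> real" where
  "ddlogG \<theta> x = - 2 * \<nu> / \<theta>\<^sup>2 - (2 * \<nu> + 1) * (\<delta>\<^sup>2 * (x\<^sup>2 - \<delta>\<^sup>2 * \<theta>\<^sup>2) / (\<delta>\<^sup>2 * \<theta>\<^sup>2 + x\<^sup>2)\<^sup>2)"

lemma Cnu_pos: "0 < Cnu \<nu>"
  using nu unfolding Cnu_def by (intro divide_pos_pos mult_pos_pos Gamma_real_pos) auto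

lemma den_pos: "0 < \<theta> \<Longrightarrow> 0 < \<delta>\<^sup>2 * \<theta>\<^sup>2 + x\<^sup>2"
  using delta by (intro add_pos_nonneg mult_pos_pos) auto

lemma G_eq: "0 < \<theta> \<Longrightarrow> G \<theta> x = Cnu \<nu> * (\<delta> * \<theta>) powr (2 * \<nu>) * (\<delta>\<^sup>2 * \<theta>\<^sup>2 + x\<^sup>2) powr (- (\<nu> + 1/2))"
  by (simp add: G_def gstar_def power_mult_distrib)

lemma G_pos: "0 < \<theta> \<Longrightarrow> 0 < G \<theta> x"
  using Cnu_pos delta den_pos[of \<theta> x] by (simp add: G_eq)

lemma G_cont: "0 < \<theta> \<Longrightarrow> continuous_on S (G \<theta>)"
proof -
  assume t: "0 < \<theta>"
  have "(\<delta> * \<theta>)\<^sup>2 + x\<^sup>2 \<noteq> 0" for x using den_pos[OF t, of x] by (simp add: power_mult_distrib)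
  then show ?thesis unfolding G_def gstar_def by (intro continuous_intros) auto
qed

lemma G_minus: "G \<theta> (- x) = G \<theta> x"
  by (simp add: G_def gstar_def)

lemma dlogG_cont: "0 < \<theta> \<Longrightarrow> continuous_on S (dlogG \<theta>)"
proof -
  assume t: "0 < \<theta>"
  have "\<delta>\<^sup>2 * \<theta>\<^sup>2 + x\<^sup>2 \<noteq> 0" for x using den_pos[OF t, of x] by simp
  then show ?thesis unfolding dlogG_def by (intro continuous_intros) auto
qed

lemma dlogG_minus: "dlogG \<theta> (- x) = dlogG \<theta> x"
  by (simp add: dlogG_def)

lemma G_deriv:
  assumes t: "0 < \<theta>"
  shows "((\<lambda>\<theta>. G \<theta> x) has_real_derivative G \<theta> x * dlogG \<theta> x) (at \<theta>)"
proof -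
  let ?f = "\<lambda>\<theta>. Cnu \<nu> * (exp (2 * \<nu> * ln (\<delta> * \<theta>)) * exp (- (\<nu> + 1/2) * ln (\<delta>\<^sup>2 * \<theta>\<^sup>2 + x\<^sup>2)))"
  have eq: "G \<theta> x = ?f \<theta>" if "0 < \<theta>" for \<theta>
    using that delta den_pos[OF that, of x] by (simp add: G_eq powr_def)
  have p: "0 < \<delta> * \<theta>" using delta t by simp
  have "(?f has_real_derivative Cnu \<nu> * ((exp (2 * \<nu> * ln (\<delta> * \<theta>)) * (2 * \<nu> * (\<delta> / (\<delta> * \<theta>)))) * exp (- (\<nu> + 1/2) * ln (\<delta>\<^sup>2 * \<theta>\<^sup>2 + x\<^sup>2)) +
      exp (2 * \<nu> * ln (\<delta> * \<theta>)) * (exp (- (\<nu> + 1/2) * ln (\<delta>\<^sup>2 * \<theta>\<^sup>2 + x\<^sup>2)) * (- (\<nu> + 1/2) * (\<delta>\<^sup>2 * (2 * \<theta>) / (\<delta>\<^sup>2 * \<theta>\<^sup>2 + x\<^sup>2)))))) (at \<theta>)"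
    using p den_pos[OF t, of x] by (auto intro!: derivative_eq_intros)
  also have "Cnu \<nu> * ((exp (2 * \<nu> * ln (\<delta> * \<theta>)) * (2 * \<nu> * (\<delta> / (\<delta> * \<theta>)))) * exp (- (\<nu> + 1/2) * ln (\<delta>\<^sup>2 * \<theta>\<^sup>2 + x\<^sup>2)) +
      exp (2 * \<nu> * ln (\<delta> * \<theta>)) * (exp (- (\<nu> + 1/2) * ln (\<delta>\<^sup>2 * \<theta>\<^sup>2 + x\<^sup>2)) * (- (\<nu> + 1/2) * (\<delta>\<^sup>2 * (2 * \<theta>) / (\<delta>\<^sup>2 * \<theta>\<^sup>2 + x\<^sup>2)))))
      = ?f \<theta> * (2 * \<nu> * (\<delta> / (\<delta> * \<theta>)) + - (\<nu> + 1/2) * (\<delta>\<^sup>2 * (2 * \<theta>) / (\<delta>\<^sup>2 * \<theta>\<^sup>2 + x\<^sup>2)))"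
    by (simp only: distrib_left mult_ac)
  also have "2 * \<nu> * (\<delta> / (\<delta> * \<theta>)) + - (\<nu> + 1/2) * (\<delta>\<^sup>2 * (2 * \<theta>) / (\<delta>\<^sup>2 * \<theta>\<^sup>2 + x\<^sup>2)) = dlogG \<theta> x"
  proof -
    have "\<delta>\<^sup>2 * (2 * \<theta>) / (\<delta>\<^sup>2 * \<theta>\<^sup>2 + x\<^sup>2) = 2 * (\<delta>\<^sup>2 * \<theta> / (\<delta>\<^sup>2 * \<theta>\<^sup>2 + x\<^sup>2))" by simp
    moreover have "- (\<nu> + 1/2) * (2 * z) = - ((2 * \<nu> + 1) * z)" for z by (simp add: algebra_simps)
    ultimately show ?thesis using delta unfolding dlogG_def by (simp only: diff_conv_add_uminus) simp
  qed
  also have "?f \<theta> = G \<theta> x" using eq[OF t] by simp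
  finally show ?thesis
  proof (rule has_field_derivative_transform_within_open[of _ _ _ "{0<..}"])
    show "?f \<theta> = G \<theta> x" if "\<theta> \<in> {0<..}" for \<theta> using eq that by simp
  qed (use t in auto)
qed

lemma dlogG_deriv:
  assumes t: "0 < \<theta>"
  shows "((\<lambda>\<theta>. dlogG \<theta> x) has_real_derivative ddlogG \<theta> x) (at \<theta>)"
proof -
  have n: "\<delta>\<^sup>2 * \<theta>\<^sup>2 + x\<^sup>2 \<noteq> 0" using den_pos[OF t, of x] by simp
  have "((\<lambda>\<theta>. dlogG \<theta> x) has_real_derivative (0 * \<theta> - 2 * \<nu> * 1) / (\<theta> * \<theta>) - (2 * \<nu> + 1) *
     ((\<delta>\<^sup>2 * 1 * (\<delta>\<^sup>2 * \<theta>\<^sup>2 + x\<^sup>2) - \<delta>\<^sup>2 * \<theta> * (\<delta>\<^sup>2 * (2 * \<theta>) + 0)) / ((\<delta>\<^sup>2 * \<theta>\<^sup>2 + x\<^sup>2) * (\<delta>\<^sup>2 * \<theta>\<^sup>2 + x\<^sup>2)))) (at \<theta>)"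
    unfolding dlogG_def using t n by (auto intro!: derivative_eq_intros) (simp add: algebra_simps)
  moreover have "\<delta>\<^sup>2 * 1 * (\<delta>\<^sup>2 * \<theta>\<^sup>2 + x\<^sup>2) - \<delta>\<^sup>2 * \<theta> * (\<delta>\<^sup>2 * (2 * \<theta>) + 0) = \<delta>\<^sup>2 * (x\<^sup>2 - \<delta>\<^sup>2 * \<theta>\<^sup>2)"
    by (simp add: algebra_simps power2_eq_square)
  ultimately show ?thesis by (simp add: ddlogG_def power2_eq_square)
qed

text \<open>The deviation from the constant \<open>2 \<nu> / \<theta>\<close> is a Lorentz profile
  of width \<open>\<delta> \<theta>\<close>; the limit of vanishing spacing rests on this.\<close>

lemma dlogG_dev:
  assumes t: "0 < \<theta>"
  shows "\<bar>dlogG \<theta> x - 2 * \<nu> / \<theta>\<bar> = (2 * \<nu> + 1) * (\<delta>\<^sup>2 * \<theta> / (\<delta>\<^sup>2 * \<theta>\<^sup>2 + x\<^sup>2))"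
  using nu t den_pos[OF t, of x] by (simp add: dlogG_def abs_mult)

lemma frac_le: "0 < \<theta> \<Longrightarrow> \<delta>\<^sup>2 * \<theta> / (\<delta>\<^sup>2 * \<theta>\<^sup>2 + x\<^sup>2) \<le> 1 / \<theta>"
  using den_pos[of \<theta> x] by (simp add: field_simps power2_eq_square)

lemma dlogG_le:
  assumes t: "lo \<le> \<theta>"
  shows "\<bar>dlogG \<theta> x\<bar> \<le> (4 * \<nu> + 1) / lo"
proof -
  have tp: "0 < \<theta>" using t lo by simp
  have "\<bar>dlogG \<theta> x\<bar> \<le> \<bar>2 * \<nu> / \<theta>\<bar> + \<bar>dlogG \<theta> x - 2 * \<nu> / \<theta>\<bar>" by linarith
  also have "\<dots> \<le> 2 * \<nu> / \<theta> + (2 * \<nu> + 1) * (1 / \<theta>)"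
    unfolding dlogG_dev[OF tp] using tp nu frac_le[OF tp] by (intro add_mono mult_left_mono) auto
  also have "\<dots> = (4 * \<nu> + 1) / \<theta>" by (simp add: add_divide_distrib)
  also have "\<dots> \<le> (4 * \<nu> + 1) / lo" using t lo nu by (intro divide_left_mono) auto
  finally show ?thesis .
qed

lemma ddlogG_le:
  assumes t: "lo \<le> \<theta>"
  shows "\<bar>ddlogG \<theta> x\<bar> \<le> (4 * \<nu> + 1) / lo\<^sup>2"
proof -
  have tp: "0 < \<theta>" using t lo by simp
  define D where "D = \<delta>\<^sup>2 * \<theta>\<^sup>2 + x\<^sup>2"
  have D: "0 < D" using den_pos[OF tp] by (simp add: D_def)
  have "\<bar>\<delta>\<^sup>2 * (x\<^sup>2 - \<delta>\<^sup>2 * \<theta>\<^sup>2) / D\<^sup>2\<bar> = \<delta>\<^sup>2 * \<bar>x\<^sup>2 - \<delta>\<^sup>2 * \<theta>\<^sup>2\<bar> / D\<^sup>2" by (simp add: abs_mult)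
  also have "\<dots> \<le> \<delta>\<^sup>2 * D / D\<^sup>2"
    by (intro divide_right_mono mult_left_mono) (auto simp: D_def abs_if)
  also have "\<dots> = \<delta>\<^sup>2 / D" using D by (simp add: power2_eq_square)
  also have "\<dots> \<le> \<delta>\<^sup>2 / (\<delta>\<^sup>2 * \<theta>\<^sup>2)" using delta tp by (intro divide_left_mono) (auto simp: D_def intro!: mult_pos_pos add_pos_nonneg)
  also have "\<dots> = 1 / \<theta>\<^sup>2" using delta by simp
  finally have 1: "\<bar>\<delta>\<^sup>2 * (x\<^sup>2 - \<delta>\<^sup>2 * \<theta>\<^sup>2) / D\<^sup>2\<bar> \<le> 1 / \<theta>\<^sup>2" .
  have "\<bar>ddlogG \<theta> x\<bar> \<le> \<bar>- 2 * \<nu> / \<theta>\<^sup>2\<bar> + \<bar>(2 * \<nu> + 1) * (\<delta>\<^sup>2 * (x\<^sup>2 - \<delta>\<^sup>2 * \<theta>\<^sup>2) / D\<^sup>2)\<bar>"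
    unfolding ddlogG_def D_def by (rule abs_triangle_ineq4)
  also have "\<dots> \<le> 2 * \<nu> / \<theta>\<^sup>2 + (2 * \<nu> + 1) * (1 / \<theta>\<^sup>2)"
    using 1 nu unfolding abs_mult[of "2 * \<nu> + 1"] by (intro add_mono mult_mono) auto
  also have "\<dots> = (4 * \<nu> + 1) / \<theta>\<^sup>2" by (simp add: add_divide_distrib)
  also have "\<dots> \<le> (4 * \<nu> + 1) / lo\<^sup>2" using t lo nu tp by (intro divide_left_mono power_mono) auto
  finally show ?thesis .
qed

definition KG :: real where
  "KG = Cnu \<nu> * (\<delta> * hi) powr (2 * \<nu>) * ((\<delta> * lo)\<^sup>2) powr (- (\<nu> - 1/2))"

lemma KG_pos: "0 < KG"
  using Cnu_pos delta lo lohi by (simp add: KG_def)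

text \<open>The exponent \<open>-(\<nu> + 1/2)\<close> is split into \<open>-(\<nu> - 1/2)\<close>
  and \<open>-1\<close>. The first is nonpositive by \<open>\<nu> \<ge> 1/2\<close>, so that power
  is bounded by its value at \<open>x = 0\<close>; the second gives the decay
  \<open>1 / x^2\<close>, uniformly in \<open>\<theta>\<close>.\<close>

lemma G_le:
  assumes t: "lo \<le> \<theta>" "\<theta> \<le> hi"
  shows "G \<theta> x \<le> KG / ((\<delta> * lo)\<^sup>2 + x\<^sup>2)"
proof -
  have tp: "0 < \<theta>" using t lo by simp
  define D where "D = (\<delta> * lo)\<^sup>2 + x\<^sup>2"
  have c: "0 < (\<delta> * lo)\<^sup>2" using delta lo by simp
  have D: "0 < D" "(\<delta> * lo)\<^sup>2 \<le> D" using c by (auto simp: D_def intro: add_pos_nonneg)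
  have DD: "D \<le> \<delta>\<^sup>2 * \<theta>\<^sup>2 + x\<^sup>2"
  proof -
    have "lo\<^sup>2 \<le> \<theta>\<^sup>2" using t lo by (intro power_mono) auto
    then have "\<delta>\<^sup>2 * lo\<^sup>2 \<le> \<delta>\<^sup>2 * \<theta>\<^sup>2" by (intro mult_left_mono) auto
    then show ?thesis by (simp add: D_def power_mult_distrib)
  qed
  have "(\<delta>\<^sup>2 * \<theta>\<^sup>2 + x\<^sup>2) powr (- (\<nu> + 1/2)) \<le> D powr (- (\<nu> + 1/2))"
    using DD D nu by (intro powr_mono2') auto
  also have "\<dots> = D powr (- (\<nu> - 1/2)) * D powr (-1)"
  proof -
    have e: "- (\<nu> + 1/2) = - (\<nu> - 1/2) + (-1)" by simp
    show ?thesis unfolding e by (rule powr_add)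
  qed
  also have "\<dots> \<le> ((\<delta> * lo)\<^sup>2) powr (- (\<nu> - 1/2)) * D powr (-1)"
    using D c nu by (intro mult_right_mono powr_mono2') auto
  also have "D powr (-1) = 1 / D" using D by (simp add: powr_minus_divide)
  finally have 1: "(\<delta>\<^sup>2 * \<theta>\<^sup>2 + x\<^sup>2) powr (- (\<nu> + 1/2)) \<le> ((\<delta> * lo)\<^sup>2) powr (- (\<nu> - 1/2)) * (1 / D)" .
  have 2: "(\<delta> * \<theta>) powr (2 * \<nu>) \<le> (\<delta> * hi) powr (2 * \<nu>)"
    using t tp delta nu by (intro powr_mono2) auto
  have "G \<theta> x \<le> Cnu \<nu> * (\<delta> * hi) powr (2 * \<nu>) * (((\<delta> * lo)\<^sup>2) powr (- (\<nu> - 1/2)) * (1 / D))"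
    unfolding G_eq[OF tp] using 1 2 Cnu_pos by (intro mult_mono) auto
  then show ?thesis by (simp add: KG_def D_def)
qed

section \<open>Uniform majorants and regularity of the aliasing series\<close>

definition maj :: "int \<Rightarrow> real" where
  "maj k = KG * (1 / ((\<delta> * lo)\<^sup>2 + (real_of_int k)\<^sup>2))"

lemma maj_summable: "maj summable_on UNIV"
  unfolding maj_def using delta lo by (intro summable_on_cmult_right summable_on_int_inverse_sq) simp

lemma maj_nonneg: "0 \<le> maj k"
  using KG_pos by (simp add: maj_def)

text \<open>For \<open>k \<noteq> 0\<close> the shifted point has modulus at least
  \<open>|k| pi\<close>. The first bound gives the summable majorant \<open>maj\<close>, the second
  says that no alias lies closer to 0 than \<open>x\<close>.\<close>

lemma shift_abs_ge:
  assumes x: "x \<in> {-pi..pi}"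
  shows "\<bar>real_of_int k\<bar> \<le> \<bar>x + 2 * real_of_int k * pi\<bar>" "\<bar>x\<bar> \<le> \<bar>x + 2 * real_of_int k * pi\<bar>"
proof -
  have "\<bar>real_of_int k\<bar> \<le> \<bar>x + 2 * real_of_int k * pi\<bar> \<and> \<bar>x\<bar> \<le> \<bar>x + 2 * real_of_int k * pi\<bar>"
  proof (cases "k = 0")
    case False
    then have k: "1 \<le> \<bar>real_of_int k\<bar>" by linarith
    have "\<bar>2 * real_of_int k * pi\<bar> = 2 * \<bar>real_of_int k\<bar> * pi" by (simp add: abs_mult)
    moreover have "\<bar>real_of_int k\<bar> * 1 \<le> \<bar>real_of_int k\<bar> * pi" using pi_gt3 by (intro mult_left_mono) auto
    moreover have "1 * pi \<le> \<bar>real_of_int k\<bar> * pi" using k by (intro mult_right_mono) auto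
    moreover have "\<bar>x\<bar> \<le> pi" using x by auto
    ultimately show ?thesis by linarith
  qed simp
  then show "\<bar>real_of_int k\<bar> \<le> \<bar>x + 2 * real_of_int k * pi\<bar>" "\<bar>x\<bar> \<le> \<bar>x + 2 * real_of_int k * pi\<bar>" by auto
qed

lemma G_maj:
  assumes "lo \<le> \<theta>" "\<theta> \<le> hi" and x: "x \<in> {-pi..pi}"
  shows "G \<theta> (x + 2 * real_of_int k * pi) \<le> maj k"
proof -
  have "(real_of_int k)\<^sup>2 \<le> (x + 2 * real_of_int k * pi)\<^sup>2" using shift_abs_ge(1)[OF x] by (simp add: abs_le_square_iff)
  then have "KG / ((\<delta> * lo)\<^sup>2 + (x + 2 * real_of_int k * pi)\<^sup>2) \<le> KG / ((\<delta> * lo)\<^sup>2 + (real_of_int k)\<^sup>2)"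
    using KG_pos delta lo by (intro divide_left_mono mult_pos_pos add_pos_nonneg) auto
  then show ?thesis using G_le[OF assms(1,2), of "x + 2 * real_of_int k * pi"] by (simp add: maj_def)
qed

lemma infsum_uniform_limit:
  assumes "\<And>k x. x \<in> S \<Longrightarrow> \<bar>f k x\<bar> \<le> C * maj k"
  shows "uniform_limit S (\<lambda>X x. \<Sum>k\<in>X. f k x) (\<lambda>x. \<Sum>\<^sub>\<infinity>k. f k x) (finite_subsets_at_top UNIV)"
  using assms by (intro Weierstrass_m_test_general[where M="\<lambda>k. C * maj k"] summable_on_cmult_right maj_summable) auto

lemma infsum_cont:
  assumes "\<And>k x. x \<in> S \<Longrightarrow> \<bar>f k x\<bar> \<le> C * maj k" "\<And>k. continuous_on S (f k)"
  shows "continuous_on S (\<lambda>x. \<Sum>\<^sub>\<infinity>k. f k x)"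
  by (rule uniform_limit_theorem[OF _ infsum_uniform_limit[OF assms(1)]])
     (auto intro!: always_eventually continuous_on_sum assms(2))

lemma summable_maj:
  assumes "\<And>k. \<bar>f k\<bar> \<le> C * maj k"
  shows "f summable_on UNIV"
  using assms by (intro Infinite_Sum.abs_summable_summable[OF Infinite_Sum.abs_summable_on_comparison_test'[OF summable_on_cmult_right[OF maj_summable, of C]]]) auto

text \<open>The series differentiated term by term in \<open>\<theta>\<close>; that it is the
  derivative of \<open>gdelta\<close> is \<open>gdelta_deriv\<close>.\<close>

definition dgdelta :: "real \<Rightarrow> real \<Rightarrow> real" where
  "dgdelta \<theta> x = (\<Sum>\<^sub>\<infinity>k::int. G \<theta> (x + 2 * real_of_int k * pi) * dlogG \<theta> (x + 2 * real_of_int k * pi))"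

lemma gdelta_eq: "gdelta \<nu> \<delta> \<theta> x = (\<Sum>\<^sub>\<infinity>k::int. G \<theta> (x + 2 * real_of_int k * pi))"
  by (simp add: gdelta_def G_def)

context
  fixes \<theta> assumes t: "lo \<le> \<theta>" "\<theta> \<le> hi"
begin

lemma tpos: "0 < \<theta>" using t lo by simp

lemma G_abs_maj: "x \<in> {-pi..pi} \<Longrightarrow> \<bar>G \<theta> (x + 2 * real_of_int k * pi)\<bar> \<le> 1 * maj k"
  using G_maj[OF t, of x k] G_pos[OF tpos, of "x + 2 * real_of_int k * pi"] by simp

lemma Gq_abs_maj: "x \<in> {-pi..pi} \<Longrightarrow> \<bar>G \<theta> (x + 2 * real_of_int k * pi) * dlogG \<theta> (x + 2 * real_of_int k * pi)\<bar> \<le> ((4 * \<nu> + 1) / lo) * maj k"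
proof -
  assume x: "x \<in> {-pi..pi}"
  have "0 \<le> (4 * \<nu> + 1) / lo" using nu lo by simp
  then have "\<bar>dlogG \<theta> (x + 2 * real_of_int k * pi)\<bar> * \<bar>G \<theta> (x + 2 * real_of_int k * pi)\<bar> \<le> ((4 * \<nu> + 1) / lo) * (1 * maj k)"
    by (intro mult_mono dlogG_le[OF t(1)] G_abs_maj[OF x]) auto
  then show ?thesis by (simp add: abs_mult mult.commute)
qed

lemmas G_summable = summable_maj[OF G_abs_maj]
lemmas Gq_summable = summable_maj[OF Gq_abs_maj]

lemma shift_cont: "continuous_on UNIV f \<Longrightarrow> continuous_on S (\<lambda>x. f (x + 2 * real_of_int k * pi) :: real)"
  by (rule continuous_on_compose2[where t=UNIV and g=f]) (auto intro!: continuous_intros)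

lemma gdelta_cont: "continuous_on {-pi..pi} (gdelta \<nu> \<delta> \<theta>)"
  unfolding gdelta_eq using G_abs_maj by (rule infsum_cont) (auto intro!: shift_cont G_cont tpos)

lemma dgdelta_cont: "continuous_on {-pi..pi} (dgdelta \<theta>)"
  unfolding dgdelta_def using Gq_abs_maj by (rule infsum_cont) (auto intro!: continuous_on_mult shift_cont G_cont dlogG_cont tpos)

lemma gdelta_ge: "x \<in> {-pi..pi} \<Longrightarrow> G \<theta> x \<le> gdelta \<nu> \<delta> \<theta> x"
proof -
  assume x: "x \<in> {-pi..pi}"
  have "(\<Sum>\<^sub>\<infinity>k\<in>{0}. G \<theta> (x + 2 * real_of_int k * pi)) \<le> (\<Sum>\<^sub>\<infinity>k. G \<theta> (x + 2 * real_of_int k * pi))"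
    using G_pos[OF tpos] by (intro infsum_mono_neutral G_summable x) (auto intro: less_imp_le)
  then show ?thesis by (simp add: gdelta_eq)
qed

lemma gdelta_pos: "x \<in> {-pi..pi} \<Longrightarrow> 0 < gdelta \<nu> \<delta> \<theta> x"
  using gdelta_ge[of x] G_pos[OF tpos, of x] by simp

lemma infsum_int_minus: "(\<Sum>\<^sub>\<infinity>k::int. f (- k)) = (\<Sum>\<^sub>\<infinity>k. f k :: real)"
  by (rule infsum_reindex_bij_betw) (auto intro!: bij_betwI[where g=uminus])

lemma gdelta_even: "gdelta \<nu> \<delta> \<theta> (- x) = gdelta \<nu> \<delta> \<theta> x"
proof -
  have "G \<theta> (- x + 2 * real_of_int k * pi) = G \<theta> (x + 2 * real_of_int (- k) * pi)" for k
    using G_minus[of \<theta> "x + 2 * real_of_int (- k) * pi"] by simp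
  then show ?thesis unfolding gdelta_eq using infsum_int_minus[of "\<lambda>k. G \<theta> (x + 2 * real_of_int k * pi)"] by simp
qed

lemma dgdelta_even: "dgdelta \<theta> (- x) = dgdelta \<theta> x"
proof -
  have "G \<theta> (- x + 2 * real_of_int k * pi) * dlogG \<theta> (- x + 2 * real_of_int k * pi) =
     G \<theta> (x + 2 * real_of_int (- k) * pi) * dlogG \<theta> (x + 2 * real_of_int (- k) * pi)" for k
    using G_minus[of \<theta> "x + 2 * real_of_int (- k) * pi"] dlogG_minus[of \<theta> "x + 2 * real_of_int (- k) * pi"] by simp
  then show ?thesis unfolding dgdelta_def
    using infsum_int_minus[of "\<lambda>k. G \<theta> (x + 2 * real_of_int k * pi) * dlogG \<theta> (x + 2 * real_of_int k * pi)"] by simp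
qed

text \<open>Termwise from \<open>dlogG_dev\<close>: no alias is closer to 0 than \<open>x\<close>,
  so the profile at \<open>x\<close> dominates those at all shifted points and factors out of the
  sum.\<close>

lemma dgdelta_dev:
  assumes x: "x \<in> {-pi..pi}"
  shows "\<bar>dgdelta \<theta> x - 2 * \<nu> / \<theta> * gdelta \<nu> \<delta> \<theta> x\<bar> \<le> (2 * \<nu> + 1) * (\<delta>\<^sup>2 * \<theta> / (\<delta>\<^sup>2 * \<theta>\<^sup>2 + x\<^sup>2)) * gdelta \<nu> \<delta> \<theta> x"
proof -
  let ?y = "\<lambda>k. x + 2 * real_of_int k * pi"
  let ?c = "2 * \<nu> / \<theta>" and ?m = "(2 * \<nu> + 1) * (\<delta>\<^sup>2 * \<theta> / (\<delta>\<^sup>2 * \<theta>\<^sup>2 + x\<^sup>2))"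
  have gs: "((\<lambda>k. G \<theta> (?y k)) has_sum gdelta \<nu> \<delta> \<theta> x) UNIV" unfolding gdelta_eq by (rule has_sum_infsum[OF G_summable[OF x]])
  have 1: "((\<lambda>k. G \<theta> (?y k) * dlogG \<theta> (?y k)) has_sum dgdelta \<theta> x) UNIV" unfolding dgdelta_def by (rule has_sum_infsum[OF Gq_summable[OF x]])
  have "((\<lambda>k. G \<theta> (?y k) * dlogG \<theta> (?y k) + (- ?c) * G \<theta> (?y k)) has_sum (dgdelta \<theta> x + (- ?c) * gdelta \<nu> \<delta> \<theta> x)) UNIV"
    by (intro has_sum_add 1 has_sum_cmult_right gs)
  moreover have "((\<lambda>k. ?m * G \<theta> (?y k)) has_sum (?m * gdelta \<nu> \<delta> \<theta> x)) UNIV" by (intro has_sum_cmult_right gs)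
  moreover have "norm (G \<theta> (?y k) * dlogG \<theta> (?y k) + (- ?c) * G \<theta> (?y k)) \<le> ?m * G \<theta> (?y k)" for k
  proof -
    have "G \<theta> (?y k) * dlogG \<theta> (?y k) + (- ?c) * G \<theta> (?y k) = (dlogG \<theta> (?y k) - ?c) * G \<theta> (?y k)" by (simp add: algebra_simps)
    then have "norm (G \<theta> (?y k) * dlogG \<theta> (?y k) + (- ?c) * G \<theta> (?y k)) = \<bar>dlogG \<theta> (?y k) - ?c\<bar> * G \<theta> (?y k)"
      using G_pos[OF tpos, of "?y k"] by (simp add: abs_mult)
    also have "\<dots> \<le> ?m * G \<theta> (?y k)"
    proof (rule mult_right_mono)
      have "x\<^sup>2 \<le> (?y k)\<^sup>2" using shift_abs_ge(2)[OF x] by (simp add: abs_le_square_iff)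
      then have "\<delta>\<^sup>2 * \<theta> / (\<delta>\<^sup>2 * \<theta>\<^sup>2 + (?y k)\<^sup>2) \<le> \<delta>\<^sup>2 * \<theta> / (\<delta>\<^sup>2 * \<theta>\<^sup>2 + x\<^sup>2)"
        using den_pos[OF tpos] tpos by (intro divide_left_mono) auto
      then show "\<bar>dlogG \<theta> (?y k) - ?c\<bar> \<le> ?m" unfolding dlogG_dev[OF tpos] using nu by (intro mult_left_mono) auto
    qed (use G_pos[OF tpos] in \<open>auto intro: less_imp_le\<close>)
    finally show ?thesis .
  qed
  ultimately have "norm (dgdelta \<theta> x + (- ?c) * gdelta \<nu> \<delta> \<theta> x) \<le> ?m * gdelta \<nu> \<delta> \<theta> x" by (rule norm_infsum_le)
  then show ?thesis by simp
qed

end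

section \<open>Second order expansion of the aliased density in \<theta>\<close>

definition K2 :: real where "K2 = (((4 * \<nu> + 1) / lo)\<^sup>2 + (4 * \<nu> + 1) / lo\<^sup>2) / 2"

text \<open>Lagrange remainder, the second derivative being \<open>G\<close> times
  \<open>dlogG^2 + ddlogG\<close>. That factor is bounded by \<open>2 * K2\<close>, and
  \<open>maj\<close> majorises \<open>G\<close> at the intermediate point.\<close>

lemma G_taylor:
  assumes "lo \<le> \<theta>" "\<theta> \<le> hi" "lo \<le> \<theta>0" "\<theta>0 \<le> hi" and x: "x \<in> {-pi..pi}"
  defines "y \<equiv> \<lambda>k. x + 2 * real_of_int k * pi"
  shows "\<bar>G \<theta> (y k) - G \<theta>0 (y k) - (\<theta> - \<theta>0) * (G \<theta>0 (y k) * dlogG \<theta>0 (y k))\<bar> \<le> (\<theta> - \<theta>0)\<^sup>2 * K2 * maj k"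
proof (cases "\<theta> = \<theta>0")
  case True
  then show ?thesis by simp
next
  case False
  define D where "D m \<theta> = (if m = 0 then G \<theta> (y k) else if m = 1 then G \<theta> (y k) * dlogG \<theta> (y k) else
     (G \<theta> (y k) * dlogG \<theta> (y k)) * dlogG \<theta> (y k) + G \<theta> (y k) * ddlogG \<theta> (y k))" for m :: nat and \<theta>
  have "\<exists>t. (if \<theta> < \<theta>0 then \<theta> < t \<and> t < \<theta>0 else \<theta>0 < t \<and> t < \<theta>) \<and>
     D 0 \<theta> = (\<Sum>m<2. D m \<theta>0 / fact m * (\<theta> - \<theta>0) ^ m) + D 2 t / fact 2 * (\<theta> - \<theta>0)^2"
  proof (rule Taylor[where a=lo and b=hi])
    show "\<forall>m t. m < 2 \<and> lo \<le> t \<and> t \<le> hi \<longrightarrow> (D m has_real_derivative D (Suc m) t) (at t)"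
    proof (intro allI impI; elim conjE)
      fix m :: nat and t assume m: "m < 2" and "lo \<le> t" "t \<le> hi"
      then have tp: "0 < t" using lo by simp
      have "m = 0 \<or> m = 1" using m by auto
      then show "(D m has_real_derivative D (Suc m) t) (at t)"
        using G_deriv[OF tp, of "y k"] DERIV_mult[OF G_deriv[OF tp, of "y k"] dlogG_deriv[OF tp, of "y k"]]
        by (auto simp: D_def[abs_def] algebra_simps)
    qed
  qed (use assms False in auto)
  then obtain t where t1: "if \<theta> < \<theta>0 then \<theta> < t \<and> t < \<theta>0 else \<theta>0 < t \<and> t < \<theta>" and eq: "D 0 \<theta> = (\<Sum>m<2. D m \<theta>0 / fact m * (\<theta> - \<theta>0) ^ m) + D 2 t / fact 2 * (\<theta> - \<theta>0)^2"
    by blast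
  have t: "lo \<le> t" "t \<le> hi" using t1 assms(1-4) by (auto split: if_splits)
  have sum2: "(\<Sum>m<2. D m \<theta>0 / fact m * (\<theta> - \<theta>0) ^ m) = D 0 \<theta>0 + D 1 \<theta>0 * (\<theta> - \<theta>0)" by (simp add: numeral_2_eq_2)
  have D01: "D 0 s = G s (y k)" "D 1 s = G s (y k) * dlogG s (y k)" for s by (simp_all add: D_def)
  have "G \<theta> (y k) - G \<theta>0 (y k) - (\<theta> - \<theta>0) * (G \<theta>0 (y k) * dlogG \<theta>0 (y k)) = D 2 t / 2 * (\<theta> - \<theta>0)^2"
  proof -
    have "G \<theta> (y k) = (G \<theta>0 (y k) + G \<theta>0 (y k) * dlogG \<theta>0 (y k) * (\<theta> - \<theta>0)) + D 2 t / 2 * (\<theta> - \<theta>0)^2"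
      using eq unfolding sum2 D01 by (simp only: fact_2)
    then show ?thesis by (subst mult.commute[of "\<theta> - \<theta>0" "G \<theta>0 (y k) * dlogG \<theta>0 (y k)"]) linarith
  qed
  also have "\<bar>\<dots>\<bar> = (\<theta> - \<theta>0)^2 * (\<bar>D 2 t\<bar> / 2)" by (simp add: abs_mult)
  also have "\<dots> \<le> (\<theta> - \<theta>0)^2 * (K2 * maj k)"
  proof (rule mult_left_mono)
    have "D 2 t = G t (y k) * ((dlogG t (y k))\<^sup>2 + ddlogG t (y k))" by (simp add: D_def power2_eq_square algebra_simps)
    then have "\<bar>D 2 t\<bar> = G t (y k) * \<bar>(dlogG t (y k))\<^sup>2 + ddlogG t (y k)\<bar>"
      using G_pos[OF tpos[OF t], of "y k"] by (simp add: abs_mult)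
    also have "\<dots> \<le> maj k * (((4 * \<nu> + 1) / lo)\<^sup>2 + (4 * \<nu> + 1) / lo\<^sup>2)"
    proof (rule mult_mono)
      show "G t (y k) \<le> maj k" unfolding y_def by (rule G_maj[OF t x])
      have "(dlogG t (y k))\<^sup>2 \<le> ((4 * \<nu> + 1) / lo)\<^sup>2" using power_mono[OF dlogG_le[OF t(1), of "y k"], of 2] by simp
      then show "\<bar>(dlogG t (y k))\<^sup>2 + ddlogG t (y k)\<bar> \<le> ((4 * \<nu> + 1) / lo)\<^sup>2 + (4 * \<nu> + 1) / lo\<^sup>2"
        using ddlogG_le[OF t(1), of "y k"] abs_triangle_ineq[of "(dlogG t (y k))\<^sup>2" "ddlogG t (y k)"] by simp
    qed (auto simp: maj_nonneg)
    finally show "\<bar>D 2 t\<bar> / 2 \<le> K2 * maj k" by (simp add: K2_def mult.commute)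
  qed simp
  finally show ?thesis by (simp add: mult.assoc)
qed

text \<open>Uniform in \<open>x\<close>, because it is used twice: for the derivative behind
  \<open>hdelta\<close>, and as a sup norm bound on a symbol, hence an operator bound on its
  Toeplitz matrix.\<close>

lemma gdelta_taylor:
  assumes t: "lo \<le> \<theta>" "\<theta> \<le> hi" and t0: "lo \<le> \<theta>0" "\<theta>0 \<le> hi" and x: "x \<in> {-pi..pi}"
  shows "\<bar>gdelta \<nu> \<delta> \<theta> x - gdelta \<nu> \<delta> \<theta>0 x - (\<theta> - \<theta>0) * dgdelta \<theta>0 x\<bar> \<le> (\<theta> - \<theta>0)\<^sup>2 * K2 * infsum maj UNIV"
proof -
  let ?y = "\<lambda>k. x + 2 * real_of_int k * pi"
  have "((\<lambda>k. G \<theta> (?y k) + ((-1) * G \<theta>0 (?y k) + (- (\<theta> - \<theta>0)) * (G \<theta>0 (?y k) * dlogG \<theta>0 (?y k)))) has_sum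
     (gdelta \<nu> \<delta> \<theta> x + ((-1) * gdelta \<nu> \<delta> \<theta>0 x + (- (\<theta> - \<theta>0)) * dgdelta \<theta>0 x))) UNIV"
    unfolding gdelta_eq dgdelta_def
    by (intro has_sum_add has_sum_cmult_right has_sum_infsum G_summable Gq_summable t t0 x)
  moreover have "((\<lambda>k. (\<theta> - \<theta>0)\<^sup>2 * K2 * maj k) has_sum ((\<theta> - \<theta>0)\<^sup>2 * K2 * infsum maj UNIV)) UNIV"
    by (intro has_sum_cmult_right has_sum_infsum maj_summable)
  ultimately have "norm (gdelta \<nu> \<delta> \<theta> x + ((-1) * gdelta \<nu> \<delta> \<theta>0 x + (- (\<theta> - \<theta>0)) * dgdelta \<theta>0 x)) \<le> (\<theta> - \<theta>0)\<^sup>2 * K2 * infsum maj UNIV"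
  proof (rule norm_infsum_le)
    fix k show "norm (G \<theta> (?y k) + ((-1) * G \<theta>0 (?y k) + (- (\<theta> - \<theta>0)) * (G \<theta>0 (?y k) * dlogG \<theta>0 (?y k)))) \<le> (\<theta> - \<theta>0)\<^sup>2 * K2 * maj k"
      using G_taylor[OF t t0 x, of k] by (simp add: algebra_simps)
  qed
  then show ?thesis by (simp add: algebra_simps)
qed

lemma gdelta_deriv:
  assumes t0: "lo < \<theta>0" "\<theta>0 < hi" and x: "x \<in> {-pi..pi}"
  shows "((\<lambda>\<theta>. gdelta \<nu> \<delta> \<theta> x) has_real_derivative dgdelta \<theta>0 x) (at \<theta>0)"
proof -
  define C where "C = K2 * infsum maj UNIV"
  have "((\<lambda>\<theta>. (gdelta \<nu> \<delta> \<theta> x - gdelta \<nu> \<delta> \<theta>0 x) / (\<theta> - \<theta>0) - dgdelta \<theta>0 x) \<longlongrightarrow> 0) (at \<theta>0)"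
  proof (rule tendsto_0_le[where K=1])
    show "((\<lambda>\<theta>. C * (\<theta> - \<theta>0)) \<longlongrightarrow> 0) (at \<theta>0)" by (auto intro!: tendsto_eq_intros)
    have "eventually (\<lambda>\<theta>. \<theta> \<in> {lo<..<hi}) (at \<theta>0)" using t0 by (intro eventually_at_in_open') auto
    then show "\<forall>\<^sub>F \<theta> in at \<theta>0. norm ((gdelta \<nu> \<delta> \<theta> x - gdelta \<nu> \<delta> \<theta>0 x) / (\<theta> - \<theta>0) - dgdelta \<theta>0 x) \<le> norm (C * (\<theta> - \<theta>0)) * 1"
      using eventually_neq_at_within[of \<theta>0 \<theta>0 UNIV]
    proof eventually_elim
      case (elim \<theta>)
      then have n: "\<theta> - \<theta>0 \<noteq> 0" by simp
      have "(gdelta \<nu> \<delta> \<theta> x - gdelta \<nu> \<delta> \<theta>0 x) / (\<theta> - \<theta>0) - dgdelta \<theta>0 x = (gdelta \<nu> \<delta> \<theta> x - gdelta \<nu> \<delta> \<theta>0 x - (\<theta> - \<theta>0) * dgdelta \<theta>0 x) / (\<theta> - \<theta>0)"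
        using n by (simp add: diff_divide_distrib)
      then have "norm ((gdelta \<nu> \<delta> \<theta> x - gdelta \<nu> \<delta> \<theta>0 x) / (\<theta> - \<theta>0) - dgdelta \<theta>0 x) = \<bar>gdelta \<nu> \<delta> \<theta> x - gdelta \<nu> \<delta> \<theta>0 x - (\<theta> - \<theta>0) * dgdelta \<theta>0 x\<bar> / \<bar>\<theta> - \<theta>0\<bar>"
        by simp
      also have "\<dots> \<le> (\<theta> - \<theta>0)\<^sup>2 * C / \<bar>\<theta> - \<theta>0\<bar>"
        using gdelta_taylor[of \<theta> \<theta>0 x] elim t0 x by (intro divide_right_mono) (auto simp: C_def mult.assoc)
      also have "\<dots> = \<bar>\<theta> - \<theta>0\<bar> * C"
      proof -
        have zz: "z\<^sup>2 * C / \<bar>z\<bar> = \<bar>z\<bar> * C" if "z \<noteq> 0" for z :: real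
        proof -
          have uu: "u * u * C / u = u * C" if "u \<noteq> 0" for u :: real using that by simp
          have "z\<^sup>2 * C / \<bar>z\<bar> = \<bar>z\<bar> * \<bar>z\<bar> * C / \<bar>z\<bar>" by (simp only: power2_eq_square[of "\<bar>z\<bar>", symmetric] power2_abs)
          also have "\<dots> = \<bar>z\<bar> * C" using that by (intro uu) simp
          finally show ?thesis .
        qed
        show ?thesis by (rule zz[OF n])
      qed
      also have "\<dots> \<le> norm (C * (\<theta> - \<theta>0)) * 1"
      proof -
        have "C * \<bar>\<theta> - \<theta>0\<bar> \<le> \<bar>C\<bar> * \<bar>\<theta> - \<theta>0\<bar>" by (intro mult_right_mono) auto
        then show ?thesis by (simp only: real_norm_def abs_mult mult_1_right mult.commute[of "\<bar>\<theta> - \<theta>0\<bar>" C])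
      qed
      finally show ?case .
    qed
  qed
  then show ?thesis unfolding has_field_derivative_iff by (rule LIM_zero_cancel)
qed

lemma hdelta_eq:
  assumes t0: "lo < \<theta>0" "\<theta>0 < hi" and x: "x \<in> {-pi..pi}"
  shows "hdelta \<nu> \<delta> \<theta>0 x = dgdelta \<theta>0 x / gdelta \<nu> \<delta> \<theta>0 x"
proof -
  have p: "0 < gdelta \<nu> \<delta> \<theta>0 x" using t0 x by (intro gdelta_pos) auto
  have "((\<lambda>t. ln (gdelta \<nu> \<delta> t x)) has_real_derivative (1 / gdelta \<nu> \<delta> \<theta>0 x) * dgdelta \<theta>0 x) (at \<theta>0)"
    by (rule DERIV_chain2[OF DERIV_ln_divide[OF p] gdelta_deriv[OF t0 x]])
  then show ?thesis unfolding hdelta_def by (simp add: DERIV_imp_deriv)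
qed

end

section \<open>Covariances as Fourier coefficients of the aliased density\<close>

context matern
begin

text \<open>Unordered sums over \<open>int\<close> may thus be evaluated along symmetric ranges,
  which match the integration windows of \<open>integral_window\<close>.\<close>

lemma symmetric_intervals_at_top: "filterlim (\<lambda>N. {- int N..int N}) (finite_subsets_at_top UNIV) sequentially"
  unfolding filterlim_finite_subsets_at_top
proof (intro allI impI)
  fix X :: "int set" assume "finite X \<and> X \<subseteq> UNIV"
  then have X: "finite X" by simp
  show "\<forall>\<^sub>F N in sequentially. finite {- int N..int N} \<and> X \<subseteq> {- int N..int N} \<and> {- int N..int N} \<subseteq> UNIV"
  proof (rule eventually_sequentiallyI)
    fix N assume N: "nat (\<Sum>x\<in>X. \<bar>x\<bar>) \<le> N"
    have "\<bar>x\<bar> \<le> int N" if "x \<in> X" for x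
    proof -
      have "\<bar>x\<bar> \<le> (\<Sum>x\<in>X. \<bar>x\<bar>)" using X that by (intro member_le_sum) auto
      then show ?thesis using N by linarith
    qed
    then show "finite {- int N..int N} \<and> X \<subseteq> {- int N..int N} \<and> {- int N..int N} \<subseteq> UNIV" by (auto simp: abs_le_iff minus_le_iff)
  qed
qed

lemma G_integrable:
  assumes t: "lo \<le> \<theta>" "\<theta> \<le> hi"
  shows "integrable lborel (G \<theta>)"
proof -
  have "einterval (-\<infinity>) \<infinity> = UNIV" by (auto simp: einterval_def)
  then have i: "integrable lborel (\<lambda>x::real. inverse (1 + x\<^sup>2))" using integrable_inverse_1_plus_square by (simp add: set_integrable_def)
  define c where "c = (\<delta> * lo)\<^sup>2"
  have c: "0 < c" using delta lo by (simp add: c_def)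
  \<comment> \<open>Large enough for \<open>1 + x^2 \<le> K (c + x^2)\<close>, which reduces the
    claim to integrability of \<open>1 / (1 + x^2)\<close>.\<close>
  define K where "K = max 1 (1 / c)"
  have K: "1 \<le> K" "1 / c \<le> K" by (auto simp: K_def)
  then have Kc: "1 \<le> K * c" using c by (simp add: divide_le_eq)
  show ?thesis
  proof (rule Bochner_Integration.integrable_bound[OF integrable_mult_right[OF i, of "KG * K"]])
    show "G \<theta> \<in> borel_measurable lborel"
      using G_cont[of \<theta> UNIV] tpos[OF t] by (simp add: borel_measurable_continuous_onI)
    have "norm (G \<theta> x) \<le> norm (KG * K * inverse (1 + x\<^sup>2))" for x
    proof -
      have "1 + x\<^sup>2 \<le> K * c + K * x\<^sup>2" using Kc mult_right_mono[OF K(1), of "x\<^sup>2"] by (intro add_mono) auto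
      then have "1 + x\<^sup>2 \<le> K * (c + x\<^sup>2)" by (simp add: distrib_left)
      moreover have "0 < c + x\<^sup>2" "0 < 1 + x\<^sup>2" using c by (auto intro: add_pos_nonneg)
      ultimately have "1 / (c + x\<^sup>2) \<le> K * (1 / (1 + x\<^sup>2))" by (simp add: field_simps)
      then have "KG * (1 / (c + x\<^sup>2)) \<le> KG * (K * (1 / (1 + x\<^sup>2)))" using KG_pos by (intro mult_left_mono) auto
      then have "G \<theta> x \<le> KG * K * inverse (1 + x\<^sup>2)" using G_le[OF t, of x] by (simp add: c_def inverse_eq_divide)
      then show ?thesis using G_pos[OF tpos[OF t], of x] by simp
    qed
    then show "AE x in lborel. norm (G \<theta> x) \<le> norm (KG * K * inverse (1 + x\<^sup>2))" by simp
  qed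
qed

lemma cos_shift: "cos (real_of_int m * (x + 2 * real_of_int k * pi)) = cos (real_of_int m * x)"
proof -
  have "real_of_int m * (x + 2 * real_of_int k * pi) = real_of_int m * x + 2 * pi * real_of_int (m * k)" by (simp add: algebra_simps)
  moreover have "cos (2 * pi * real_of_int (m * k)) = 1" "sin (2 * pi * real_of_int (m * k)) = 0"
    using cos_int_2pin[of "m * k"] sin_int_2pin[of "m * k"] by (simp_all add: mult_ac)
  ultimately show ?thesis by (simp only: cos_add)
qed

text \<open>The window consists of \<open>2 N + 1\<close> periods of length \<open>2 pi\<close>; the
  induction adds one at each end.\<close>

lemma integral_window:
  fixes f :: "real \<Rightarrow> real"
  assumes f: "continuous_on UNIV f"
  shows "integral {- ((2 * real N + 1) * pi)..(2 * real N + 1) * pi} f = (\<Sum>k\<in>{- int N..int N}. integral {-pi..pi} (\<lambda>x. f (x + 2 * real_of_int k * pi)))"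
proof (induction N)
  case 0
  then show ?case by simp
next
  case (Suc N)
  let ?a = "(2 * real N + 1) * pi" and ?b = "(2 * real (Suc N) + 1) * pi"
  have i: "f integrable_on {a..b}" for a b by (intro integrable_continuous_interval continuous_on_subset[OF f]) auto
  have ab: "0 \<le> ?a" "?a \<le> ?b" by (auto intro!: mult_right_mono)
  have sh: "integral {(2 * real_of_int k - 1) * pi..(2 * real_of_int k + 1) * pi} f = integral {-pi..pi} (\<lambda>x. f (x + 2 * real_of_int k * pi))" for k
    using integral_shift_real_ivl[of "(2 * real_of_int k - 1) * pi" "2 * real_of_int k * pi" "(2 * real_of_int k + 1) * pi" f]
    by (simp add: algebra_simps)
  have "integral {- ?b..?b} f = integral {- ?b..- ?a} f + (integral {- ?a..?a} f + integral {?a..?b} f)"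
  proof -
    have "integral {- ?b..- ?a} f + integral {- ?a..?b} f = integral {- ?b..?b} f"
      by (rule Henstock_Kurzweil_Integration.integral_combine[OF _ _ i]) (use ab in linarith)+
    moreover have "integral {- ?a..?a} f + integral {?a..?b} f = integral {- ?a..?b} f"
      by (rule Henstock_Kurzweil_Integration.integral_combine[OF _ _ i]) (use ab in linarith)+
    ultimately show ?thesis by simp
  qed
  also have "integral {?a..?b} f = integral {-pi..pi} (\<lambda>x. f (x + 2 * real_of_int (int (Suc N)) * pi))"
    unfolding sh[symmetric] by (simp add: algebra_simps)
  also have "integral {- ?b..- ?a} f = integral {-pi..pi} (\<lambda>x. f (x + 2 * real_of_int (- int (Suc N)) * pi))"
    unfolding sh[symmetric] by (simp add: algebra_simps)
  finally have "integral {- ?b..?b} f = integral {-pi..pi} (\<lambda>x. f (x + 2 * real_of_int (- int (Suc N)) * pi)) +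
     ((\<Sum>k\<in>{- int N..int N}. integral {-pi..pi} (\<lambda>x. f (x + 2 * real_of_int k * pi))) + integral {-pi..pi} (\<lambda>x. f (x + 2 * real_of_int (int (Suc N)) * pi)))"
    unfolding Suc.IH .
  moreover have "{- int (Suc N)..int (Suc N)} = insert (- int (Suc N)) (insert (int (Suc N)) {- int N..int N})" by auto
  ultimately show ?case by (simp only:) (subst sum.insert, simp, simp, subst sum.insert, auto)
qed

text \<open>Periodisation: at integer frequencies the cosine is unchanged by shifts of
  \<open>2 pi k\<close>, so the integral over the line folds onto one period. Dominated convergence
  over growing windows gives the left side, uniform convergence of the aliasing series the right
  side.\<close>

lemma fourier_gdelta:
  assumes t: "lo \<le> \<theta>" "\<theta> \<le> hi"
  shows "(LINT y|lborel. G \<theta> y * cos (real_of_int m * y)) = integral {-pi..pi} (\<lambda>x. gdelta \<nu> \<delta> \<theta> x * cos (real_of_int m * x))"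
proof -
  define f where "f y = G \<theta> y * cos (real_of_int m * y)" for y
  have fc: "continuous_on S f" for S unfolding f_def by (intro continuous_intros G_cont tpos[OF t])
  have fm[measurable]: "f \<in> borel_measurable borel" using fc by (rule borel_measurable_continuous_onI)
  have fi: "integrable lborel f"
  proof (rule Bochner_Integration.integrable_bound[OF G_integrable[OF t]])
    have "norm (f x) \<le> norm (G \<theta> x)" for x
      using mult_left_mono[OF abs_cos_le_one[of "real_of_int m * x"], of "\<bar>G \<theta> x\<bar>"] by (simp add: f_def abs_mult)
    then show "AE x in lborel. norm (f x) \<le> norm (G \<theta> x)" by simp
  qed simp
  define W where "W N = {- ((2 * real N + 1) * pi)..(2 * real N + 1) * pi}" for N
  have L1: "(\<lambda>N. LINT y|lborel. indicator (W N) y * f y) \<longlonglongrightarrow> (LINT y|lborel. f y)"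
  proof (rule integral_dominated_convergence[where w="\<lambda>y. norm (f y)"])
    show "AE x in lborel. (\<lambda>N. indicator (W N) x * f x) \<longlonglongrightarrow> f x"
    proof (rule AE_I2)
      fix x :: real
      have "eventually (\<lambda>N. f x = indicator (W N) x * f x) sequentially"
      proof (rule eventually_sequentiallyI)
        fix N assume N: "nat \<lceil>\<bar>x\<bar>\<rceil> \<le> N"
        have "\<bar>x\<bar> \<le> real N" using N by linarith
        also have "\<dots> \<le> (2 * real N + 1) * 1" by simp
        also have "\<dots> \<le> (2 * real N + 1) * pi" using pi_gt3 by (intro mult_left_mono) auto
        finally have "x \<in> W N" by (auto simp: W_def abs_le_iff)
        then show "f x = indicator (W N) x * f x" by simp
      qed
      then show "(\<lambda>N. indicator (W N) x * f x) \<longlonglongrightarrow> f x" by (rule Lim_transform_eventually[OF tendsto_const])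
    qed
    show "AE x in lborel. norm (indicator (W N) x * f x) \<le> norm (f x)" for N by (auto split: split_indicator)
  qed (use fi in \<open>auto simp: W_def\<close>)
  have L2: "(LINT y|lborel. indicator (W N) y * f y) = integral {-pi..pi} (\<lambda>x. (\<Sum>k\<in>{- int N..int N}. G \<theta> (x + 2 * real_of_int k * pi)) * cos (real_of_int m * x))" for N
  proof -
    have "set_integrable lborel (W N) f" unfolding set_integrable_def
      by (rule integrable_mult_indicator) (use fi in \<open>auto simp: W_def\<close>)
    then have "(LINT y|lborel. indicator (W N) y * f y) = integral (W N) f"
      using set_borel_integral_eq_integral(2)[of "W N" f] by (simp add: set_lebesgue_integral_def)
    also have "\<dots> = (\<Sum>k\<in>{- int N..int N}. integral {-pi..pi} (\<lambda>x. f (x + 2 * real_of_int k * pi)))"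
      unfolding W_def by (rule integral_window[OF fc])
    also have "\<dots> = integral {-pi..pi} (\<lambda>x. \<Sum>k\<in>{- int N..int N}. f (x + 2 * real_of_int k * pi))"
      by (rule integral_sum[symmetric]) (auto intro!: integrable_continuous_interval shift_cont[OF t fc])
    finally show ?thesis by (simp add: f_def cos_shift sum_distrib_right)
  qed
  have L3: "(\<lambda>N. integral {-pi..pi} (\<lambda>x. (\<Sum>k\<in>{- int N..int N}. G \<theta> (x + 2 * real_of_int k * pi)) * cos (real_of_int m * x))) \<longlonglongrightarrow>
     integral {-pi..pi} (\<lambda>x. gdelta \<nu> \<delta> \<theta> x * cos (real_of_int m * x))"
  proof (rule tendstoI)
    fix e :: real assume e: "0 < e"
    \<comment> \<open>The period has length \<open>2 pi\<close>, so the integrated error is at most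
      \<open>e / 2\<close>.\<close>
    define e' where "e' = e / (4 * pi)"
    have e': "0 < e'" using e by (simp add: e'_def)
    have "\<forall>\<^sub>F X in finite_subsets_at_top UNIV. \<forall>x\<in>{-pi..pi}. dist (\<Sum>k\<in>X. G \<theta> (x + 2 * real_of_int k * pi)) (gdelta \<nu> \<delta> \<theta> x) < e'"
    proof -
      have "uniform_limit {-pi..pi} (\<lambda>X x. \<Sum>k\<in>X. G \<theta> (x + 2 * real_of_int k * pi)) (\<lambda>x. \<Sum>\<^sub>\<infinity>k. G \<theta> (x + 2 * real_of_int k * pi)) (finite_subsets_at_top UNIV)"
        by (rule infsum_uniform_limit[OF G_abs_maj[OF t]])
      from uniform_limitD[OF this e'] show ?thesis by (simp only: gdelta_eq)
    qed
    then have "\<forall>\<^sub>F N in sequentially. \<forall>x\<in>{-pi..pi}. dist (\<Sum>k\<in>{- int N..int N}. G \<theta> (x + 2 * real_of_int k * pi)) (gdelta \<nu> \<delta> \<theta> x) < e'"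
      by (rule eventually_compose_filterlim[OF _ symmetric_intervals_at_top])
    then show "\<forall>\<^sub>F N in sequentially. dist (integral {-pi..pi} (\<lambda>x. (\<Sum>k\<in>{- int N..int N}. G \<theta> (x + 2 * real_of_int k * pi)) * cos (real_of_int m * x)))
      (integral {-pi..pi} (\<lambda>x. gdelta \<nu> \<delta> \<theta> x * cos (real_of_int m * x))) < e"
    proof eventually_elim
      case (elim N)
      let ?S = "\<lambda>x. \<Sum>k\<in>{- int N..int N}. G \<theta> (x + 2 * real_of_int k * pi)"
      have c1: "continuous_on {-pi..pi} (\<lambda>x. ?S x * cos (real_of_int m * x))"
        by (intro continuous_intros shift_cont[OF t G_cont] tpos[OF t])
      have c2: "continuous_on {-pi..pi} (\<lambda>x. gdelta \<nu> \<delta> \<theta> x * cos (real_of_int m * x))"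
        by (intro continuous_intros gdelta_cont[OF t])
      have "integral {-pi..pi} (\<lambda>x. ?S x * cos (real_of_int m * x)) - integral {-pi..pi} (\<lambda>x. gdelta \<nu> \<delta> \<theta> x * cos (real_of_int m * x))
        = integral {-pi..pi} (\<lambda>x. ?S x * cos (real_of_int m * x) - gdelta \<nu> \<delta> \<theta> x * cos (real_of_int m * x))"
        by (rule integral_diff[symmetric]) (intro integrable_continuous_interval c1 c2)+
      also have "norm \<dots> \<le> integral {-pi..pi} (\<lambda>x. e')"
      proof (rule integral_norm_bound_integral)
        show "(\<lambda>x. ?S x * cos (real_of_int m * x) - gdelta \<nu> \<delta> \<theta> x * cos (real_of_int m * x)) integrable_on {-pi..pi}"
          by (intro integrable_continuous_interval continuous_on_diff c1 c2)
        fix x assume x: "x \<in> {-pi..pi}"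
        have "norm (?S x * cos (real_of_int m * x) - gdelta \<nu> \<delta> \<theta> x * cos (real_of_int m * x)) = \<bar>?S x - gdelta \<nu> \<delta> \<theta> x\<bar> * \<bar>cos (real_of_int m * x)\<bar>"
          by (simp add: abs_mult[symmetric] left_diff_distrib)
        also have "\<dots> \<le> e' * 1" using elim x e' by (intro mult_mono) (auto simp: dist_real_def intro: less_imp_le abs_cos_le_one)
        finally show "norm (?S x * cos (real_of_int m * x) - gdelta \<nu> \<delta> \<theta> x * cos (real_of_int m * x)) \<le> e'" by simp
      qed (auto intro: integrable_continuous_interval)
      also have "\<dots> < e" using e by (simp add: e'_def)
      finally show ?case by (simp add: dist_norm)
    qed
  qed
  have "(LINT y|lborel. f y) = integral {-pi..pi} (\<lambda>x. gdelta \<nu> \<delta> \<theta> x * cos (real_of_int m * x))"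
    by (rule LIMSEQ_unique[OF L1[unfolded L2] L3])
  then show ?thesis by (simp add: f_def)
qed

text \<open>Substituting \<open>x / \<delta>\<close> for the frequency turns \<open>\<theta>\<close>
  into \<open>\<delta> \<theta>\<close>: the power \<open>\<delta>^(2\<nu>+1)\<close> pulled out of
  the denominator loses one factor to the Jacobian, and the rest combines to
  \<open>(\<delta> \<theta>)^(2\<nu>)\<close>.\<close>

lemma Kmat_eq:
  assumes t: "lo \<le> \<theta>" "\<theta> \<le> hi"
  shows "Kmat \<nu> \<theta> (\<delta> * real_of_int m) = integral {-pi..pi} (\<lambda>x. gdelta \<nu> \<delta> \<theta> x * cos (real_of_int m * x))"
proof -
  have tp: "0 < \<theta>" by (rule tpos[OF t])
  have scaling: "(1/\<delta>) * gstar \<nu> \<theta> (x / \<delta>) = G \<theta> x" for x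
  proof -
    have D: "0 < \<delta>\<^sup>2 * \<theta>\<^sup>2 + x\<^sup>2" by (rule den_pos[OF tp])
    have "\<theta>\<^sup>2 + (x / \<delta>)\<^sup>2 = (\<delta>\<^sup>2 * \<theta>\<^sup>2 + x\<^sup>2) / \<delta>\<^sup>2" using delta by (simp add: power_divide add_divide_distrib)
    then have "(\<theta>\<^sup>2 + (x / \<delta>)\<^sup>2) powr (- (\<nu> + 1/2)) = (\<delta>\<^sup>2 * \<theta>\<^sup>2 + x\<^sup>2) powr (- (\<nu> + 1/2)) * (\<delta>\<^sup>2) powr (\<nu> + 1/2)"
      using D delta by (simp add: powr_divide powr_minus_divide[of "\<delta>\<^sup>2" "\<nu> + 1/2"] del: minus_add_distrib)
    also have "(\<delta>\<^sup>2) powr (\<nu> + 1/2) = \<delta> powr (2 * \<nu> + 1)"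
      using delta by (simp add: powr_powr powr_realpow[symmetric, of \<delta> 2] algebra_simps flip: powr_numeral)
    also have "\<dots> = \<delta> powr (2 * \<nu>) * \<delta>" using delta by (simp add: powr_add)
    finally show ?thesis using delta tp unfolding G_eq[OF tp] gstar_def by (simp add: powr_mult)
  qed
  have "Kmat \<nu> \<theta> (\<delta> * real_of_int m) = \<bar>1/\<delta>\<bar> *\<^sub>R (LINT x|lborel. gstar \<nu> \<theta> (0 + (1/\<delta>) * x) * cos ((0 + (1/\<delta>) * x) * (\<delta> * real_of_int m)))"
    unfolding Kmat_def using delta by (intro lborel_integral_real_affine) auto
  also have "\<dots> = (LINT x|lborel. (1/\<delta>) * (gstar \<nu> \<theta> (x / \<delta>) * cos (real_of_int m * x)))"
    using delta by (subst integral_mult_right_zero) (auto simp: mult.commute)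
  also have "\<dots> = (LINT x|lborel. G \<theta> x * cos (real_of_int m * x))"
    by (simp only: mult.assoc[symmetric] scaling)
  finally show ?thesis using fourier_gdelta[OF t] by simp
qed

end

section \<open>Vanishing spacing\<close>

text \<open>The antiderivative is \<open>a arctan (x / a)\<close>, with increment below
  \<open>pi a\<close> over the whole line.\<close>

lemma integral_lorentz_le:
  assumes a: "0 < (a::real)"
  shows "integral {-pi..pi} (\<lambda>x. a\<^sup>2 / (a\<^sup>2 + x\<^sup>2)) \<le> pi * a"
proof -
  have p: "0 < a\<^sup>2 + x\<^sup>2" for x using a by (intro add_pos_nonneg) auto
  have "((\<lambda>x. a\<^sup>2 / (a\<^sup>2 + x\<^sup>2)) has_integral (a * arctan (pi / a) - a * arctan (- pi / a))) {-pi..pi}"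
  proof (rule fundamental_theorem_of_calculus)
    fix x :: real
    have "((\<lambda>x. a * arctan (x / a)) has_real_derivative a * (inverse (1 + (x / a)\<^sup>2) * (1 / a))) (at x within {-pi..pi})"
      using a by (auto intro!: derivative_eq_intros)
    moreover have "1 + (x / a)\<^sup>2 = (a\<^sup>2 + x\<^sup>2) / a\<^sup>2" using a by (simp add: power_divide add_divide_distrib)
    then have "a * (inverse (1 + (x / a)\<^sup>2) * (1 / a)) = a\<^sup>2 / (a\<^sup>2 + x\<^sup>2)" using a by simp
    ultimately show "((\<lambda>x. a * arctan (x / a)) has_vector_derivative a\<^sup>2 / (a\<^sup>2 + x\<^sup>2)) (at x within {-pi..pi})"
      by (simp add: has_real_derivative_iff_has_vector_derivative)
  qed simp
  then have "integral {-pi..pi} (\<lambda>x. a\<^sup>2 / (a\<^sup>2 + x\<^sup>2)) = 2 * a * arctan (pi / a)"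
    by (simp add: integral_unique arctan_minus)
  also have "\<dots> \<le> 2 * a * (pi / 2)" using a arctan_ubound[of "pi / a"] by (intro mult_left_mono) auto
  finally show ?thesis by (simp add: mult.commute)
qed

context matern
begin

context
  fixes b \<theta> :: real assumes b: "0 < b" and t: "lo < \<theta>" "\<theta> < hi"
begin

lemma t': "lo \<le> \<theta>" "\<theta> \<le> hi" "0 < \<theta>" using t lo by auto

lemma adelta_cont: "continuous_on {-pi..pi} (adelta \<nu> \<delta> b \<theta>)"
proof -
  have "b * gdelta \<nu> \<delta> \<theta> x + 1 / (2 * pi) \<noteq> 0" if "x \<in> {-pi..pi}" for x
    using gdelta_pos[OF t'(1,2) that] b by (intro less_imp_neq[symmetric] add_pos_pos) auto
  then show ?thesis unfolding adelta_def by (intro continuous_intros gdelta_cont t') auto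
qed

lemma hdelta_cont: "continuous_on {-pi..pi} (hdelta \<nu> \<delta> \<theta>)"
proof (subst continuous_on_cong[OF refl hdelta_eq[OF t]])
  show "continuous_on {-pi..pi} (\<lambda>x. dgdelta \<theta> x / gdelta \<nu> \<delta> \<theta> x)"
    using gdelta_pos[OF t'(1,2)] by (intro continuous_intros gdelta_cont dgdelta_cont t') (metis less_irrefl)
qed

lemma adelta_bounds: "x \<in> {-pi..pi} \<Longrightarrow> 0 < adelta \<nu> \<delta> b \<theta> x" "x \<in> {-pi..pi} \<Longrightarrow> adelta \<nu> \<delta> b \<theta> x < 1"
proof -
  assume x: "x \<in> {-pi..pi}"
  have "0 < b * gdelta \<nu> \<delta> \<theta> x" using gdelta_pos[OF t'(1,2) x] b by simp
  then show "0 < adelta \<nu> \<delta> b \<theta> x" "adelta \<nu> \<delta> b \<theta> x < 1"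
  proof -
    have "0 < y / (y + c)" "y / (y + c) < 1" if "0 < y" "0 < c" for y c :: real using that by (simp_all add: divide_less_eq)
    from this[of "b * gdelta \<nu> \<delta> \<theta> x" "1 / (2 * pi)"] \<open>0 < b * gdelta \<nu> \<delta> \<theta> x\<close>
    show "0 < adelta \<nu> \<delta> b \<theta> x" "adelta \<nu> \<delta> b \<theta> x < 1" unfolding adelta_def by auto
  qed
qed

lemma hdelta_dev:
  assumes x: "x \<in> {-pi..pi}"
  shows "\<bar>hdelta \<nu> \<delta> \<theta> x - 2 * \<nu> / \<theta>\<bar> \<le> (2 * \<nu> + 1) / \<theta> * ((\<delta> * \<theta>)\<^sup>2 / ((\<delta> * \<theta>)\<^sup>2 + x\<^sup>2))"
proof -
  have g: "0 < gdelta \<nu> \<delta> \<theta> x" by (rule gdelta_pos[OF t'(1,2) x])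
  have "\<bar>hdelta \<nu> \<delta> \<theta> x - 2 * \<nu> / \<theta>\<bar> = \<bar>dgdelta \<theta> x - 2 * \<nu> / \<theta> * gdelta \<nu> \<delta> \<theta> x\<bar> / gdelta \<nu> \<delta> \<theta> x"
  proof -
    have "hdelta \<nu> \<delta> \<theta> x - 2 * \<nu> / \<theta> = (dgdelta \<theta> x - 2 * \<nu> / \<theta> * gdelta \<nu> \<delta> \<theta> x) / gdelta \<nu> \<delta> \<theta> x"
      unfolding hdelta_eq[OF t x] using g by (simp add: diff_divide_distrib)
    then show ?thesis using g by (simp add: abs_divide)
  qed
  also have "\<dots> \<le> ((2 * \<nu> + 1) * (\<delta>\<^sup>2 * \<theta> / (\<delta>\<^sup>2 * \<theta>\<^sup>2 + x\<^sup>2)) * gdelta \<nu> \<delta> \<theta> x) / gdelta \<nu> \<delta> \<theta> x"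
    using dgdelta_dev[OF t'(1,2) x] g by (intro divide_right_mono) auto
  also have "\<dots> = (2 * \<nu> + 1) / \<theta> * ((\<delta> * \<theta>)\<^sup>2 / ((\<delta> * \<theta>)\<^sup>2 + x\<^sup>2))"
    using g t'(3) by (simp add: power_mult_distrib) (simp add: power2_eq_square)
  finally show ?thesis .
qed

lemma hdelta_dev_le: "x \<in> {-pi..pi} \<Longrightarrow> \<bar>hdelta \<nu> \<delta> \<theta> x - 2 * \<nu> / \<theta>\<bar> \<le> (2 * \<nu> + 1) / \<theta>"
proof -
  assume x: "x \<in> {-pi..pi}"
  have "(2 * \<nu> + 1) / \<theta> * ((\<delta> * \<theta>)\<^sup>2 / ((\<delta> * \<theta>)\<^sup>2 + x\<^sup>2)) \<le> (2 * \<nu> + 1) / \<theta> * 1"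
  proof (rule mult_left_mono)
    have "(\<delta> * \<theta>)\<^sup>2 / ((\<delta> * \<theta>)\<^sup>2 + x\<^sup>2) \<le> ((\<delta> * \<theta>)\<^sup>2 + x\<^sup>2) / ((\<delta> * \<theta>)\<^sup>2 + x\<^sup>2)"
      by (intro divide_right_mono) auto
    then show "(\<delta> * \<theta>)\<^sup>2 / ((\<delta> * \<theta>)\<^sup>2 + x\<^sup>2) \<le> 1" by (rule order_trans) (simp add: divide_self_if)
  qed (use nu t'(3) in auto)
  then show ?thesis using hdelta_dev[OF x] by simp
qed

text \<open>The weight is at most one, so by the Lorentz bound the deviation integrates to
  O(\<open>\<delta>\<close>).\<close>

lemma weighted_dev:
  "integral {-pi..pi} (\<lambda>x. (adelta \<nu> \<delta> b \<theta> x)\<^sup>2 * \<bar>hdelta \<nu> \<delta> \<theta> x - 2 * \<nu> / \<theta>\<bar>) \<le> (2 * \<nu> + 1) * pi * \<delta>"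
proof -
  let ?a = "\<delta> * \<theta>"
  have a: "0 < ?a" using delta t' by simp
  have p: "?a\<^sup>2 + x\<^sup>2 \<noteq> 0" for x using a by (intro less_imp_neq[symmetric] add_pos_nonneg) auto
  have "integral {-pi..pi} (\<lambda>x. (adelta \<nu> \<delta> b \<theta> x)\<^sup>2 * \<bar>hdelta \<nu> \<delta> \<theta> x - 2 * \<nu> / \<theta>\<bar>) \<le>
     integral {-pi..pi} (\<lambda>x. (2 * \<nu> + 1) / \<theta> * (?a\<^sup>2 / (?a\<^sup>2 + x\<^sup>2)))"
  proof (rule integral_le)
    fix x assume x: "x \<in> {-pi..pi}"
    have "(adelta \<nu> \<delta> b \<theta> x)\<^sup>2 \<le> 1" using adelta_bounds[OF x] by (simp add: power_le_one)
    then have "(adelta \<nu> \<delta> b \<theta> x)\<^sup>2 * \<bar>hdelta \<nu> \<delta> \<theta> x - 2 * \<nu> / \<theta>\<bar> \<le> 1 * ((2 * \<nu> + 1) / \<theta> * (?a\<^sup>2 / (?a\<^sup>2 + x\<^sup>2)))"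
      using hdelta_dev[OF x] by (intro mult_mono) auto
    then show "(adelta \<nu> \<delta> b \<theta> x)\<^sup>2 * \<bar>hdelta \<nu> \<delta> \<theta> x - 2 * \<nu> / \<theta>\<bar> \<le> (2 * \<nu> + 1) / \<theta> * (?a\<^sup>2 / (?a\<^sup>2 + x\<^sup>2))" by simp
  qed (intro integrable_continuous_interval continuous_intros adelta_cont hdelta_cont; use p in simp)+
  also have "\<dots> \<le> (2 * \<nu> + 1) / \<theta> * (pi * ?a)"
    unfolding integral_mult_right using nu t'(3) a by (intro mult_left_mono integral_lorentz_le) auto
  also have "\<dots> = (2 * \<nu> + 1) * pi * \<delta>" using t'(3) by simp
  finally show ?thesis .
qed

text \<open>The cutoff is chosen so that \<open>s^(2\<nu>+1) = \<delta>^(2\<nu>)\<close>: up to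
  \<open>s\<close> the unaliased density times \<open>b\<close> stays above \<open>k\<close>, which
  is free of \<open>\<delta>\<close>, and therefore \<open>adelta\<close> stays above
  \<open>k / (k + 1 / (2 pi))\<close>.\<close>

lemma weight_lower:
  assumes s: "s = \<delta> powr (2 * \<nu> / (2 * \<nu> + 1))" "\<delta> * \<theta> \<le> s" "s \<le> pi"
  defines "k \<equiv> b * Cnu \<nu> * \<theta> powr (2 * \<nu>) * 2 powr (- (\<nu> + 1/2))"
  shows "(k / (k + 1 / (2 * pi)))\<^sup>2 * s \<le> integral {-pi..pi} (\<lambda>x. (adelta \<nu> \<delta> b \<theta> x)\<^sup>2)"
proof -
  have s0: "0 < s" using delta s(1) by simp
  have k: "0 < k" using b Cnu_pos t' by (simp add: k_def)
  have lower: "k / (k + 1 / (2 * pi)) \<le> adelta \<nu> \<delta> b \<theta> x" if x: "x \<in> {0..s}" for x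
  proof -
    have xp: "x \<in> {-pi..pi}" using x s by auto
    have "\<delta>\<^sup>2 * \<theta>\<^sup>2 + x\<^sup>2 \<le> 2 * s\<^sup>2"
    proof -
      have "x\<^sup>2 \<le> s\<^sup>2" using x by (intro power_mono) auto
      then show ?thesis using power_mono[OF s(2), of 2] delta t' by (simp add: power_mult_distrib)
    qed
    then have "(2 * s\<^sup>2) powr (- (\<nu> + 1/2)) \<le> (\<delta>\<^sup>2 * \<theta>\<^sup>2 + x\<^sup>2) powr (- (\<nu> + 1/2))"
      using nu den_pos[OF t'(3)] by (intro powr_mono2') auto
    moreover have "(2 * s\<^sup>2) powr (- (\<nu> + 1/2)) = 2 powr (- (\<nu> + 1/2)) * \<delta> powr (- (2 * \<nu>))"
    proof -
      have "s\<^sup>2 = \<delta> powr (2 * (2 * \<nu> / (2 * \<nu> + 1)))" using delta by (simp add: s(1) powr_power mult.commute)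
      then have "(s\<^sup>2) powr (- (\<nu> + 1/2)) = \<delta> powr (2 * (2 * \<nu> / (2 * \<nu> + 1)) * (- (\<nu> + 1/2)))" by (simp add: powr_powr)
      also have "2 * (2 * \<nu> / (2 * \<nu> + 1)) * (- (\<nu> + 1/2)) = - (2 * \<nu>)"
      proof -
        have eq: "- (\<nu> + 1/2) = - ((2 * \<nu> + 1) / 2)" by (simp add: add_divide_distrib)
        have gen: "2 * (2 * \<nu> / D) * (- (D / 2)) = - (2 * \<nu>)" if "D \<noteq> 0" for D using that by simp
        show ?thesis unfolding eq by (rule gen) (use nu in auto)
      qed
      finally show ?thesis using s0 by (simp add: powr_mult)
    qed
    ultimately have 1: "2 powr (- (\<nu> + 1/2)) * \<delta> powr (- (2 * \<nu>)) \<le> (\<delta>\<^sup>2 * \<theta>\<^sup>2 + x\<^sup>2) powr (- (\<nu> + 1/2))" by simp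
    have "k = b * (Cnu \<nu> * (\<delta> * \<theta>) powr (2 * \<nu>) * (2 powr (- (\<nu> + 1/2)) * \<delta> powr (- (2 * \<nu>))))"
      using delta t' by (simp add: k_def powr_mult powr_minus)
    also have "\<dots> \<le> b * G \<theta> x" unfolding G_eq[OF t'(3)] using 1 b Cnu_pos by (intro mult_left_mono) auto
    also have "\<dots> \<le> b * gdelta \<nu> \<delta> \<theta> x" using b gdelta_ge[OF t'(1,2) xp] by simp
    finally have kl: "k \<le> b * gdelta \<nu> \<delta> \<theta> x" .
    have "p / (p + c) \<le> q / (q + c)" if "0 < p" "p \<le> q" "0 < c" for p q c :: real
    proof -
      have "p * (q + c) \<le> q * (p + c)" using that by (simp add: algebra_simps)
      then show ?thesis using that by (simp add: divide_simps add_pos_pos)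
    qed
    from this[OF k kl, of "1 / (2 * pi)"] show ?thesis by (simp add: adelta_def)
  qed
  have kk: "0 \<le> k / (k + 1 / (2 * pi))" using k by (intro divide_nonneg_nonneg add_nonneg_nonneg) auto
  have "(k / (k + 1 / (2 * pi)))\<^sup>2 * s = integral {0..s} (\<lambda>x. (k / (k + 1 / (2 * pi)))\<^sup>2)" using s0 by simp
  also have "\<dots> \<le> integral {0..s} (\<lambda>x. (adelta \<nu> \<delta> b \<theta> x)\<^sup>2)"
    using lower kk s(3) by (intro integral_le integrable_continuous_interval continuous_intros continuous_on_subset[OF adelta_cont] power_mono) auto
  also have "\<dots> \<le> integral {-pi..pi} (\<lambda>x. (adelta \<nu> \<delta> b \<theta> x)\<^sup>2)"
    using s(3) by (intro integral_subset_le integrable_continuous_interval continuous_intros continuous_on_subset[OF adelta_cont]) auto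
  finally show ?thesis .
qed

end
end

section \<open>The variance ratio and its limit for vanishing spacing\<close>

lemma I0_eq_ratio:
  "I0 \<nu> d b \<theta> = integral {-pi..pi} (\<lambda>x. (adelta \<nu> d b \<theta> x)\<^sup>2) * integral {-pi..pi} (\<lambda>x. (adelta \<nu> d b \<theta> x)\<^sup>2 * (hdelta \<nu> d \<theta> x)\<^sup>2)
     / (integral {-pi..pi} (\<lambda>x. (adelta \<nu> d b \<theta> x)\<^sup>2 * hdelta \<nu> d \<theta> x))\<^sup>2"
  by (simp add: I0_def avarGE0_def avarML_def)

text \<open>Also correct when an integral vanishes: division by zero then makes both sides
  0.\<close>

lemma I0_eq_Jfun: "I0 \<nu> d b \<theta> = 1 + Jfun (adelta \<nu> d b \<theta>) (hdelta \<nu> d \<theta>)"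
  by (simp add: I0_eq_ratio Jfun_def)

text \<open>The ratio is the second moment of \<open>h\<close> over its squared mean, for the weight
  \<open>w\<close> normalised to mass one. Both moments approach those of the constant
  \<open>c\<close>: the deviation integrates to O(\<open>d\<close>), while the total weight is at
  least a multiple of \<open>d powr p\<close> with \<open>p < 1\<close>.\<close>

lemma I0_tendsto_1:
  assumes nu: "1/2 \<le> \<nu>" and b: "0 < b" and th: "0 < \<theta>"
  shows "((\<lambda>d. I0 \<nu> d b \<theta>) \<longlongrightarrow> 1) (at_right 0)"
proof -
  define w where "w d x = (adelta \<nu> d b \<theta> x)\<^sup>2" for d x
  define h where "h d x = hdelta \<nu> d \<theta> x" for d x
  define I where "I f = integral {-pi..pi} f" for f :: "real \<Rightarrow> real"
  define c where "c = 2 * \<nu> / \<theta>"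
  have c: "0 < c" using nu th by (simp add: c_def)
  define H where "H = (2 * \<nu> + 1) / \<theta>"
  define k where "k = b * Cnu \<nu> * \<theta> powr (2 * \<nu>) * 2 powr (- (\<nu> + 1/2))"
  define B where "B = (k / (k + 1 / (2 * pi)))\<^sup>2"
  define p where "p = 2 * \<nu> / (2 * \<nu> + 1)"
  have p: "0 < p" "p < 1" using nu by (auto simp: p_def)
  \<comment> \<open>The upper bound for the weighted deviation over the lower bound for the total
    weight.\<close>
  define r where "r d = (2 * \<nu> + 1) * pi / B * d powr (1 - p)" for d
  \<comment> \<open>An auxiliary parameter interval around \<open>\<theta>\<close>; the locale is
    instantiated anew for every spacing \<open>d\<close>.\<close>
  have mat: "matern \<nu> d (\<theta>/2) (2*\<theta>)" if "0 < d" for d using that nu th by unfold_locales auto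
  have k0: "0 < k" unfolding k_def using b th matern.Cnu_pos[OF mat[of 1]] by simp
  have B: "0 < B" unfolding B_def using k0 by (intro zero_less_power divide_pos_pos add_pos_pos) auto
  have tt: "\<theta>/2 < \<theta>" "\<theta> < 2*\<theta>" using th by auto
  have r0: "(r \<longlongrightarrow> 0) (at_right 0)"
  proof -
    have "((\<lambda>d::real. d powr (1 - p)) \<longlongrightarrow> 0) (at_right 0)" using p by real_asymp
    then show ?thesis unfolding r_def by (rule tendsto_mult_right_zero)
  qed
  have ev: "eventually (\<lambda>d::real. 0 < d \<and> d * \<theta> \<le> d powr p \<and> d powr p \<le> pi) (at_right 0)"
  proof (intro eventually_conj)
    show "eventually (\<lambda>d::real. 0 < d) (at_right 0)" by (simp add: eventually_at_right_less)
    show "eventually (\<lambda>d. d * \<theta> \<le> d powr p) (at_right 0)"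
    proof -
      have "((\<lambda>d::real. d powr (1 - p) * \<theta>) \<longlongrightarrow> 0) (at_right 0)" using p by real_asymp
      then have "eventually (\<lambda>d. d powr (1 - p) * \<theta> < 1) (at_right 0)" by (rule order_tendstoD) simp
      moreover have "eventually (\<lambda>d::real. 0 < d) (at_right 0)" by (simp add: eventually_at_right_less)
      ultimately show ?thesis
      proof eventually_elim
        case (elim d)
        have "d = d powr p * d powr (1 - p)" using elim by (simp add: powr_add[symmetric])
        then have "d * \<theta> = d powr p * (d powr (1 - p) * \<theta>)" by (metis mult.assoc)
        also have "\<dots> \<le> d powr p * 1" using elim by (intro mult_left_mono) auto
        finally show ?case by simp
      qed
    qed
    have "((\<lambda>d::real. d powr p) \<longlongrightarrow> 0) (at_right 0)" using p by real_asymp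
    then show "eventually (\<lambda>d. d powr p \<le> pi) (at_right 0)"
      by (rule eventually_mono[OF order_tendstoD(2)[of _ 0 _ pi]]) auto
  qed
  have key: "eventually (\<lambda>d. 0 < I (w d) \<and> \<bar>I (\<lambda>x. w d x * h d x) / I (w d) - c\<bar> \<le> r d \<and>
      \<bar>I (\<lambda>x. w d x * (h d x)\<^sup>2) / I (w d) - c\<^sup>2\<bar> \<le> (2 * c + H) * r d) (at_right 0)"
    using ev
  proof eventually_elim
    case (elim d)
    then have d: "0 < d" by simp
    interpret m: matern \<nu> d "\<theta>/2" "2*\<theta>" by (rule mat[OF d])
    note ac = m.adelta_cont[OF b tt] and hc = m.hdelta_cont[OF b tt]
    have wc: "continuous_on {-pi..pi} (w d)" unfolding w_def by (intro continuous_intros ac)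
    have hc': "continuous_on {-pi..pi} (h d)" unfolding h_def by (intro hc)
    have w0: "0 \<le> w d x" for x by (simp add: w_def)
    have Bl: "B * d powr p \<le> I (w d)"
      using m.weight_lower[OF b tt, of "d powr p"] elim unfolding B_def k_def p_def I_def w_def by simp
    have pos: "0 < I (w d)"
    proof -
      have "0 < B * d powr p" using B d by simp
      then show ?thesis using Bl by linarith
    qed
    have dev: "I (\<lambda>x. w d x * \<bar>h d x - c\<bar>) \<le> (2 * \<nu> + 1) * pi * d"
      using m.weighted_dev[OF b tt] unfolding I_def w_def h_def c_def .
    have "I (\<lambda>x. w d x * \<bar>h d x - c\<bar>) / I (w d) \<le> (2 * \<nu> + 1) * pi * d / (B * d powr p)"
      using dev Bl B d nu by (intro frac_le) auto
    also have "\<dots> = r d"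
    proof -
      have "d / d powr p = d powr (1 - p)" using d by (simp add: powr_diff)
      moreover have "(2 * \<nu> + 1) * pi * d / (B * d powr p) = (2 * \<nu> + 1) * pi / B * (d / d powr p)" by simp
      ultimately show ?thesis by (simp only: r_def)
    qed
    finally have devr: "I (\<lambda>x. w d x * \<bar>h d x - c\<bar>) / I (w d) \<le> r d" .
    \<comment> \<open>One estimate for two functions: \<open>f = h\<close> with
      \<open>C = c\<close>, \<open>L = 1\<close>, and \<open>f = h^2\<close> with
      \<open>C = c^2\<close>, \<open>L = 2 c + H\<close>.\<close>
    have wd: "\<bar>I (\<lambda>x. w d x * f x) / I (w d) - C\<bar> \<le> L * r d"
      if f: "continuous_on {-pi..pi} f" and L: "0 \<le> L" "\<And>x. x \<in> {-pi..pi} \<Longrightarrow> \<bar>f x - C\<bar> \<le> L * \<bar>h d x - c\<bar>" for f C L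
    proof -
      have "I (\<lambda>x. w d x * f x) - C * I (w d) = I (\<lambda>x. w d x * f x - C * w d x)"
        unfolding I_def by (subst integral_diff) (auto intro!: integrable_continuous_interval continuous_intros wc f)
      also have "\<bar>\<dots>\<bar> \<le> I (\<lambda>x. L * (w d x * \<bar>h d x - c\<bar>))"
        unfolding I_def real_norm_def[symmetric]
      proof (rule integral_norm_bound_integral)
        fix x assume x: "x \<in> {-pi..pi}"
        have "norm (w d x * f x - C * w d x) = w d x * \<bar>f x - C\<bar>"
        proof -
          have "w d x * f x - C * w d x = w d x * (f x - C)" by (simp add: algebra_simps)
          then show ?thesis using w0[of x] by (simp add: abs_mult)
        qed
        also have "\<dots> \<le> w d x * (L * \<bar>h d x - c\<bar>)" using L(2)[OF x] w0 by (intro mult_left_mono) auto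
        finally show "norm (w d x * f x - C * w d x) \<le> L * (w d x * norm (h d x - c))" by (simp add: mult_ac)
      qed (auto intro!: integrable_continuous_interval continuous_intros wc f hc')
      also have "\<dots> = L * I (\<lambda>x. w d x * \<bar>h d x - c\<bar>)" unfolding I_def by simp
      finally have 1: "\<bar>I (\<lambda>x. w d x * f x) - C * I (w d)\<bar> \<le> L * I (\<lambda>x. w d x * \<bar>h d x - c\<bar>)" .
      have "I (\<lambda>x. w d x * f x) / I (w d) - C = (I (\<lambda>x. w d x * f x) - C * I (w d)) / I (w d)"
        using pos by (simp add: diff_divide_distrib)
      then have "\<bar>I (\<lambda>x. w d x * f x) / I (w d) - C\<bar> = \<bar>I (\<lambda>x. w d x * f x) - C * I (w d)\<bar> / I (w d)"
        using pos by (simp add: abs_divide)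
      also have "\<dots> \<le> L * I (\<lambda>x. w d x * \<bar>h d x - c\<bar>) / I (w d)" using 1 pos by (intro divide_right_mono) auto
      also have "\<dots> \<le> L * r d" using devr L(1) by (simp add: mult_left_mono flip: times_divide_eq_right)
      finally show ?thesis .
    qed
    have "\<bar>(h d x)\<^sup>2 - c\<^sup>2\<bar> \<le> (2 * c + H) * \<bar>h d x - c\<bar>" if x: "x \<in> {-pi..pi}" for x
    proof -
      have "\<bar>h d x - c\<bar> \<le> H" using m.hdelta_dev_le[OF b tt x] by (simp add: h_def c_def H_def)
      then have "\<bar>h d x + c\<bar> \<le> 2 * c + H" using c by linarith
      then have "\<bar>h d x + c\<bar> * \<bar>h d x - c\<bar> \<le> (2 * c + H) * \<bar>h d x - c\<bar>" by (intro mult_right_mono) auto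
      moreover have "(h d x)\<^sup>2 - c\<^sup>2 = (h d x + c) * (h d x - c)" by (simp add: power2_eq_square algebra_simps)
      ultimately show ?thesis by (simp add: abs_mult)
    qed
    moreover have "0 \<le> 2 * c + H" using c nu th by (simp add: H_def)
    ultimately show ?case using pos wd[OF hc', of 1 c] wd[of "\<lambda>x. (h d x)\<^sup>2" "2 * c + H" "c\<^sup>2"] hc'
      by (auto intro!: continuous_intros)
  qed
  have l1: "((\<lambda>d. I (\<lambda>x. w d x * h d x) / I (w d)) \<longlongrightarrow> c) (at_right 0)"
    by (rule LIM_zero_cancel, rule Lim_null_comparison[OF _ r0]) (use key in \<open>auto elim: eventually_mono\<close>)
  have l2: "((\<lambda>d. I (\<lambda>x. w d x * (h d x)\<^sup>2) / I (w d)) \<longlongrightarrow> c\<^sup>2) (at_right 0)"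
    by (rule LIM_zero_cancel, rule Lim_null_comparison[OF _ tendsto_mult_right_zero[OF r0, of "2 * c + H"]]) (use key in \<open>auto elim: eventually_mono\<close>)
  have "((\<lambda>d. (I (\<lambda>x. w d x * (h d x)\<^sup>2) / I (w d)) / (I (\<lambda>x. w d x * h d x) / I (w d))\<^sup>2) \<longlongrightarrow> c\<^sup>2 / c\<^sup>2) (at_right 0)"
    using c by (intro tendsto_intros l1 l2) auto
  moreover have "eventually (\<lambda>d. (I (\<lambda>x. w d x * (h d x)\<^sup>2) / I (w d)) / (I (\<lambda>x. w d x * h d x) / I (w d))\<^sup>2 = I0 \<nu> d b \<theta>) (at_right 0)"
    using key
  proof eventually_elim
    case (elim d)
    then have "I (w d) \<noteq> 0" by simp
    then have "(I (\<lambda>x. w d x * (h d x)\<^sup>2) / I (w d)) / (I (\<lambda>x. w d x * h d x) / I (w d))\<^sup>2 = I (w d) * I (\<lambda>x. w d x * (h d x)\<^sup>2) / (I (\<lambda>x. w d x * h d x))\<^sup>2"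
      by (simp add: power_divide power2_eq_square)
    then show ?case by (simp add: I0_eq_ratio I_def w_def[abs_def] h_def)
  qed
  ultimately show ?thesis using c by (simp add: tendsto_cong)
qed

section \<open>The estimating equation\<close>

lemma pencil_symmetric_inverse:
  fixes Sig G :: "real mat"
  assumes "Sig \<in> carrier_mat n n" "G \<in> carrier_mat n n" "Sig * G = 1\<^sub>m n" "Sig\<^sup>T = Sig"
  shows "G\<^sup>T = G"
proof -
  have "G\<^sup>T * Sig = (Sig * G)\<^sup>T" using assms by (subst transpose_mult[of _ n n]) auto
  then have "G\<^sup>T * Sig = 1\<^sub>m n" using assms by simp
  then have "G\<^sup>T * Sig * G = G" using assms by simp
  moreover have "G\<^sup>T * Sig * G = G\<^sup>T * (Sig * G)" using assms by (intro assoc_mult_mat[of _ n n _ n _ n]) auto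
  ultimately show ?thesis using assms by simp
qed

section \<open>Quadratic forms in the Gaussian observations\<close>

context prob_space begin

text \<open>With \<open>Sig = U U\<^sup>T\<close>, the coordinates \<open>w = U\<^sup>T G y\<close>,
  that is the inverse of \<open>U\<close> applied to \<open>y\<close>, have identity covariance and
  are independent standard normal by \<open>normal_coordinates\<close>. In them the form is
  diagonal; its mean is the sum of the \<open>\<gamma>\<close>, half its variance the sum of their
  squares, and both are traces by cyclicity.\<close>

lemma quadratic_representation:
  fixes y :: "nat \<Rightarrow> 'a \<Rightarrow> real"
  assumes pen: "pencil n G Sig T s" and y: "\<And>i. i < n \<Longrightarrow> y i \<in> borel_measurable M"
    and ch: "\<And>c. (CLINT x|M. iexp (\<Sum>i<n. c i * y i x)) = complex_of_real (exp (- bform Sig (vec n c) (vec n c) / 2))"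
    and c: "opb n c T"
  shows "\<exists>\<gamma> w. (\<forall>j<n. w j \<in> borel_measurable M) \<and> (\<forall>j<n. distr M borel (w j) = std_normal_distribution) \<and> indep_vars (\<lambda>_. borel) w {..<n} \<and>
     (\<forall>x. bform T (vec n (\<lambda>i. y i x)) (vec n (\<lambda>i. y i x)) - mtrace (T * Sig) = (\<Sum>j<n. \<gamma> j * ((w j x)\<^sup>2 - 1))) \<and>
     (\<Sum>j<n. (\<gamma> j)\<^sup>2) = mtrace ((T * Sig) * (T * Sig)) \<and> (\<forall>j<n. \<bar>\<gamma> j\<bar> \<le> c * s\<^sup>2)"
proof -
  interpret pencil n G Sig T s by (rule pen)
  obtain U \<gamma> where U: "U \<in> carrier_mat n n" and UGU: "U\<^sup>T * G * U = 1\<^sub>m n" and UU: "U * U\<^sup>T = Sig"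
    and UTU: "U\<^sup>T * T * U = mat n n (\<lambda>(i,j). if i = j then \<gamma> i else 0)" and gb: "\<And>i. i < n \<Longrightarrow> \<bar>\<gamma> i\<bar> \<le> c * s\<^sup>2"
    using simultaneous_diagonalisation c by blast
  define W where "W = U\<^sup>T * G"
  have UT: "U\<^sup>T \<in> carrier_mat n n" using U by simp
  have W: "W \<in> carrier_mat n n" using UT G by (simp add: W_def)
  define D where "D = mat n n (\<lambda>(i,j). if i = j then \<gamma> i else 0)"
  have D: "D \<in> carrier_mat n n" by (simp add: D_def)
  define w where "w j x = (\<Sum>i<n. W $$ (j,i) * y i x)" for j x
  define yv where "yv x = vec n (\<lambda>i. y i x)" for x
  have yv: "yv x \<in> carrier_vec n" for x by (simp add: yv_def)
  have wv: "vec n (\<lambda>j. w j x) = W *\<^sub>v yv x" for x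
    using W by (intro eq_vecI) (auto simp: w_def yv_def scalar_prod_def atLeast0LessThan)
  have UW: "U * W = 1\<^sub>m n"
  proof -
    have "U * W = U * U\<^sup>T * G" unfolding W_def using U UT G by (intro assoc_mult_mat[of _ n n _ n _ n, symmetric]) auto
    then show ?thesis by (simp add: UU inv)
  qed
  have WU: "W * U = 1\<^sub>m n" using UGU by (simp add: W_def)
  have WS: "W * Sig = U\<^sup>T"
  proof -
    have "W * Sig = U\<^sup>T * (G * Sig)" unfolding W_def using UT G Sig by (intro assoc_mult_mat[of _ n n _ n _ n]) auto
    then show ?thesis using UT by (simp add: inv)
  qed
  have WT: "W\<^sup>T \<in> carrier_mat n n" using W by simp
  have WTe: "W\<^sup>T = G * U" unfolding W_def using UT G U by (subst transpose_mult[of _ n n]) auto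
  have wm: "w j \<in> borel_measurable M" for j unfolding w_def using y by (intro borel_measurable_sum borel_measurable_times) auto
  have wch: "(CLINT x|M. iexp (\<Sum>j<n. t j * w j x)) = complex_of_real (exp (- (\<Sum>j<n. (t j)\<^sup>2) / 2))" for t
  proof -
    define a where "a i = (\<Sum>j<n. t j * W $$ (j,i))" for i
    have "(\<Sum>j<n. t j * w j x) = (\<Sum>i<n. a i * y i x)" for x
    proof -
      have "(\<Sum>j<n. t j * w j x) = (\<Sum>j<n. \<Sum>i<n. t j * W $$ (j,i) * y i x)" by (simp add: w_def sum_distrib_left mult.assoc)
      also have "\<dots> = (\<Sum>i<n. \<Sum>j<n. t j * W $$ (j,i) * y i x)" by (rule sum.swap)
      finally show ?thesis by (simp add: a_def sum_distrib_right)
    qed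
    moreover have "bform Sig (vec n a) (vec n a) = (\<Sum>j<n. (t j)\<^sup>2)"
    proof -
      let ?t = "vec n t"
      have av: "vec n a = W\<^sup>T *\<^sub>v ?t" using W by (intro eq_vecI) (auto simp: a_def scalar_prod_def atLeast0LessThan mult.commute)
      have "bform Sig (vec n a) (vec n a) = ?t \<bullet> (W *\<^sub>v (Sig *\<^sub>v (W\<^sup>T *\<^sub>v ?t)))"
        unfolding bform_def av using W Sig WT by (intro transpose_scalar_prod) auto
      also have "W *\<^sub>v (Sig *\<^sub>v (W\<^sup>T *\<^sub>v ?t)) = (W * Sig * W\<^sup>T) *\<^sub>v ?t"
        using W Sig WT by (simp add: assoc_mult_mat_vec[of _ n n _ n])
      also have "W * Sig * W\<^sup>T = U\<^sup>T * G * U" unfolding WS WTe using UT G U by (intro assoc_mult_mat[of _ n n _ n _ n, symmetric]) auto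
      also have "(U\<^sup>T * G * U) *\<^sub>v ?t = ?t" unfolding UGU by simp
      finally show ?thesis by (simp add: scalar_prod_def atLeast0LessThan power2_eq_square)
    qed
    ultimately show ?thesis using ch[of a] by simp
  qed
  note nc = normal_coordinates[OF wm wch]
  have tr: "mtrace (T * Sig) = (\<Sum>j<n. \<gamma> j)"
  proof -
    have "mtrace (T * Sig) = mtrace (T * U * U\<^sup>T)" unfolding UU[symmetric] using T U UT by (simp add: assoc_mult_mat[of _ n n _ n _ n])
    also have "\<dots> = mtrace (U\<^sup>T * (T * U))" using T U UT by (intro mtrace_comm[of _ n]) auto
    also have "U\<^sup>T * (T * U) = U\<^sup>T * T * U" using T U UT by (intro assoc_mult_mat[of _ n n _ n _ n, symmetric]) auto
    finally show ?thesis unfolding UTU by (simp add: mtrace_def)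
  qed
  have tr2: "mtrace ((T * Sig) * (T * Sig)) = (\<Sum>j<n. (\<gamma> j)\<^sup>2)"
  proof -
    have "(T * Sig) * (T * Sig) = (T * U) * (D * U\<^sup>T)"
    proof -
      have "(T * Sig) * (T * Sig) = (T * (U * U\<^sup>T)) * (T * (U * U\<^sup>T))" by (simp add: UU)
      also have "\<dots> = (T * U) * ((U\<^sup>T * T * U) * U\<^sup>T)" using T U UT by (simp add: assoc_mult_mat[of _ n n _ n _ n])
      finally show ?thesis unfolding UTU D_def .
    qed
    then have "mtrace ((T * Sig) * (T * Sig)) = mtrace ((D * U\<^sup>T) * (T * U))"
      using T U UT D by (simp only:) (intro mtrace_comm[of _ n], auto)
    also have "(D * U\<^sup>T) * (T * U) = D * (U\<^sup>T * T * U)" using T U UT D by (simp add: assoc_mult_mat[of _ n n _ n _ n])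
    also have "\<dots> = D * D" unfolding UTU D_def ..
    also have "mtrace (D * D) = (\<Sum>j<n. (\<gamma> j)\<^sup>2)"
    proof -
      have "(\<Sum>k<n. (if j = k then \<gamma> j else 0) * (if k = j then \<gamma> k else 0)) = (\<gamma> j)\<^sup>2" if j: "j < n" for j
      proof -
        have "(\<Sum>k<n. (if j = k then \<gamma> j else 0) * (if k = j then \<gamma> k else 0)) = (\<Sum>k<n. if j = k then (\<gamma> k)\<^sup>2 else 0)"
          by (intro sum.cong) (auto simp: power2_eq_square)
        then show ?thesis using j by simp
      qed
      then show ?thesis by (simp add: mtrace_def D_def scalar_prod_def atLeast0LessThan)
    qed
    finally show ?thesis .
  qed
  have q: "bform T (yv x) (yv x) = (\<Sum>j<n. \<gamma> j * (w j x)\<^sup>2)" for x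
  proof -
    let ?w = "vec n (\<lambda>j. w j x)"
    have wc: "?w \<in> carrier_vec n" by simp
    have "yv x = U *\<^sub>v ?w" unfolding wv using assoc_mult_mat_vec[OF U W yv[of x]] UW yv[of x] by simp
    then have "bform T (yv x) (yv x) = (U *\<^sub>v ?w) \<bullet> (T *\<^sub>v (U *\<^sub>v ?w))" by (simp add: bform_def)
    also have "\<dots> = ?w \<bullet> (U\<^sup>T *\<^sub>v (T *\<^sub>v (U *\<^sub>v ?w)))" using transpose_scalar_prod[OF UT, of ?w "T *\<^sub>v (U *\<^sub>v ?w)"] T U by simp
    also have "U\<^sup>T *\<^sub>v (T *\<^sub>v (U *\<^sub>v ?w)) = (U\<^sup>T * T * U) *\<^sub>v ?w" using T U UT by (simp add: assoc_mult_mat_vec[of _ n n _ n])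
    also have "\<dots> = vec n (\<lambda>j. \<gamma> j * w j x)" unfolding UTU
    proof (rule eq_vecI)
      fix j assume "j < dim_vec (vec n (\<lambda>j. \<gamma> j * w j x))"
      then have j: "j < n" by simp
      have "(\<Sum>i<n. (if j = i then \<gamma> j else 0) * w i x) = (\<Sum>i<n. if j = i then \<gamma> j * w i x else 0)" by (intro sum.cong) auto
      also have "\<dots> = \<gamma> j * w j x" using j by simp
      finally show "(mat n n (\<lambda>(i,j). if i = j then \<gamma> i else 0) *\<^sub>v ?w) $ j = vec n (\<lambda>j. \<gamma> j * w j x) $ j"
        using j by (simp add: scalar_prod_def atLeast0LessThan)
    qed simp
    also have "?w \<bullet> vec n (\<lambda>j. \<gamma> j * w j x) = (\<Sum>j<n. \<gamma> j * (w j x)\<^sup>2)" by (simp add: scalar_prod_def atLeast0LessThan power2_eq_square mult_ac)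
    finally show ?thesis .
  qed
  have "bform T (yv x) (yv x) - mtrace (T * Sig) = (\<Sum>j<n. \<gamma> j * ((w j x)\<^sup>2 - 1))" for x
    unfolding q tr by (simp add: right_diff_distrib sum_subtractf)
  then show ?thesis using wm nc tr2 gb unfolding yv_def by (intro exI[of _ \<gamma>] exI[of _ w]) auto
qed

text \<open>Independence of process and noise splits the characteristic function into two Gaussian
  factors. Its value at 1 suffices because the coefficients \<open>c\<close> are arbitrary.\<close>

lemma linear_combination_char:
  fixes Z :: "real \<Rightarrow> 'a \<Rightarrow> real" and eps :: "nat \<Rightarrow> 'a \<Rightarrow> real" and c ts :: "nat \<Rightarrow> real"
  assumes Zgp: "gaussian_process M Z K0"
    and eps_normal: "\<And>i. distributed M lborel (eps i) (normal_density 0 1)"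
    and eps_indep: "indep_vars (\<lambda>_. borel) eps UNIV"
    and Z_eps_indep: "indep_set
              (sigma_sets (space M) (\<Union>t. {Z t -` A \<inter> space M |A. A \<in> sets borel}))
              (sigma_sets (space M) (\<Union>i. {eps i -` A \<inter> space M |A. A \<in> sets borel}))"
    and v: "v = (\<Sum>i<n. \<Sum>j<n. c i * c j * K0 (ts i) (ts j))" "0 \<le> v"
  shows "(CLINT x|M. iexp (\<Sum>i<n. c i * (Z (ts i) x + eps i x))) = complex_of_real (exp (- (v + (\<Sum>i<n. (c i)\<^sup>2)) / 2))"
proof -
  define X1 where "X1 x = (\<Sum>i<n. c i * Z (ts i) x)" for x
  define X2 where "X2 x = (\<Sum>i<n. c i * eps i x)" for x
  \<comment> \<open>The sigma-algebras generated by the process and by the noise: each linear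
    combination is measurable for its own one, which transfers the assumed independence.\<close>
  define N1 where "N1 = sigma (space M) (\<Union>t. {Z t -` A \<inter> space M |A. A \<in> sets borel})"
  define N2 where "N2 = sigma (space M) (\<Union>i. {eps i -` A \<inter> space M |A. A \<in> sets borel})"
  have s1: "sets N1 = sigma_sets (space M) (\<Union>t. {Z t -` A \<inter> space M |A. A \<in> sets borel})" "space N1 = space M"
    unfolding N1_def by (auto intro!: sets_measure_of space_measure_of)
  have s2: "sets N2 = sigma_sets (space M) (\<Union>i. {eps i -` A \<inter> space M |A. A \<in> sets borel})" "space N2 = space M"
    unfolding N2_def by (auto intro!: sets_measure_of space_measure_of)
  have Z1: "Z t \<in> borel_measurable N1" for t
    by (rule measurableI) (auto simp: s1 intro!: sigma_sets.Basic)
  have E2: "eps i \<in> borel_measurable N2" for i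
    by (rule measurableI) (auto simp: s2 intro!: sigma_sets.Basic)
  have X1N: "X1 \<in> borel_measurable N1" unfolding X1_def using Z1 by (intro borel_measurable_sum borel_measurable_times) auto
  have X2N: "X2 \<in> borel_measurable N2" unfolding X2_def using E2 by (intro borel_measurable_sum borel_measurable_times) auto
  have em: "eps i \<in> borel_measurable M" for i using distributed_measurable[OF eps_normal[of i]] by simp
  have X2m: "X2 \<in> borel_measurable M" unfolding X2_def using em by (intro borel_measurable_sum borel_measurable_times) auto
  have cn: "centered_normal M X1 v"
  proof -
    \<comment> \<open>\<open>gaussian_process\<close> quantifies over lists, so the finite family is
      listed along \<open>[0..<n]\<close>.\<close>
    have "centered_normal M (\<lambda>\<omega>. \<Sum>i<length (map ts [0..<n]). map c [0..<n] ! i * Z (map ts [0..<n] ! i) \<omega>)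
          (\<Sum>i<length (map ts [0..<n]). \<Sum>j<length (map ts [0..<n]). map c [0..<n] ! i * map c [0..<n] ! j * K0 (map ts [0..<n] ! i) (map ts [0..<n] ! j))"
    proof -
      have "centered_normal M (\<lambda>\<omega>. \<Sum>i<length us. cs!i * Z (us!i) \<omega>) (\<Sum>i<length us. \<Sum>j<length us. cs!i * cs!j * K0 (us!i) (us!j))"
        if "length cs = length us" for us cs :: "real list" using Zgp that unfolding gaussian_process_def by blast
      from this[of "map c [0..<n]" "map ts [0..<n]"] show ?thesis by simp
    qed
    then show ?thesis by (simp add: X1_def[abs_def] v(1))
  qed
  have X1m: "X1 \<in> borel_measurable M" using cn by (simp add: centered_normal_def)
  have ind: "indep_var borel X1 borel X2"
    unfolding indep_var_eq
  proof (intro conjI X1m X2m)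
    have "sigma_sets (space M) {X1 -` A \<inter> space M |A. A \<in> sets borel} \<subseteq> sets N1"
      unfolding s1(2)[symmetric] using X1N by (intro sets.sigma_sets_subset) (auto intro: measurable_sets)
    moreover have "sigma_sets (space M) {X2 -` A \<inter> space M |A. A \<in> sets borel} \<subseteq> sets N2"
      unfolding s2(2)[symmetric] using X2N by (intro sets.sigma_sets_subset) (auto intro: measurable_sets)
    ultimately show "indep_set (sigma_sets (space M) {X1 -` A \<inter> space M |A. A \<in> sets borel}) (sigma_sets (space M) {X2 -` A \<inter> space M |A. A \<in> sets borel})"
      using Z_eps_indep unfolding s1(1)[symmetric] s2(1)[symmetric] indep_sets2_eq by blast
  qed
  have ch1: "char (distr M borel X1) 1 = complex_of_real (exp (- v / 2))"
  proof (cases "v = 0")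
    \<comment> \<open>There is no normal density of variance zero; \<open>centered_normal\<close>
      then says that the combination vanishes almost surely.\<close>
    case True
    then have "AE x in M. X1 x = 0" using cn by (simp add: centered_normal_def)
    then have "(CLINT x|M. iexp (1 * X1 x)) = (CLINT x|M. 1)" using X1m by (intro integral_cong_AE) auto
    then show ?thesis using True X1m by (simp add: char_def integral_distr prob_space)
  next
    case False
    then have "distributed M lborel X1 (normal_density 0 (sqrt v))" "0 < sqrt v" using cn v(2) by (auto simp: centered_normal_def)
    from char_normal[OF this, of 1] show ?thesis using v(2) by simp
  qed
  have ch2: "char (distr M borel X2) 1 = complex_of_real (exp (- (\<Sum>i<n. (c i)\<^sup>2) / 2))"
  proof -
    have "indep_vars (\<lambda>_. borel) eps {..<n}" by (rule indep_vars_subset[OF eps_indep]) auto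
    then have "indep_vars (\<lambda>_. borel) (\<lambda>i x. c i * eps i x) {..<n}"
      by (rule indep_vars_compose2[where Y="\<lambda>i z. c i * z"]) measurable
    then have "char (distr M borel X2) 1 = (\<Prod>i<n. char (distr M borel (\<lambda>x. c i * eps i x)) 1)"
      unfolding X2_def by (rule char_distr_sum)
    also have "\<dots> = (\<Prod>i<n. complex_of_real (exp (- (c i)\<^sup>2 / 2)))"
    proof (rule prod.cong[OF refl])
      fix i
      have "char (distr M borel (\<lambda>x. c i * eps i x)) 1 = char (distr M borel (eps i)) (c i)" using em[of i] by (simp add: char_def integral_distr)
      then show "char (distr M borel (\<lambda>x. c i * eps i x)) 1 = complex_of_real (exp (- (c i)\<^sup>2 / 2))" using char_normal[OF eps_normal[of i], of "c i"] by simp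
    qed
    also have "\<dots> = complex_of_real (exp (- (\<Sum>i<n. (c i)\<^sup>2) / 2))"
      by (simp only: of_real_prod[symmetric] exp_sum[symmetric] finite_lessThan sum_divide_distrib[symmetric] sum_negf)
    finally show ?thesis .
  qed
  have "(CLINT x|M. iexp (\<Sum>i<n. c i * (Z (ts i) x + eps i x))) = (CLINT x|M. iexp (1 * (X1 x + X2 x)))"
    by (simp add: X1_def X2_def distrib_left sum.distrib)
  also have "\<dots> = char (distr M borel (\<lambda>x. X1 x + X2 x)) 1" unfolding char_def by (rule integral_distr[symmetric]) (use X1m X2m in measurable)
  also have "\<dots> = complex_of_real (exp (- v / 2)) * complex_of_real (exp (- (\<Sum>i<n. (c i)\<^sup>2) / 2))"
    unfolding char_distr_add[OF ind] ch1 ch2 ..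
  also have "\<dots> = complex_of_real (exp (- (v + (\<Sum>i<n. (c i)\<^sup>2)) / 2))"
    by (simp only: of_real_mult[symmetric] exp_add[symmetric] add_divide_distrib[symmetric] minus_add_distrib)
  finally show ?thesis .
qed

end

section \<open>The estimating equation in terms of Toeplitz matrices\<close>

context matern
begin

text \<open>The factor \<open>2 pi\<close> cancels the one in \<open>tcoef\<close>, so that the
  Toeplitz matrix of the symbol is \<open>b R\<close> itself.\<close>

definition symbol :: "real \<Rightarrow> real \<Rightarrow> real \<Rightarrow> real" where
  "symbol b \<theta> x = 2 * pi * b * gdelta \<nu> \<delta> \<theta> x"

definition dsymbol :: "real \<Rightarrow> real \<Rightarrow> real \<Rightarrow> real" where
  "dsymbol b \<theta> x = 2 * pi * b * dgdelta \<theta> x"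

lemma symbol_cont: "lo \<le> \<theta> \<Longrightarrow> \<theta> \<le> hi \<Longrightarrow> continuous_on {-pi..pi} (symbol b \<theta>)"
  unfolding symbol_def by (intro continuous_intros gdelta_cont)

lemma dsymbol_cont: "lo \<le> \<theta> \<Longrightarrow> \<theta> \<le> hi \<Longrightarrow> continuous_on {-pi..pi} (dsymbol b \<theta>)"
  unfolding dsymbol_def by (intro continuous_intros dgdelta_cont)

lemma symbol_pos: "lo \<le> \<theta> \<Longrightarrow> \<theta> \<le> hi \<Longrightarrow> 0 < b \<Longrightarrow> x \<in> {-pi..pi} \<Longrightarrow> 0 < symbol b \<theta> x"
  unfolding symbol_def by (simp add: gdelta_pos)

lemma symbol_even: "symbol b \<theta> (- x) = symbol b \<theta> x" "dsymbol b \<theta> (- x) = dsymbol b \<theta> x" if "lo \<le> \<theta>" "\<theta> \<le> hi"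
  by (simp_all add: symbol_def dsymbol_def gdelta_even[OF that] dgdelta_even[OF that])

lemma Kmat_nat:
  assumes t: "lo \<le> \<theta>" "\<theta> \<le> hi"
  shows "b * Kmat \<nu> \<theta> (\<delta> * (real j - real k)) = tcoef (symbol b \<theta>) (real j - real k)"
proof -
  have "b * Kmat \<nu> \<theta> (\<delta> * (real j - real k)) = b * integral {-pi..pi} (\<lambda>x. gdelta \<nu> \<delta> \<theta> x * cos ((real j - real k) * x))"
    using Kmat_eq[OF t, of "int j - int k"] by simp
  also have "\<dots> = integral {-pi..pi} (\<lambda>x. (2 * pi * b) * (gdelta \<nu> \<delta> \<theta> x * cos ((real j - real k) * x))) / (2 * pi)"
    by (simp only: integral_mult_right) simp
  finally show ?thesis by (simp add: tcoef_def symbol_def mult.assoc)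
qed

lemma Kmat_minus: "Kmat \<nu> \<theta> (- u) = Kmat \<nu> \<theta> u"
  by (simp add: Kmat_def)

lemma scaled_Rmat:
  assumes t: "lo \<le> \<theta>" "\<theta> \<le> hi"
  shows "b \<cdot>\<^sub>m Rmat \<nu> \<delta> \<theta> n = toep n (symbol b \<theta>)"
proof (rule eq_matI)
  fix j k assume "j < dim_row (toep n (symbol b \<theta>))" "k < dim_col (toep n (symbol b \<theta>))"
  then have jk: "j < n" "k < n" by auto
  have "Kmat \<nu> \<theta> (\<delta> * \<bar>real j - real k\<bar>) = Kmat \<nu> \<theta> (\<delta> * (real j - real k))"
    using Kmat_minus[of \<theta> "\<delta> * (real j - real k)"] by (simp add: abs_if algebra_simps)
  then show "(b \<cdot>\<^sub>m Rmat \<nu> \<delta> \<theta> n) $$ (j,k) = toep n (symbol b \<theta>) $$ (j,k)"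
    using jk Kmat_nat[OF t, of b j k] by (simp add: Rmat_def toep_index)
qed (auto simp: Rmat_def)

lemma GE0_eq_iff:
  assumes t: "lo \<le> \<theta>" "\<theta> \<le> hi"
  shows "GE0_eq \<nu> \<delta> b \<theta> n y \<longleftrightarrow> score n (toep n (symbol b \<theta>) * toepinv n (symbol b \<theta>)) y = 0"
  unfolding GE0_eq_def Amat_def scaled_Rmat[OF t] toepinv_def[symmetric] score_def by simp

text \<open>\<open>K\<close> is fixed before \<open>n\<close>, \<open>y\<close> and
  \<open>\<theta>\<close>, so the expansion may be used at a random root.\<close>

lemma score_local_expansion:
  assumes b: "0 < b" and t0: "lo \<le> \<theta>0" "\<theta>0 \<le> hi"
  defines "M0 \<equiv> \<lambda>n. toepinv n (symbol b \<theta>0)"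
  defines "N \<equiv> \<lambda>n. M0 n * toep n (dsymbol b \<theta>0) * M0 n"
  shows "\<exists>K\<ge>0. \<forall>n. \<forall>y\<in>carrier_vec n. \<forall>\<theta>. lo \<le> \<theta> \<longrightarrow> \<theta> \<le> hi \<longrightarrow> \<bar>\<theta> - \<theta>0\<bar> \<le> 1 \<longrightarrow>
     \<bar>score n (toep n (symbol b \<theta>) * toepinv n (symbol b \<theta>)) y - score n (toep n (symbol b \<theta>0) * M0 n) y
       + (\<theta> - \<theta>0) * (bform (N n - M0 n * N n - N n * M0 n) y y + mtrace (N n))\<bar> \<le> K * (\<theta> - \<theta>0)\<^sup>2 * ((vnorm y)\<^sup>2 + real n)"
proof -
  obtain L where L: "\<And>n. opb n L (toep n (dsymbol b \<theta>0))" using opb_toep_ex[OF dsymbol_cont[OF t0]] by blast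
  \<comment> \<open>The constant of \<open>gdelta_taylor\<close> times \<open>2 pi b\<close>; the
    summand one makes it positive, as \<open>opb_toep\<close> requires.\<close>
  define K where "K = 2 * pi * b * (\<bar>K2 * infsum maj UNIV\<bar> + 1)"
  have K: "0 < K" using b by (auto simp: K_def intro!: mult_pos_pos add_nonneg_pos)
  have p0: "continuous_on {-pi..pi} (symbol b \<theta>0)" "\<And>x. x \<in> {-pi..pi} \<Longrightarrow> 0 \<le> symbol b \<theta>0 x"
    using symbol_cont[OF t0] symbol_pos[OF t0 b] by (auto intro: less_imp_le)
  have main: "\<bar>score n (toep n (symbol b \<theta>) * toepinv n (symbol b \<theta>)) y - score n (toep n (symbol b \<theta>0) * M0 n) y
       + (\<theta> - \<theta>0) * (bform (N n - M0 n * N n - N n * M0 n) y y + mtrace (N n))\<bar> \<le> (4 * (L + K)\<^sup>2 + 3 * K) * (\<theta> - \<theta>0)\<^sup>2 * ((vnorm y)\<^sup>2 + real n)"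
    if y: "y \<in> carrier_vec n" and t: "lo \<le> \<theta>" "\<theta> \<le> hi" and d: "\<bar>\<theta> - \<theta>0\<bar> \<le> 1" for n y \<theta>
  proof (cases "\<theta> = \<theta>0")
    \<comment> \<open>Treated apart because the bound
      \<open>K * (\<theta> - \<theta>0)\<^sup>2\<close> would be zero, which \<open>opb_toep\<close>
      does not admit.\<close>
    case True
    then show ?thesis by (simp add: M0_def)
  next
    case False
    have p: "continuous_on {-pi..pi} (symbol b \<theta>)" "\<And>x. x \<in> {-pi..pi} \<Longrightarrow> 0 \<le> symbol b \<theta> x"
      using symbol_cont[OF t] symbol_pos[OF t b] by (auto intro: less_imp_le)
    define e where "e x = symbol b \<theta> x - (symbol b \<theta>0 x + (\<theta> - \<theta>0) * dsymbol b \<theta>0 x)" for x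
    have ec: "continuous_on {-pi..pi} e" unfolding e_def by (intro continuous_intros p p0 dsymbol_cont[OF t0])
    have E: "opb n (K * (\<theta> - \<theta>0)\<^sup>2) (toep n e)"
    proof (rule opb_toep[OF ec])
      show "0 < K * (\<theta> - \<theta>0)\<^sup>2" using K False by simp
      fix x assume x: "x \<in> {-pi..pi}"
      have "e x = 2 * pi * b * (gdelta \<nu> \<delta> \<theta> x - gdelta \<nu> \<delta> \<theta>0 x - (\<theta> - \<theta>0) * dgdelta \<theta>0 x)"
        by (simp add: e_def symbol_def dsymbol_def algebra_simps)
      then have "\<bar>e x\<bar> = 2 * pi * b * \<bar>gdelta \<nu> \<delta> \<theta> x - gdelta \<nu> \<delta> \<theta>0 x - (\<theta> - \<theta>0) * dgdelta \<theta>0 x\<bar>" using b by (simp add: abs_mult)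
      also have "\<dots> \<le> 2 * pi * b * ((\<theta> - \<theta>0)\<^sup>2 * K2 * infsum maj UNIV)"
        using b by (intro mult_left_mono gdelta_taylor t t0 x) auto
      also have "\<dots> = 2 * pi * b * (K2 * infsum maj UNIV) * (\<theta> - \<theta>0)\<^sup>2" by simp
      also have "\<dots> \<le> K * (\<theta> - \<theta>0)\<^sup>2" unfolding K_def using b by (intro mult_right_mono mult_left_mono) auto
      finally show "\<bar>e x\<bar> \<le> K * (\<theta> - \<theta>0)\<^sup>2" .
    qed
    have "toep n (symbol b \<theta>) = toep n (symbol b \<theta>0) + ((\<theta> - \<theta>0) \<cdot>\<^sub>m toep n (dsymbol b \<theta>0) + toep n e)"
    proof -
      have "toep n (symbol b \<theta>) = toep n (\<lambda>x. symbol b \<theta>0 x + ((\<theta> - \<theta>0) * dsymbol b \<theta>0 x + e x))" by (rule toep_cong) (simp add: e_def)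
      also have "\<dots> = toep n (symbol b \<theta>0) + toep n (\<lambda>x. (\<theta> - \<theta>0) * dsymbol b \<theta>0 x + e x)"
        by (intro toep_add continuous_intros p0 dsymbol_cont[OF t0] ec)
      also have "toep n (\<lambda>x. (\<theta> - \<theta>0) * dsymbol b \<theta>0 x + e x) = toep n (\<lambda>x. (\<theta> - \<theta>0) * dsymbol b \<theta>0 x) + toep n e"
        by (intro toep_add continuous_intros dsymbol_cont[OF t0] ec)
      finally show ?thesis by (simp only: toep_cmult)
    qed
    from score_expansion[OF toep_carrier toep_carrier toepinv(3)[OF p] toepinv(2)[OF p] toepinv(4)[OF p] toepinv(2)[OF p0] toepinv(4)[OF p0] this L E d less_imp_le[OF K] y]
    show ?thesis unfolding bform_def N_def M0_def .
  qed
  have "0 \<le> 4 * (L + K)\<^sup>2 + 3 * K" using K by simp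
  then show ?thesis using main by blast
qed

text \<open>Multiplying numerator and denominator by \<open>2 pi\<close> exhibits \<open>a\<close>
  as the asymptotic symbol of \<open>A\<close>.\<close>

lemma adelta_eq_symbol:
  assumes t: "lo \<le> \<theta>" "\<theta> \<le> hi" and b: "0 < b" and x: "x \<in> {-pi..pi}"
  shows "adelta \<nu> \<delta> b \<theta> x = symbol b \<theta> x / (1 + symbol b \<theta> x)"
proof -
  have "adelta \<nu> \<delta> b \<theta> x = (2 * pi * (b * gdelta \<nu> \<delta> \<theta> x)) / (2 * pi * (b * gdelta \<nu> \<delta> \<theta> x + 1 / (2 * pi)))"
    unfolding adelta_def by (rule mult_divide_mult_cancel_left[symmetric]) simp
  also have "2 * pi * (b * gdelta \<nu> \<delta> \<theta> x + 1 / (2 * pi)) = 1 + symbol b \<theta> x" by (simp add: symbol_def distrib_left)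
  finally show ?thesis by (simp add: symbol_def)
qed

text \<open>The right side is the integrand in the second limit of
  \<open>score_traces\<close>.\<close>

lemma weighted_hdelta_eq_symbol:
  assumes t: "lo < \<theta>" "\<theta> < hi" and b: "0 < b" and x: "x \<in> {-pi..pi}"
  shows "(adelta \<nu> \<delta> b \<theta> x)\<^sup>2 * hdelta \<nu> \<delta> \<theta> x = dsymbol b \<theta> x * symbol b \<theta> x / (1 + symbol b \<theta> x)\<^sup>2"
proof -
  have t': "lo \<le> \<theta>" "\<theta> \<le> hi" using t by auto
  have g: "0 < gdelta \<nu> \<delta> \<theta> x" by (rule gdelta_pos[OF t' x])
  have "hdelta \<nu> \<delta> \<theta> x = dsymbol b \<theta> x / symbol b \<theta> x" using b by (simp add: hdelta_eq[OF t x] symbol_def dsymbol_def)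
  moreover have "0 < symbol b \<theta> x" by (rule symbol_pos[OF t' b x])
  ultimately show ?thesis unfolding adelta_eq_symbol[OF t' b x] by (simp add: power_divide power2_eq_square)
qed

lemma weight_integral_pos:
  assumes t: "lo < \<theta>" "\<theta> < hi" and b: "0 < b"
  shows "0 < integral {-pi..pi} (\<lambda>x. (adelta \<nu> \<delta> b \<theta> x)\<^sup>2)"
proof -
  let ?f = "\<lambda>x. (adelta \<nu> \<delta> b \<theta> x)\<^sup>2"
  have c: "continuous_on {-pi..pi} ?f" by (intro continuous_intros adelta_cont[OF b t])
  have "0 \<le> integral {-pi..pi} ?f" by (intro integral_nonneg integrable_continuous_interval c) auto
  moreover have "integral {-pi..pi} ?f \<noteq> 0"
  proof
    assume "integral {-pi..pi} ?f = 0"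
    then have "\<forall>x\<in>{-pi..pi}. ?f x = 0" using integral_eq_0_iff[OF c] by simp
    then have "?f 0 = 0" by (rule bspec) simp
    then show False using adelta_bounds(1)[OF b t, of 0] by simp
  qed
  ultimately show ?thesis by linarith
qed

end

lemma transpose_minus_mat: "A \<in> carrier_mat n n \<Longrightarrow> C \<in> carrier_mat n n \<Longrightarrow> (A - C)\<^sup>T = A\<^sup>T - (C\<^sup>T :: real mat)"
  by (auto intro!: eq_matI)

lemma mat_minus_swap: "A \<in> carrier_mat n n \<Longrightarrow> C \<in> carrier_mat n n \<Longrightarrow> D \<in> carrier_mat n n \<Longrightarrow> A - C - D = A - D - (C :: real mat)"
  by (auto intro!: eq_matI)

section \<open>The observation model, its score and its slope at the true parameter\<close>

locale noisy_matern = prob_space M + matern \<nu> \<delta> lo hi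
  for M :: "'a measure" and \<nu> \<delta> lo hi :: real +
  fixes Z :: "real \<Rightarrow> 'a \<Rightarrow> real" and eps :: "nat \<Rightarrow> 'a \<Rightarrow> real" and b0 \<theta>0 :: real
  assumes b0: "0 < b0" and th0: "lo < \<theta>0" "\<theta>0 < hi"
    and Zgp: "gaussian_process M Z (\<lambda>s t. b0 * Kmat \<nu> \<theta>0 (t - s))"
    and eps_normal: "\<And>i. distributed M lborel (eps i) (normal_density 0 1)"
    and eps_indep: "indep_vars (\<lambda>_. borel) eps UNIV"
    and Z_eps_indep: "indep_set
              (sigma_sets (space M) (\<Union>t. {Z t -` A \<inter> space M |A. A \<in> sets borel}))
              (sigma_sets (space M) (\<Union>i. {eps i -` A \<inter> space M |A. A \<in> sets borel}))"
begin

lemma theta0_range: "lo \<le> \<theta>0" "\<theta>0 \<le> hi" using th0 by auto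

abbreviation "p \<equiv> symbol b0 \<theta>0"
abbreviation "q \<equiv> dsymbol b0 \<theta>0"

definition obs :: "nat \<Rightarrow> 'a \<Rightarrow> real" where "obs i x = Z (real (Suc i) * \<delta>) x + eps i x"
definition yv :: "nat \<Rightarrow> 'a \<Rightarrow> real vec" where "yv n x = vec n (\<lambda>i. obs i x)"
definition Sig :: "nat \<Rightarrow> real mat" where "Sig n = 1\<^sub>m n + toep n p"
definition M0 :: "nat \<Rightarrow> real mat" where "M0 n = toepinv n p"

lemma p_cont: "continuous_on {-pi..pi} p" by (rule symbol_cont[OF theta0_range])
lemma q_cont: "continuous_on {-pi..pi} q" by (rule dsymbol_cont[OF theta0_range])
lemma p_nonneg: "x \<in> {-pi..pi} \<Longrightarrow> 0 \<le> p x" using symbol_pos[OF theta0_range b0] by (auto intro: less_imp_le)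

lemma inv0:
  "M0 n \<in> carrier_mat n n" "Sig n * M0 n = 1\<^sub>m n" "M0 n * Sig n = 1\<^sub>m n" "opb n 1 (M0 n)"
  unfolding M0_def Sig_def by (rule toepinv[OF p_cont p_nonneg]; assumption)+

lemma yv_carrier [simp]: "yv n x \<in> carrier_vec n" by (simp add: yv_def)
lemma Sig_carrier [simp]: "Sig n \<in> carrier_mat n n" by (simp add: Sig_def)

lemma Sig_transpose: "(Sig n)\<^sup>T = Sig n"
  unfolding Sig_def by (subst transpose_add[of _ n n]) auto

lemma M0_transpose: "(M0 n)\<^sup>T = M0 n"
  by (rule pencil_symmetric_inverse[OF Sig_carrier inv0(1,2) Sig_transpose])

lemma obs_measurable: "obs i \<in> borel_measurable M"
proof -
  have "centered_normal M (\<lambda>\<omega>. \<Sum>i<length us. cs!i * Z (us!i) \<omega>) (\<Sum>i<length us. \<Sum>j<length us. cs!i * cs!j * (b0 * Kmat \<nu> \<theta>0 (us!j - us!i)))"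
    if "length cs = length us" for us cs :: "real list" using Zgp that unfolding gaussian_process_def by blast
  from this[of "[1]" "[_]"] have "Z t \<in> borel_measurable M" for t by (simp add: centered_normal_def)
  moreover have "eps i \<in> borel_measurable M" using distributed_measurable[OF eps_normal[of i]] by simp
  ultimately show ?thesis unfolding obs_def by (intro borel_measurable_add) auto
qed

lemma bform_Sig: "bform (Sig n) (vec n c) (vec n c) = (\<Sum>i<n. (c i)\<^sup>2) + (\<Sum>i<n. \<Sum>j<n. c i * c j * tcoef p (real i - real j))"
proof -
  have "bform (Sig n) (vec n c) (vec n c) = (\<Sum>i<n. \<Sum>j<n. c i * ((if i = j then 1 else 0) + tcoef p (real i - real j)) * c j)"
    by (subst bform_sum[of _ n]) (auto simp: Sig_def toep_index intro!: sum.cong)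
  also have "\<dots> = (\<Sum>i<n. \<Sum>j<n. (if i = j then (c i)\<^sup>2 else 0) + c i * c j * tcoef p (real i - real j))"
    by (intro sum.cong refl) (auto simp: power2_eq_square algebra_simps)
  finally show ?thesis by (simp add: sum.distrib)
qed

lemma char_obs: "(CLINT x|M. iexp (\<Sum>i<n. c i * obs i x)) = complex_of_real (exp (- bform (Sig n) (vec n c) (vec n c) / 2))"
proof -
  define v where "v = (\<Sum>i<n. \<Sum>j<n. c i * c j * (b0 * Kmat \<nu> \<theta>0 (real (Suc j) * \<delta> - real (Suc i) * \<delta>)))"
  have "b0 * Kmat \<nu> \<theta>0 (real (Suc j) * \<delta> - real (Suc i) * \<delta>) = tcoef p (real i - real j)" for i j
    using Kmat_nat[OF theta0_range, of b0 i j] Kmat_minus[of \<theta>0 "\<delta> * (real i - real j)"] by (simp add: algebra_simps)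
  then have v: "v = (\<Sum>i<n. \<Sum>j<n. c i * c j * tcoef p (real i - real j))" by (simp only: v_def)
  have "v = bform (toep n p) (vec n c) (vec n c)"
    unfolding v by (subst bform_sum[of _ n]) (auto simp: toep_index mult_ac intro!: sum.cong)
  then have "0 \<le> v" using toep_quad_nonneg[OF p_cont p_nonneg, of "vec n c" n] by (simp add: bform_def)
  from linear_combination_char[OF Zgp eps_normal eps_indep Z_eps_indep v_def this]
  show ?thesis unfolding obs_def bform_Sig v by (simp add: add.commute)
qed

text \<open>One operator bound for the covariances of all sizes, fixed by choice because it enters
  every variance estimate.\<close>

definition Sig_bound :: real where "Sig_bound = (SOME s. 0 < s \<and> (\<forall>n. opb n s (Sig n)))"

lemma Sig_bound: "0 < Sig_bound" "opb n Sig_bound (Sig n)"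
proof -
  obtain C where "0 < C" "\<And>n. opb n C (toep n p)" using opb_toep_ex[OF p_cont] by blast
  then have "0 < 1 + C \<and> (\<forall>n. opb n (1 + C) (Sig n))" unfolding Sig_def by (auto intro!: opb_add opb_one)
  then have "0 < Sig_bound \<and> (\<forall>n. opb n Sig_bound (Sig n))" unfolding Sig_bound_def by (rule someI)
  then show "0 < Sig_bound" "opb n Sig_bound (Sig n)" by auto
qed

lemma Sig_lower: "x \<in> carrier_vec n \<Longrightarrow> (vnorm x)\<^sup>2 \<le> bform (Sig n) x x"
proof -
  assume x: "x \<in> carrier_vec n"
  have "bform (Sig n) x x = x \<bullet> x + x \<bullet> (toep n p *\<^sub>v x)"
    unfolding bform_def Sig_def using x scalar_prod_add_distrib[OF x x mult_mat_vec_carrier[OF toep_carrier x], of p]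
    by (simp add: add_mult_distrib_mat_vec[of _ n n])
  then show ?thesis using toep_quad_nonneg[OF p_cont p_nonneg x] by (simp add: vnorm_sq)
qed

lemma pencil_obs: "T \<in> carrier_mat n n \<Longrightarrow> T\<^sup>T = T \<Longrightarrow> pencil n (M0 n) (Sig n) T Sig_bound"
  by unfold_locales (auto simp: M0_transpose inv0 Sig_bound Sig_lower)

lemma quadratic_obs:
  assumes T: "T \<in> carrier_mat n n" "T\<^sup>T = T" "opb n c T"
  shows "\<exists>\<gamma> w. (\<forall>j<n. w j \<in> borel_measurable M) \<and> (\<forall>j<n. distr M borel (w j) = std_normal_distribution) \<and> indep_vars (\<lambda>_. borel) w {..<n} \<and>
     (\<forall>x. bform T (yv n x) (yv n x) - mtrace (T * Sig n) = (\<Sum>j<n. \<gamma> j * ((w j x)\<^sup>2 - 1))) \<and>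
     (\<Sum>j<n. (\<gamma> j)\<^sup>2) = mtrace ((T * Sig n) * (T * Sig n)) \<and> (\<forall>j<n. \<bar>\<gamma> j\<bar> \<le> c * Sig_bound\<^sup>2)"
  unfolding yv_def by (rule quadratic_representation[OF pencil_obs[OF T(1,2)] obs_measurable char_obs T(3)])

lemma bform_measurable: "T \<in> carrier_mat n n \<Longrightarrow> (\<lambda>x. bform T (yv n x) (yv n x)) \<in> borel_measurable M"
  using obs_measurable by (subst bform_sum[of _ n]) (auto simp: yv_def intro!: borel_measurable_sum borel_measurable_times)

lemma quadratic_deviation:
  assumes T: "T \<in> carrier_mat n n" "T\<^sup>T = T" "opb n c T" and a: "0 < a"
  shows "prob {x \<in> space M. a \<le> \<bar>bform T (yv n x) (yv n x) - mtrace (T * Sig n)\<bar>} \<le> 2 * (c * Sig_bound)\<^sup>2 * real n / a\<^sup>2"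
proof -
  obtain \<gamma> w where gw: "\<forall>j<n. w j \<in> borel_measurable M" "\<forall>j<n. distr M borel (w j) = std_normal_distribution" "indep_vars (\<lambda>_. borel) w {..<n}"
    and eq: "\<And>x. bform T (yv n x) (yv n x) - mtrace (T * Sig n) = (\<Sum>j<n. \<gamma> j * ((w j x)\<^sup>2 - 1))"
    and g2: "(\<Sum>j<n. (\<gamma> j)\<^sup>2) = mtrace ((T * Sig n) * (T * Sig n))"
    using quadratic_obs[OF T] by blast
  have "opb n (c * Sig_bound * (c * Sig_bound)) ((T * Sig n) * (T * Sig n))" by (intro opb_mult T Sig_bound)
  then have "(\<Sum>j<n. (\<gamma> j)\<^sup>2) \<le> (c * Sig_bound)\<^sup>2 * real n"
    unfolding g2 using mtrace_opb_le[of n "c * Sig_bound * (c * Sig_bound)" "(T * Sig n) * (T * Sig n)"] by (simp add: power2_eq_square)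
  then have "2 * (\<Sum>j<n. (\<gamma> j)\<^sup>2) / a\<^sup>2 \<le> 2 * (c * Sig_bound)\<^sup>2 * real n / a\<^sup>2" by (intro divide_right_mono) auto
  moreover have "prob {x \<in> space M. a \<le> \<bar>\<Sum>j<n. \<gamma> j * ((w j x)\<^sup>2 - 1)\<bar>} \<le> 2 * (\<Sum>j<n. (\<gamma> j)\<^sup>2) / a\<^sup>2"
    using gw by (intro second_moment_quadratic a) auto
  ultimately show ?thesis unfolding eq by linarith
qed

text \<open>\<open>M0\<close> is the inverse covariance \<open>1 - A\<close>. \<open>B\<close> is
  the matrix \<open>A (1 - A)\<close> of the score; at \<open>\<theta>0\<close>, \<open>P1\<close>
  is the derivative of \<open>A\<close> in \<open>\<theta>\<close>, and \<open>slope\<close> is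
  minus that of \<open>A (1 - A)\<close>.\<close>

definition P1 :: "nat \<Rightarrow> real mat" where "P1 n = M0 n * toep n q * M0 n"
definition slope :: "nat \<Rightarrow> real mat" where "slope n = P1 n - M0 n * P1 n - P1 n * M0 n"
definition B :: "nat \<Rightarrow> real mat" where "B n = (1\<^sub>m n - M0 n) * M0 n"

lemma carriers [simp]: "M0 n \<in> carrier_mat n n" "P1 n \<in> carrier_mat n n" "slope n \<in> carrier_mat n n" "B n \<in> carrier_mat n n"
  using inv0(1)[of n] by (auto simp: P1_def slope_def B_def)

lemma transposes: "(P1 n)\<^sup>T = P1 n" "(slope n)\<^sup>T = slope n" "(B n)\<^sup>T = B n"
proof -
  note X = mat_expand[where n=n]
  show P: "(P1 n)\<^sup>T = P1 n"
  proof -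
    have "(P1 n)\<^sup>T = (M0 n)\<^sup>T * (M0 n * toep n q)\<^sup>T" unfolding P1_def by (rule transpose_mult[of _ n n _ n]) (auto intro!: mult_carrier_mat)
    also have "(M0 n * toep n q)\<^sup>T = (toep n q)\<^sup>T * (M0 n)\<^sup>T" by (rule transpose_mult[of _ n n _ n]) auto
    also have "(M0 n)\<^sup>T * ((toep n q)\<^sup>T * (M0 n)\<^sup>T) = M0 n * toep n q * M0 n" by (simp add: M0_transpose X)
    finally show ?thesis by (simp add: P1_def)
  qed
  have "(slope n)\<^sup>T = (P1 n)\<^sup>T - (M0 n * P1 n)\<^sup>T - (P1 n * M0 n)\<^sup>T"
    unfolding slope_def transpose_minus_mat[OF minus_carrier_mat[OF mult_carrier_mat[OF carriers(1,2)]] mult_carrier_mat[OF carriers(2,1)]]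
      transpose_minus_mat[OF carriers(2) mult_carrier_mat[OF carriers(1,2)]] ..
  also have "(M0 n * P1 n)\<^sup>T = P1 n * M0 n" by (subst transpose_mult[of _ n n _ n]) (auto simp: P M0_transpose)
  also have "(P1 n * M0 n)\<^sup>T = M0 n * P1 n" by (subst transpose_mult[of _ n n _ n]) (auto simp: P M0_transpose)
  finally show "(slope n)\<^sup>T = slope n"
    unfolding P slope_def mat_minus_swap[OF carriers(2) mult_carrier_mat[OF carriers(2,1)] mult_carrier_mat[OF carriers(1,2)]] .
  have "B n = M0 n - M0 n * M0 n" unfolding B_def by (simp add: X left_mult_one_mat[OF carriers(1)])
  moreover have "(M0 n - M0 n * M0 n)\<^sup>T = (M0 n)\<^sup>T - (M0 n * M0 n)\<^sup>T" by (rule transpose_minus_mat[OF carriers(1) mult_carrier_mat[OF carriers(1,1)]])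
  moreover have "(M0 n * M0 n)\<^sup>T = M0 n * M0 n" by (subst transpose_mult[of _ n n _ n]) (auto simp: M0_transpose)
  ultimately show "(B n)\<^sup>T = B n" by (simp add: M0_transpose)
qed

text \<open>\<open>Sig\<close> cancels the factor \<open>M0 = 1 - A\<close>, and \<open>A\<close> is
  left: the form in the score has mean \<open>tr A\<close>, so the estimating equation is unbiased
  at the truth.\<close>

lemma B_Sig: "B n * Sig n = 1\<^sub>m n - M0 n"
proof -
  have "B n * Sig n = (1\<^sub>m n - M0 n) * (M0 n * Sig n)" unfolding B_def
    by (rule assoc_mult_mat[of _ n n _ n _ n]) (auto intro!: minus_carrier_mat)
  then show ?thesis unfolding inv0 by (simp add: right_mult_one_mat[of _ n n] minus_carrier_mat)
qed

lemma T0_M0: "toep n p * M0 n = 1\<^sub>m n - M0 n"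
proof -
  have "M0 n + toep n p * M0 n = Sig n * M0 n" unfolding Sig_def
    by (simp add: mat_expand[where n=n] left_mult_one_mat[OF carriers(1)])
  then have "M0 n + toep n p * M0 n = 1\<^sub>m n" by (simp add: inv0)
  from mat_eq_diff[OF carriers(1) mult_carrier_mat[OF toep_carrier carriers(1)] this] show ?thesis .
qed

lemma score_obs: "score n (toep n p * M0 n) (yv n x) = bform (B n) (yv n x) (yv n x) - mtrace (B n * Sig n)"
proof -
  have "1\<^sub>m n - (1\<^sub>m n - M0 n) = M0 n" by (auto intro!: eq_matI)
  then show ?thesis unfolding score_def T0_M0 B_Sig bform_def by (simp add: B_def)
qed

text \<open>By \<open>M0 Sig = 1\<close> and cyclicity,
  \<open>tr (slope Sig) = tr (P1 Sig) - 2 tr P1\<close>; as \<open>Sig = 1 + T(p)\<close>, adding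
  \<open>tr P1\<close> leaves \<open>tr (P1 T(p))\<close>.\<close>

lemma slope_trace: "mtrace (slope n * Sig n) + mtrace (P1 n) = mtrace (M0 n * toep n q * M0 n * toep n p)"
proof -
  note X = mat_expand[where n=n]
  have 1: "slope n * Sig n = P1 n * Sig n - M0 n * (P1 n * Sig n) - P1 n"
  proof -
    have "slope n * Sig n = P1 n * Sig n - M0 n * P1 n * Sig n - P1 n * M0 n * Sig n"
      unfolding slope_def X(2)[OF minus_carrier_mat[OF mult_carrier_mat[OF carriers(1,2)]] mult_carrier_mat[OF carriers(2,1)] Sig_carrier]
        X(2)[OF carriers(2) mult_carrier_mat[OF carriers(1,2)] Sig_carrier] ..
    also have "P1 n * M0 n * Sig n = P1 n * (M0 n * Sig n)" by (rule assoc_mult_mat[of _ n n _ n _ n]) auto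
    also have "M0 n * P1 n * Sig n = M0 n * (P1 n * Sig n)" by (rule assoc_mult_mat[of _ n n _ n _ n]) auto
    finally show ?thesis unfolding inv0 right_mult_one_mat[OF carriers(2)] .
  qed
  have 2: "mtrace (M0 n * (P1 n * Sig n)) = mtrace (P1 n)"
  proof -
    have "mtrace (M0 n * (P1 n * Sig n)) = mtrace (P1 n * Sig n * M0 n)"
      by (rule mtrace_comm[OF carriers(1) mult_carrier_mat[OF carriers(2) Sig_carrier]])
    also have "P1 n * Sig n * M0 n = P1 n * (Sig n * M0 n)" by (rule assoc_mult_mat[of _ n n _ n _ n]) auto
    finally show ?thesis unfolding inv0 right_mult_one_mat[OF carriers(2)] .
  qed
  have 3: "P1 n * Sig n = P1 n + P1 n * toep n p" unfolding Sig_def by (simp add: X(3) right_mult_one_mat[OF carriers(2)])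
  have "mtrace (slope n * Sig n) = mtrace (P1 n * Sig n) - mtrace (M0 n * (P1 n * Sig n)) - mtrace (P1 n)"
    unfolding 1 mtrace_diff[OF minus_carrier_mat[OF mult_carrier_mat[OF carriers(1) mult_carrier_mat[OF carriers(2) Sig_carrier]]] carriers(2)]
      mtrace_diff[OF mult_carrier_mat[OF carriers(2) Sig_carrier] mult_carrier_mat[OF carriers(1) mult_carrier_mat[OF carriers(2) Sig_carrier]]] ..
  also have "mtrace (P1 n * Sig n) = mtrace (P1 n) + mtrace (P1 n * toep n p)" unfolding 3
    by (rule mtrace_add[OF carriers(2) mult_carrier_mat[OF carriers(2) toep_carrier]])
  finally show ?thesis unfolding 2 by (simp add: P1_def)
qed

text \<open>\<open>2 * Ia\<close> is the limiting variance of the score divided by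
  \<open>sqrt n\<close>; \<open>Iah\<close> is the limit of the slope divided by
  \<open>n\<close>.\<close>

definition Ia :: real where "Ia = integral {-pi..pi} (\<lambda>x. (adelta \<nu> \<delta> b0 \<theta>0 x)\<^sup>2) / (2 * pi)"
definition Iah :: real where "Iah = integral {-pi..pi} (\<lambda>x. (adelta \<nu> \<delta> b0 \<theta>0 x)\<^sup>2 * hdelta \<nu> \<delta> \<theta>0 x) / (2 * pi)"

lemma trace_limits:
  "(\<lambda>n. mtrace ((B n * Sig n) * (B n * Sig n)) / real n) \<longlonglongrightarrow> Ia"
  "(\<lambda>n. (mtrace (slope n * Sig n) + mtrace (P1 n)) / real n) \<longlonglongrightarrow> Iah"
proof -
  note L = score_traces[OF p_cont p_nonneg symbol_even(1)[OF theta0_range] q_cont symbol_even(2)[OF theta0_range], folded M0_def]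
  have "Ia = integral {-pi..pi} (\<lambda>x. (p x / (1 + p x))\<^sup>2) / (2 * pi)"
    unfolding Ia_def by (intro arg_cong2[where f="(/)"] integral_cong refl) (simp add: adelta_eq_symbol[OF theta0_range b0])
  then show "(\<lambda>n. mtrace ((B n * Sig n) * (B n * Sig n)) / real n) \<longlonglongrightarrow> Ia" unfolding B_Sig using L(1) by simp
  have "Iah = integral {-pi..pi} (\<lambda>x. q x * p x / (1 + p x)\<^sup>2) / (2 * pi)"
    unfolding Iah_def by (intro arg_cong2[where f="(/)"] integral_cong refl) (simp add: weighted_hdelta_eq_symbol[OF th0 b0])
  then show "(\<lambda>n. (mtrace (slope n * Sig n) + mtrace (P1 n)) / real n) \<longlonglongrightarrow> Iah" unfolding slope_trace using L(2) by simp
qed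

lemma B_opb: "opb n 2 (B n)"
proof -
  have "opb n ((1 + 1) * 1) (B n)" unfolding B_def by (intro opb_mult opb_diff opb_one inv0)
  then show ?thesis by simp
qed

text \<open>The limit is the characteristic function of a centred normal law with variance
  \<open>2 * Ia\<close>; the factor two is the variance of a squared standard normal.\<close>

lemma score_clt:
  "(\<lambda>n. char (distr M borel (\<lambda>x. score n (toep n p * M0 n) (yv n x) / sqrt (real n))) t) \<longlonglongrightarrow> exp (- Ia * t\<^sup>2)"
proof -
  have "\<forall>n. \<exists>\<gamma> w. (\<forall>j<n. w j \<in> borel_measurable M) \<and> (\<forall>j<n. distr M borel (w j) = std_normal_distribution) \<and> indep_vars (\<lambda>_. borel) w {..<n} \<and>
     (\<forall>x. bform (B n) (yv n x) (yv n x) - mtrace (B n * Sig n) = (\<Sum>j<n. \<gamma> j * ((w j x)\<^sup>2 - 1))) \<and>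
     (\<Sum>j<n. (\<gamma> j)\<^sup>2) = mtrace ((B n * Sig n) * (B n * Sig n)) \<and> (\<forall>j<n. \<bar>\<gamma> j\<bar> \<le> 2 * Sig_bound\<^sup>2)"
    by (intro allI quadratic_obs transposes B_opb carriers)
  then obtain \<gamma> w where gw: "\<And>n. (\<forall>j<n. w n j \<in> borel_measurable M) \<and> (\<forall>j<n. distr M borel (w n j) = std_normal_distribution) \<and> indep_vars (\<lambda>_. borel) (w n) {..<n} \<and>
     (\<forall>x. bform (B n) (yv n x) (yv n x) - mtrace (B n * Sig n) = (\<Sum>j<n. \<gamma> n j * ((w n j x)\<^sup>2 - 1))) \<and>
     (\<Sum>j<n. (\<gamma> n j)\<^sup>2) = mtrace ((B n * Sig n) * (B n * Sig n)) \<and> (\<forall>j<n. \<bar>\<gamma> n j\<bar> \<le> 2 * Sig_bound\<^sup>2)"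
    by (atomize_elim, subst (asm) choice_iff, subst (asm) choice_iff) blast
  have "(\<lambda>n. char (distr M borel (\<lambda>x. (\<Sum>j<n. \<gamma> n j * ((w n j x)\<^sup>2 - 1)) / sqrt (real n))) t) \<longlonglongrightarrow> exp (- Ia * t\<^sup>2)"
  proof (rule quadratic_clt)
    show "(\<lambda>n. (\<Sum>j<n. (\<gamma> n j)\<^sup>2) / real n) \<longlonglongrightarrow> Ia" using trace_limits(1) gw by simp
  qed (use gw in auto)
  moreover have "(\<Sum>j<n. \<gamma> n j * ((w n j x)\<^sup>2 - 1)) = score n (toep n p * M0 n) (yv n x)" for n x using gw by (simp add: score_obs)
  ultimately show ?thesis by simp
qed

text \<open>A law of large numbers by Chebyshev: the form has variance O(n), so after division by
  \<open>n\<close> only its mean survives, which \<open>trace_limits\<close> identifies.\<close>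

lemma slope_to_zero:
  "to_zero (\<lambda>n x. (bform (slope n) (yv n x) (yv n x) + mtrace (P1 n)) / real n - Iah)"
proof (rule to_zeroI_bound)
  fix n show "(\<lambda>x. (bform (slope n) (yv n x) (yv n x) + mtrace (P1 n)) / real n - Iah) \<in> borel_measurable M"
    using bform_measurable[of "slope n" n] by simp
next
  fix e :: real assume e: "0 < e"
  obtain C where C: "\<And>n. opb n C (toep n q)" using opb_toep_ex[OF q_cont] by blast
  define c where "c = 1 * C * 1 + 1 * (1 * C * 1) + 1 * C * 1 * 1"
  have so: "opb n c (slope n)" for n unfolding c_def slope_def P1_def by (intro opb_diff opb_mult C inv0)
  have "(\<lambda>n. 8 * (c * Sig_bound)\<^sup>2 / e\<^sup>2 / real n) \<longlonglongrightarrow> 0" by real_asymp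
  moreover have "eventually (\<lambda>n. prob {x \<in> space M. e < \<bar>(bform (slope n) (yv n x) (yv n x) + mtrace (P1 n)) / real n - Iah\<bar>} \<le> 8 * (c * Sig_bound)\<^sup>2 / e\<^sup>2 / real n) sequentially"
  proof -
    have "eventually (\<lambda>n. \<bar>(mtrace (slope n * Sig n) + mtrace (P1 n)) / real n - Iah\<bar> < e / 2) sequentially"
      using tendstoD[OF trace_limits(2), of "e/2"] e by (simp add: dist_real_def)
    then show ?thesis using eventually_gt_at_top[of 0]
    proof eventually_elim
      case (elim n)
      then have n: "0 < n" by simp
      have "{x \<in> space M. e < \<bar>(bform (slope n) (yv n x) (yv n x) + mtrace (P1 n)) / real n - Iah\<bar>} \<subseteq>
        {x \<in> space M. real n * (e / 2) \<le> \<bar>bform (slope n) (yv n x) (yv n x) - mtrace (slope n * Sig n)\<bar>}"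
      proof clarify
        fix x assume x: "e < \<bar>(bform (slope n) (yv n x) (yv n x) + mtrace (P1 n)) / real n - Iah\<bar>"
        have "(bform (slope n) (yv n x) (yv n x) + mtrace (P1 n)) / real n - Iah =
          (bform (slope n) (yv n x) (yv n x) - mtrace (slope n * Sig n)) / real n + ((mtrace (slope n * Sig n) + mtrace (P1 n)) / real n - Iah)"
          by (simp add: add_divide_distrib diff_divide_distrib)
        then have "e / 2 \<le> \<bar>(bform (slope n) (yv n x) (yv n x) - mtrace (slope n * Sig n)) / real n\<bar>" using x elim by linarith
        then show "real n * (e / 2) \<le> \<bar>bform (slope n) (yv n x) (yv n x) - mtrace (slope n * Sig n)\<bar>"
          using n by (simp add: abs_divide pos_le_divide_eq mult.commute)
      qed
      then have "prob {x \<in> space M. e < \<bar>(bform (slope n) (yv n x) (yv n x) + mtrace (P1 n)) / real n - Iah\<bar>} \<le>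
        prob {x \<in> space M. real n * (e / 2) \<le> \<bar>bform (slope n) (yv n x) (yv n x) - mtrace (slope n * Sig n)\<bar>}"
        using bform_measurable[of "slope n" n] by (intro finite_measure_mono) auto
      also have "\<dots> \<le> 2 * (c * Sig_bound)\<^sup>2 * real n / (real n * (e / 2))\<^sup>2"
        using n e by (intro quadratic_deviation so transposes carriers) auto
      also have "\<dots> = 8 * (c * Sig_bound)\<^sup>2 / e\<^sup>2 / real n"
      proof -
        have "2 * z * N / (N * (e / 2))\<^sup>2 = 8 * z / e\<^sup>2 / N" if "0 < N" for z N :: real
          using that e by (simp add: power2_eq_square)
        then show ?thesis using n by simp
      qed
      finally show ?case .
    qed
  qed
  ultimately show "\<exists>f. f \<longlonglongrightarrow> 0 \<and> eventually (\<lambda>n. prob {x \<in> space M. e < \<bar>(bform (slope n) (yv n x) (yv n x) + mtrace (P1 n)) / real n - Iah\<bar>} \<le> f n) sequentially"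
    by blast
qed

lemma norm_obs_measurable: "(\<lambda>x. (vnorm (yv n x))\<^sup>2) \<in> borel_measurable M"
proof -
  have "(vnorm (yv n x))\<^sup>2 = bform (1\<^sub>m n) (yv n x) (yv n x)" for x by (simp add: vnorm_sq bform_def)
  then show ?thesis using bform_measurable[of "1\<^sub>m n" n] by simp
qed

text \<open>The identity matrix in \<open>quadratic_deviation\<close>; the mean of
  \<open>|y|^2\<close> is at most \<open>Sig_bound * n\<close>.\<close>

lemma norm_obs_deviation:
  assumes n: "0 < n"
  shows "prob {x \<in> space M. Sig_bound + 1 < (vnorm (yv n x))\<^sup>2 / real n} \<le> 2 * Sig_bound\<^sup>2 / real n"
proof -
  have eq: "(vnorm (yv n x))\<^sup>2 = bform (1\<^sub>m n) (yv n x) (yv n x)" for x by (simp add: vnorm_sq bform_def)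
  have tr: "mtrace (1\<^sub>m n * Sig n) \<le> Sig_bound * real n" using mtrace_opb_le[OF Sig_bound(2)[of n]] unfolding left_mult_one_mat[OF Sig_carrier] by linarith
  have "{x \<in> space M. Sig_bound + 1 < (vnorm (yv n x))\<^sup>2 / real n} \<subseteq> {x \<in> space M. real n \<le> \<bar>bform (1\<^sub>m n) (yv n x) (yv n x) - mtrace (1\<^sub>m n * Sig n)\<bar>}"
  proof clarify
    fix x assume "Sig_bound + 1 < (vnorm (yv n x))\<^sup>2 / real n"
    then have "(Sig_bound + 1) * real n < bform (1\<^sub>m n) (yv n x) (yv n x)" using n by (simp add: pos_less_divide_eq eq)
    then show "real n \<le> \<bar>bform (1\<^sub>m n) (yv n x) (yv n x) - mtrace (1\<^sub>m n * Sig n)\<bar>" using tr by (simp add: algebra_simps)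
  qed
  then have "prob {x \<in> space M. Sig_bound + 1 < (vnorm (yv n x))\<^sup>2 / real n} \<le> prob {x \<in> space M. real n \<le> \<bar>bform (1\<^sub>m n) (yv n x) (yv n x) - mtrace (1\<^sub>m n * Sig n)\<bar>}"
    using bform_measurable[of "1\<^sub>m n" n] by (intro finite_measure_mono) auto
  also have "\<dots> \<le> 2 * (1 * Sig_bound)\<^sup>2 * real n / (real n)\<^sup>2" using n by (intro quadratic_deviation opb_one) auto
  also have "\<dots> = 2 * Sig_bound\<^sup>2 / real n" using n by (simp add: power2_eq_square)
  finally show ?thesis .
qed

text \<open>Consistency makes the distance to \<open>\<theta>0\<close> small, and
  \<open>norm_obs_deviation\<close> keeps the last factor bounded in probability.\<close>

lemma remainder_to_zero:
  assumes tm[measurable]: "\<And>n. \<theta>hat n \<in> borel_measurable M" and K: "0 < K"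
    and cons: "\<And>e. e > 0 \<Longrightarrow> (\<lambda>n. prob {x \<in> space M. \<bar>\<theta>hat n x - \<theta>0\<bar> > e}) \<longlonglongrightarrow> 0"
  shows "to_zero (\<lambda>n x. K * \<bar>\<theta>hat n x - \<theta>0\<bar> * ((vnorm (yv n x))\<^sup>2 / real n + 1))"
proof (rule to_zeroI_bound)
  fix n show "(\<lambda>x. K * \<bar>\<theta>hat n x - \<theta>0\<bar> * ((vnorm (yv n x))\<^sup>2 / real n + 1)) \<in> borel_measurable M"
    using norm_obs_measurable[of n] tm[of n] by measurable
next
  fix e :: real assume e: "0 < e"
  \<comment> \<open>Outside an event of vanishing probability the last factor is at most
    \<open>Sig_bound + 2\<close>.\<close>
  define e' where "e' = e / (K * (Sig_bound + 2))"
  have e': "0 < e'" using e K Sig_bound(1) by (simp add: e'_def)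
  let ?A = "\<lambda>n. {x \<in> space M. \<bar>\<theta>hat n x - \<theta>0\<bar> > e'}" and ?Q = "\<lambda>n. {x \<in> space M. Sig_bound + 1 < (vnorm (yv n x))\<^sup>2 / real n}"
  have "(\<lambda>n. prob (?A n) + 2 * Sig_bound\<^sup>2 / real n) \<longlonglongrightarrow> 0 + 0"
    by (intro tendsto_add cons[OF e']) real_asymp
  moreover have "eventually (\<lambda>n. prob {x \<in> space M. e < \<bar>K * \<bar>\<theta>hat n x - \<theta>0\<bar> * ((vnorm (yv n x))\<^sup>2 / real n + 1)\<bar>} \<le> prob (?A n) + 2 * Sig_bound\<^sup>2 / real n) sequentially"
    using eventually_gt_at_top[of 0]
  proof eventually_elim
    case (elim n)
    have Am: "?A n \<in> sets M" using tm[of n] by measurable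
    have Qm: "?Q n \<in> sets M" using norm_obs_measurable[of n] by measurable
    have "{x \<in> space M. e < \<bar>K * \<bar>\<theta>hat n x - \<theta>0\<bar> * ((vnorm (yv n x))\<^sup>2 / real n + 1)\<bar>} \<subseteq> ?A n \<union> ?Q n"
    proof (rule subsetI, rule ccontr)
      fix x assume x: "x \<in> {x \<in> space M. e < \<bar>K * \<bar>\<theta>hat n x - \<theta>0\<bar> * ((vnorm (yv n x))\<^sup>2 / real n + 1)\<bar>}" and nx: "x \<notin> ?A n \<union> ?Q n"
      then have h: "\<bar>\<theta>hat n x - \<theta>0\<bar> \<le> e'" "(vnorm (yv n x))\<^sup>2 / real n \<le> Sig_bound + 1" by auto
      have "K * \<bar>\<theta>hat n x - \<theta>0\<bar> * ((vnorm (yv n x))\<^sup>2 / real n + 1) \<le> K * e' * (Sig_bound + 2)"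
        using h K e' by (intro mult_mono) auto
      also have "\<dots> = e" using K Sig_bound(1) by (simp add: e'_def)
      finally have "K * \<bar>\<theta>hat n x - \<theta>0\<bar> * ((vnorm (yv n x))\<^sup>2 / real n + 1) \<le> e" .
      moreover have "0 \<le> K * \<bar>\<theta>hat n x - \<theta>0\<bar> * ((vnorm (yv n x))\<^sup>2 / real n + 1)" using K by (intro mult_nonneg_nonneg add_nonneg_nonneg divide_nonneg_nonneg) auto
      ultimately show False using x by simp
    qed
    then have "prob {x \<in> space M. e < \<bar>K * \<bar>\<theta>hat n x - \<theta>0\<bar> * ((vnorm (yv n x))\<^sup>2 / real n + 1)\<bar>} \<le> prob (?A n \<union> ?Q n)"
      using Am Qm by (intro finite_measure_mono) auto
    also have "\<dots> \<le> prob (?A n) + prob (?Q n)" using Am Qm by (intro measure_Un_le) auto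
    also have "prob (?Q n) \<le> 2 * Sig_bound\<^sup>2 / real n" using elim by (intro norm_obs_deviation) auto
    finally show ?case by simp
  qed
  ultimately show "\<exists>f. f \<longlonglongrightarrow> 0 \<and> eventually (\<lambda>n. prob {x \<in> space M. e < \<bar>K * \<bar>\<theta>hat n x - \<theta>0\<bar> * ((vnorm (yv n x))\<^sup>2 / real n + 1)\<bar>} \<le> f n) sequentially"
    by auto
qed

text \<open>At the root the score vanishes; dividing its expansion by \<open>sqrt n\<close> gives
  the shape of \<open>root_linearisation\<close>. The limit law is that of the scaled score divided
  by \<open>Iah\<close>, and convergence of characteristic functions gives weak convergence.\<close>

lemma root_asymptotically_normal:
  assumes tm: "\<And>n. \<theta>hat n \<in> borel_measurable M"
    and root: "(\<lambda>n. prob {x \<in> space M. \<theta>hat n x \<in> {lo..hi} \<and> GE0_eq \<nu> \<delta> b0 (\<theta>hat n x) n (yv n x)}) \<longlonglongrightarrow> 1"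
    and cons: "\<And>e. e > 0 \<Longrightarrow> (\<lambda>n. prob {x \<in> space M. \<bar>\<theta>hat n x - \<theta>0\<bar> > e}) \<longlonglongrightarrow> 0"
    and nd: "integral {-pi..pi} (\<lambda>x. (adelta \<nu> \<delta> b0 \<theta>0 x)\<^sup>2 * hdelta \<nu> \<delta> \<theta>0 x) \<noteq> 0"
  shows "weak_conv_m (\<lambda>n. distr M borel (\<lambda>x. sqrt (real n) * (\<theta>hat n x - \<theta>0)))
           (density lborel (normal_density 0 (sqrt (avarGE0 \<nu> \<delta> b0 \<theta>0))))"
proof -
  have v: "Iah \<noteq> 0" using nd by (simp add: Iah_def)
  define W where "W n x = sqrt (real n) * (\<theta>hat n x - \<theta>0)" for n x
  define X where "X n x = score n (toep n p * M0 n) (yv n x) / sqrt (real n)" for n x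
  define D where "D n x = (bform (slope n) (yv n x) (yv n x) + mtrace (P1 n)) / real n" for n x
  obtain K0 where K0: "0 \<le> K0" and exp: "\<And>n y \<theta>. y \<in> carrier_vec n \<Longrightarrow> lo \<le> \<theta> \<Longrightarrow> \<theta> \<le> hi \<Longrightarrow> \<bar>\<theta> - \<theta>0\<bar> \<le> 1 \<Longrightarrow>
     \<bar>score n (toep n (symbol b0 \<theta>) * toepinv n (symbol b0 \<theta>)) y - score n (toep n p * M0 n) y
       + (\<theta> - \<theta>0) * (bform (slope n) y y + mtrace (P1 n))\<bar> \<le> K0 * (\<theta> - \<theta>0)\<^sup>2 * ((vnorm y)\<^sup>2 + real n)"
    using score_local_expansion[OF b0 theta0_range] unfolding M0_def slope_def P1_def by blast
  \<comment> \<open>\<open>K0 + 1\<close> instead of \<open>K0\<close>: then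
    \<open>|R| \<le> 1\<close> forces the distance to \<open>\<theta>0\<close> to be at most 1, the
    range in which the expansion holds.\<close>
  define R where "R n x = (K0 + 1) * \<bar>\<theta>hat n x - \<theta>0\<bar> * ((vnorm (yv n x))\<^sup>2 / real n + 1)" for n x
  define E where "E n = {x \<in> space M. \<theta>hat n x \<in> {lo..hi} \<and> GE0_eq \<nu> \<delta> b0 (\<theta>hat n x) n (yv n x)}" for n
  have Xm: "X n \<in> borel_measurable M" for n
    unfolding X_def score_obs using bform_measurable[of "B n" n] by simp
  have Wm: "W n \<in> borel_measurable M" for n unfolding W_def using tm[of n] by measurable
  have "to_zero (\<lambda>n x. W n x - X n x / Iah)"
  proof (rule root_linearisation[where D=D and R=R and E=E and C="2 * (2 * Sig_bound)\<^sup>2"])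
    show "to_zero (\<lambda>n x. D n x - Iah)" unfolding D_def by (rule slope_to_zero)
    show "to_zero R" unfolding R_def[abs_def] using K0 by (intro remainder_to_zero tm cons) auto
    show "(\<lambda>n. prob (E n)) \<longlonglongrightarrow> 1" unfolding E_def by (rule root)
    show "Iah \<noteq> 0" by (rule v)
  next
    fix n x assume x: "x \<in> E n" "x \<in> space M" and R1: "\<bar>R n x\<bar> \<le> 1"
    define \<tau> where "\<tau> = \<theta>hat n x - \<theta>0"
    define Q where "Q = (vnorm (yv n x))\<^sup>2"
    have Q0: "0 \<le> Q" by (simp add: Q_def)
    have Rn: "\<bar>R n x\<bar> = (K0 + 1) * \<bar>\<tau>\<bar> * (Q / real n + 1)"
      using K0 Q0 by (simp add: R_def \<tau>_def Q_def abs_mult)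
    have t: "lo \<le> \<theta>hat n x" "\<theta>hat n x \<le> hi" and ge: "GE0_eq \<nu> \<delta> b0 (\<theta>hat n x) n (yv n x)" using x by (auto simp: E_def)
    have "\<bar>\<tau>\<bar> \<le> (K0 + 1) * \<bar>\<tau>\<bar> * (Q / real n + 1)"
    proof -
      have "1 * \<bar>\<tau>\<bar> * 1 \<le> (K0 + 1) * \<bar>\<tau>\<bar> * (Q / real n + 1)" using K0 Q0 by (intro mult_mono) auto
      then show ?thesis by simp
    qed
    then have t1: "\<bar>\<tau>\<bar> \<le> 1" using R1 unfolding Rn by linarith
    have "score n (toep n (symbol b0 (\<theta>hat n x)) * toepinv n (symbol b0 (\<theta>hat n x))) (yv n x) = 0"
      using ge GE0_eq_iff[OF t] by simp
    then have main: "\<bar>score n (toep n p * M0 n) (yv n x) - \<tau> * (bform (slope n) (yv n x) (yv n x) + mtrace (P1 n))\<bar> \<le> K0 * \<tau>\<^sup>2 * (Q + real n)"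
      using exp[OF yv_carrier t, of n x] t1 unfolding \<tau>_def Q_def by linarith
    show "\<bar>X n x - W n x * D n x\<bar> \<le> \<bar>W n x\<bar> * \<bar>R n x\<bar>"
    proof (cases "n = 0")
      case True
      then show ?thesis by (simp add: X_def W_def)
    next
      case False
      define r where "r = sqrt (real n)"
      have r: "0 < r" and rr: "real n = r * r" using False by (auto simp: r_def)
      have "X n x - W n x * D n x = (score n (toep n p * M0 n) (yv n x) - \<tau> * (bform (slope n) (yv n x) (yv n x) + mtrace (P1 n))) / r"
      proof -
        have rS: "r * \<tau> * (S / real n) = \<tau> * S / r" for S unfolding rr using r by simp
        show ?thesis unfolding X_def W_def D_def r_def[symmetric] \<tau>_def[symmetric] rS by (simp add: diff_divide_distrib)
      qed
      then have "\<bar>X n x - W n x * D n x\<bar> = \<bar>score n (toep n p * M0 n) (yv n x) - \<tau> * (bform (slope n) (yv n x) (yv n x) + mtrace (P1 n))\<bar> / r"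
        using r by simp
      also have "\<dots> \<le> K0 * \<tau>\<^sup>2 * (Q + real n) / r" using main r by (intro divide_right_mono) auto
      also have "\<dots> = (r * \<bar>\<tau>\<bar>) * (K0 * \<bar>\<tau>\<bar> * (Q / real n + 1))"
      proof -
        have 1: "(Q + real n) / r = r * (Q / real n + 1)" unfolding rr using r by (simp add: add_divide_distrib distrib_left)
        have 2: "\<tau>\<^sup>2 = \<bar>\<tau>\<bar> * \<bar>\<tau>\<bar>" by (simp add: power2_eq_square)
        have "K0 * \<tau>\<^sup>2 * (Q + real n) / r = K0 * \<tau>\<^sup>2 * ((Q + real n) / r)" by simp
        then show ?thesis unfolding 1 unfolding 2 by (simp only: mult_ac)
      qed
      also have "\<dots> \<le> (r * \<bar>\<tau>\<bar>) * ((K0 + 1) * \<bar>\<tau>\<bar> * (Q / real n + 1))"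
        using K0 Q0 r by (intro mult_left_mono mult_right_mono) auto
      also have "\<dots> = \<bar>W n x\<bar> * \<bar>R n x\<bar>" unfolding Rn using r by (simp add: W_def \<tau>_def abs_mult r_def)
      finally show ?thesis .
    qed
  next
    fix n :: nat and L :: real assume n: "0 < n" and L: "0 < L"
    have "{x \<in> space M. L \<le> \<bar>X n x\<bar>} = {x \<in> space M. sqrt (real n) * L \<le> \<bar>bform (B n) (yv n x) (yv n x) - mtrace (B n * Sig n)\<bar>}"
      using n by (auto simp: X_def score_obs abs_divide pos_le_divide_eq mult.commute)
    then have "prob {x \<in> space M. L \<le> \<bar>X n x\<bar>} \<le> 2 * (2 * Sig_bound)\<^sup>2 * real n / (sqrt (real n) * L)\<^sup>2"
      using quadratic_deviation[OF carriers(4)[of n] transposes(3) B_opb, where a="sqrt (real n) * L"] n L by simp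
    also have "\<dots> = 2 * (2 * Sig_bound)\<^sup>2 / L\<^sup>2" using n by (simp add: power_mult_distrib)
    finally show "prob {x \<in> space M. L \<le> \<bar>X n x\<bar>} \<le> 2 * (2 * Sig_bound)\<^sup>2 / L\<^sup>2" .
  qed (use Xm Wm in auto)
  note lin = this
  define av where "av = avarGE0 \<nu> \<delta> b0 \<theta>0"
  have Iap: "0 < Ia" unfolding Ia_def using weight_integral_pos[OF th0 b0] by simp
  \<comment> \<open>The factors \<open>2 pi\<close> inside \<open>Ia\<close> and \<open>Iah\<close>
    turn the 2 into \<open>4 pi\<close>.\<close>
  have av: "av = 2 * Ia / Iah\<^sup>2"
  proof -
    have "2 * (A / (2 * pi)) / (H / (2 * pi))\<^sup>2 = 4 * pi * A / H\<^sup>2" for A H :: real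
      by (simp add: power_divide power2_eq_square)
    then show ?thesis by (simp add: av_def avarGE0_def Ia_def Iah_def)
  qed
  have avp: "0 < av" using Iap v by (simp add: av)
  have "(\<lambda>n. char (distr M borel (W n)) t) \<longlonglongrightarrow> char (density lborel (normal_density 0 (sqrt av))) t" for t
  proof (rule char_tendsto_of_to_zero[OF Wm _ lin])
    show "(\<lambda>x. X n x / Iah) \<in> borel_measurable M" for n using Xm[of n] by measurable
    have c1: "char (distr M borel (\<lambda>x. X n x / Iah)) t = char (distr M borel (X n)) (t / Iah)" for n :: nat
    proof -
      have [measurable]: "X n \<in> borel_measurable M" by (rule Xm)
      show ?thesis by (simp add: char_def integral_distr)
    qed
    have c2: "(\<lambda>n. char (distr M borel (X n)) (t / Iah)) \<longlonglongrightarrow> exp (- Ia * (t / Iah)\<^sup>2)"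
      unfolding X_def[abs_def] by (rule score_clt)
    have c3: "- Ia * (t / Iah)\<^sup>2 = - (sqrt av * t)\<^sup>2 / 2"
      using avp by (simp add: power_mult_distrib av power_divide)
    have "0 < sqrt av" using avp by simp
    from char_normal_density(2)[OF this, of t]
    show "(\<lambda>n. char (distr M borel (\<lambda>x. X n x / Iah)) t) \<longlonglongrightarrow> char (density lborel (normal_density 0 (sqrt av))) t"
      unfolding c1 using c2 unfolding c3 by (simp only:)
  qed
  then show ?thesis unfolding av_def[symmetric] W_def[abs_def, symmetric]
    using Wm avp by (intro levy_continuity char_normal_density(1)) (auto simp: W_def[abs_def])
qed

end

text \<open>A compact interval that avoids 0 and has \<open>\<theta>0 > 0\<close> in its interior is
  \<open>{lo..hi}\<close> with \<open>0 < lo\<close>. The root is understood in probability: the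
  equation holds at \<open>\<theta>hat n\<close>, inside the interval, with probability tending to
  one.\<close>

theorem theorem4p3:
  fixes M :: "'a measure" and Z :: "real \<Rightarrow> 'a \<Rightarrow> real" and eps :: "nat \<Rightarrow> 'a \<Rightarrow> real"
    and \<nu> \<delta> b0 \<theta>0 lo hi :: real and \<theta>hat :: "nat \<Rightarrow> 'a \<Rightarrow> real"
  assumes nu: "\<nu> \<ge> 1/2"
    and delta: "\<delta> > 0"
    and b0: "b0 > 0"
    and Theta: "0 < lo" "lo < \<theta>0" "\<theta>0 < hi"
    and P: "prob_space M"
    and Zgp: "gaussian_process M Z (\<lambda>s t. b0 * Kmat \<nu> \<theta>0 (t - s))"
    and eps_normal: "\<And>i. distributed M lborel (eps i) (normal_density 0 1)"
    and eps_indep: "prob_space.indep_vars M (\<lambda>_. borel) eps UNIV"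
    and Z_eps_indep: "prob_space.indep_set M
              (sigma_sets (space M) (\<Union>t. {Z t -` A \<inter> space M |A. A \<in> sets borel}))
              (sigma_sets (space M) (\<Union>i. {eps i -` A \<inter> space M |A. A \<in> sets borel}))"
    and est_meas: "\<And>n. \<theta>hat n \<in> borel_measurable M"
    and est_root: "(\<lambda>n. measure M {\<omega> \<in> space M. \<theta>hat n \<omega> \<in> {lo..hi} \<and>
                      GE0_eq \<nu> \<delta> b0 (\<theta>hat n \<omega>) n (vec n (\<lambda>i. Z (real (Suc i) * \<delta>) \<omega> + eps i \<omega>))})
                   \<longlonglongrightarrow> 1"
    and est_consistent: "\<And>e. e > 0 \<Longrightarrow>
                   (\<lambda>n. measure M {\<omega> \<in> space M. \<bar>\<theta>hat n \<omega> - \<theta>0\<bar> > e}) \<longlonglongrightarrow> 0"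
    and nondeg: "integral {-pi..pi} (\<lambda>x. (adelta \<nu> \<delta> b0 \<theta>0 x)\<^sup>2 * hdelta \<nu> \<delta> \<theta>0 x) \<noteq> 0"
  shows "weak_conv_m (\<lambda>n. distr M borel (\<lambda>\<omega>. sqrt (real n) * (\<theta>hat n \<omega> - \<theta>0)))
           (density lborel (normal_density 0 (sqrt (avarGE0 \<nu> \<delta> b0 \<theta>0))))
       \<and> I0 \<nu> \<delta> b0 \<theta>0 = 1 + Jfun (adelta \<nu> \<delta> b0 \<theta>0) (hdelta \<nu> \<delta> \<theta>0)
       \<and> ((\<lambda>d. I0 \<nu> d b0 \<theta>0) \<longlongrightarrow> 1) (at_right 0)"
proof (intro conjI)
  interpret noisy_matern M \<nu> \<delta> lo hi Z eps b0 \<theta>0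
    using assms by (auto simp: noisy_matern_def noisy_matern_axioms_def matern_def)
  show "weak_conv_m (\<lambda>n. distr M borel (\<lambda>\<omega>. sqrt (real n) * (\<theta>hat n \<omega> - \<theta>0)))
           (density lborel (normal_density 0 (sqrt (avarGE0 \<nu> \<delta> b0 \<theta>0))))"
    by (rule root_asymptotically_normal[OF est_meas est_root[folded obs_def yv_def] est_consistent nondeg])
  show "I0 \<nu> \<delta> b0 \<theta>0 = 1 + Jfun (adelta \<nu> \<delta> b0 \<theta>0) (hdelta \<nu> \<delta> \<theta>0)" by (rule I0_eq_Jfun)
  show "((\<lambda>d. I0 \<nu> d b0 \<theta>0) \<longlongrightarrow> 1) (at_right 0)"
    using Theta by (intro I0_tendsto_1 nu b0) auto
qed

end
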